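(* Let $G(z)$ be an $n$-th order system with impulse response $g$ and let $1\le k\le n$. Then the following are equivalent: (i) $G(z)$ is Hankel $\mathrm{OVD}_{k-1}$, i.e. its Hankel operator $\mathcal{H}_g$ is order preserving $(k-1)$-variation diminishing. (ii) $G(z)$ is Hankel $k$-positive. (iii) The compound systems $G_{[j]}(z)$ are externally positive for all $1\le j\le k$. (iv) $H_g(1,k-1)\succ 0$, $H_g(2,k-1)\succeq 0$, and $G_{[k]}(z)$ is externally positive. (v) $G_{[j]}(z)$ is Hankel $(k-j+1)$-positive for all $1\le j\le k$.
   Context: A system is a nonzero, strictly proper, real rational transfer function $G(z)=\sum_{t\ge 1} g(t)z^{-t}$ (so $g(0)=0$) whose poles and zeros are disjoint and whose impulse response $g$ is bounded; its order $n$ is its number of poles counted with multiplicity. For $t,j\ge 1$, $H_g(t,j)\in\mathbb{R}^{j\times j}$ is the Hankel matrix with $(a,b)$ entry $g(t+a+b-2)$; the conditions on $H_g(\cdot,0)$ in (iv) when $k=1$ are vacuous. $\succ 0$ / $\succeq 0$ mean symmetric positive definite / semidefinite. Hankel operator: for a bounded past input $u=(u(-1),u(-2),\dots)$ for which the sums converge and the output is bounded, $(\mathcal{H}_g u)(t)=\sum_{\tau=1}^\infty g(t+\tau)u(-\tau)$, $t\ge 0$. The rank of $\mathcal H_g$ is $n$. Variation: for a sequence or vector $u$, $\mathrm{S}(u)$ is the number of sign changes in $u$ after deleting all zero entries, with $\mathrm{S}(0)=0$. A linear map $X$ is order preserving $m$-variation diminishing ($\mathrm{OVD}_m$), $m\in\mathbb{Z}_{\ge0}$,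 if for all $u$ with $\mathrm{S}(u)\le m$: (a) $\mathrm{S}(Xu)\le\min\{\mathrm{rank}(X)-1,\mathrm{S}(u)\}$; (b) whenever $\mathrm{S}(u)=\mathrm{S}(Xu)$, the signs of the first nonzero elements of $u$ and of $Xu$ coincide (vacuous if $Xu=0$). For the Hankel operator, the past input is ordered as $u(-1),u(-2),\dots$ and the output as $y(0),y(1),\dots$. A matrix is $k$-positive if all its $j$-minors are nonnegative for $1\le j\le k$. A system with impulse response $g$ is Hankel $k$-positive if $H_g(1,N)$ is $k$-positive for all $N\ge k$. The $j$-th compound system $G_{[j]}(z)$ is the system with impulse response $g_{[j]}(t)=\det H_g(t,j)$, $t\ge 1$. A system is externally positive if its impulse response is nonnegative. *)

theory Defs
  imports Complex_Main
    "HOL-Library.Extended_Nat"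
    "HOL-Library.Function_Algebras"
    "HOL-Computational_Algebra.Polynomial"
    "Jordan_Normal_Form.Determinant"
    "Jordan_Normal_Form.DL_Submatrix"
begin

section \<open>Systems\<close>

text \<open>A real rational transfer function is given by its numerator \<open>P\<close> and denominator \<open>Q\<close>,
  whose complex roots are the zeros and poles once common roots are excluded.\<close>

abbreviation cpoly :: "real poly \<Rightarrow> complex poly" where
  "cpoly p \<equiv> map_poly complex_of_real p"

definition transfer :: "real poly \<Rightarrow> real poly \<Rightarrow> complex \<Rightarrow> complex" where
  "transfer P Q z = poly (cpoly P) z / poly (cpoly Q) z"

definition system_zeros :: "real poly \<Rightarrow> complex set" where
  "system_zeros P = {z. poly (cpoly P) z = 0}"

definition system_poles :: "real poly \<Rightarrow> complex set" where
  "system_poles Q = {z. poly (cpoly Q) z = 0}"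

definition is_system :: "real poly \<Rightarrow> real poly \<Rightarrow> (nat \<Rightarrow> real) \<Rightarrow> bool" where
  "is_system P Q g \<longleftrightarrow>
     P \<noteq> 0 \<and> degree P < degree Q \<and> system_zeros P \<inter> system_poles Q = {} \<and>
     g 0 = 0 \<and> Bseq g \<and>
     (\<forall>\<^sub>F z in at_infinity. (\<lambda>t. complex_of_real (g t) * inverse z ^ t) sums transfer P Q z)"

definition system_order :: "real poly \<Rightarrow> nat" where
  "system_order Q = (\<Sum>z\<in>system_poles Q. Polynomial.order z (cpoly Q))"

definition externally_positive :: "(nat \<Rightarrow> real) \<Rightarrow> bool" where
  "externally_positive g \<longleftrightarrow> (\<forall>t. g t \<ge> 0)"


section \<open>Hankel matrices and compound systems\<close>

text \<open>Matrix indices start at 0, so the entry in row \<open>a + 1\<close> and column \<open>b + 1\<close> is \<open>g (t + a + b)\<close>.\<close>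

definition hankel_mat :: "(nat \<Rightarrow> real) \<Rightarrow> nat \<Rightarrow> nat \<Rightarrow> real mat" where
  "hankel_mat g t j = mat j j (\<lambda>(a, b). g (t + a + b))"

definition compound :: "nat \<Rightarrow> (nat \<Rightarrow> real) \<Rightarrow> nat \<Rightarrow> real" where
  "compound j g t = (if t = 0 then 0 else det (hankel_mat g t j))"

definition pos_def :: "real mat \<Rightarrow> bool" where
  "pos_def A \<longleftrightarrow> square_mat A \<and> transpose_mat A = A \<and>
     (\<forall>v \<in> carrier_vec (dim_row A). v \<noteq> 0\<^sub>v (dim_row A) \<longrightarrow> v \<bullet> (A *\<^sub>v v) > 0)"

definition pos_semidef :: "real mat \<Rightarrow> bool" where
  "pos_semidef A \<longleftrightarrow> square_mat A \<and> transpose_mat A = A \<and>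
     (\<forall>v \<in> carrier_vec (dim_row A). v \<bullet> (A *\<^sub>v v) \<ge> 0)"

definition k_positive :: "nat \<Rightarrow> real mat \<Rightarrow> bool" where
  "k_positive k A \<longleftrightarrow>
     (\<forall>j\<in>{1..k}. \<forall>I \<subseteq> {..<dim_row A}. \<forall>J \<subseteq> {..<dim_col A}.
        card I = j \<longrightarrow> card J = j \<longrightarrow> det (submatrix A I J) \<ge> 0)"

definition hankel_k_positive :: "nat \<Rightarrow> (nat \<Rightarrow> real) \<Rightarrow> bool" where
  "hankel_k_positive k g \<longleftrightarrow> (\<forall>N\<ge>k. k_positive k (hankel_mat g 1 N))"


section \<open>The Hankel operator\<close>

text \<open>A past input \<open>u(-1), u(-2), \<dots>\<close> is stored as the sequence whose \<open>i\<close>-th term is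
  \<open>u(-(i + 1))\<close>.\<close>

definition hankel_op :: "(nat \<Rightarrow> real) \<Rightarrow> (nat \<Rightarrow> real) \<Rightarrow> (nat \<Rightarrow> real)" where
  "hankel_op g u t = (\<Sum>i. g (t + Suc i) * u i)"

definition hankel_domain :: "(nat \<Rightarrow> real) \<Rightarrow> (nat \<Rightarrow> real) set" where
  "hankel_domain g =
     {u. Bseq u \<and> (\<forall>t. summable (\<lambda>i. g (t + Suc i) * u i)) \<and> Bseq (hankel_op g u)}"


section \<open>Variation diminishing operators\<close>

text \<open>A sign change is a pair of nonzero entries of opposite sign with only zeros in between,
  that is, entries that become adjacent once the zeros are deleted.\<close>

definition sign_changes :: "(nat \<Rightarrow> real) \<Rightarrow> (nat \<times> nat) set" where
  "sign_changes u = {(i, j). i < j \<and> u i * u j < 0 \<and> (\<forall>m. i < m \<and> m < j \<longrightarrow> u m = 0)}"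

definition variation :: "(nat \<Rightarrow> real) \<Rightarrow> enat" where
  "variation u = (if finite (sign_changes u) then enat (card (sign_changes u)) else \<infinity>)"

definition first_sign :: "(nat \<Rightarrow> real) \<Rightarrow> real" where
  "first_sign u = sgn (u (LEAST i. u i \<noteq> 0))"

definition seq_scale :: "real \<Rightarrow> (nat \<Rightarrow> real) \<Rightarrow> (nat \<Rightarrow> real)" where
  "seq_scale c u = (\<lambda>i. c * u i)"

interpretation seq: vector_space seq_scale
  by unfold_locales (auto simp: seq_scale_def fun_eq_iff algebra_simps)

text \<open>The rank is the dimension of the range, assumed finite. The truncated subtraction in
  \<open>rank - 1\<close> differs from the integer one only for the zero operator.\<close>

definition op_rank :: "(nat \<Rightarrow> real) set \<Rightarrow> ((nat \<Rightarrow> real) \<Rightarrow> (nat \<Rightarrow> real)) \<Rightarrow> nat" where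
  "op_rank D X = seq.dim (X ` D)"

definition ovd ::
  "nat \<Rightarrow> (nat \<Rightarrow> real) set \<Rightarrow> ((nat \<Rightarrow> real) \<Rightarrow> (nat \<Rightarrow> real)) \<Rightarrow> bool" where
  "ovd m D X \<longleftrightarrow>
     (\<forall>u\<in>D. variation u \<le> enat m \<longrightarrow>
        variation (X u) \<le> min (enat (op_rank D X - 1)) (variation u) \<and>
        (variation u = variation (X u) \<and> X u \<noteq> (\<lambda>_. 0) \<longrightarrow> first_sign u = first_sign (X u)))"

definition hankel_ovd :: "nat \<Rightarrow> (nat \<Rightarrow> real) \<Rightarrow> bool" where
  "hankel_ovd m g \<longleftrightarrow> ovd m (hankel_domain g) (hankel_op g)"

end

(* Write c_j(t) for the Hankel determinant det H_g(t,j). All five conditions are shown equivalent to: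
   c_j(t) > 0 for j < k and c_k(t) >= 0, for all t >= 1.

   The identity c_{j+2}(t) c_j(t+2) = c_{j+1}(t) c_{j+1}(t+2) - c_{j+1}(t+1)^2 (Dodgson) makes c_{j+1}
   log-convex as soon as c_{j+2} >= 0, so a single zero of c_{j+1} forces c_{j+1} = 0 on all t >= 2. Then
   g satisfies a recurrence of order j there, hence one of order j + 1 < n throughout, which contradicts
   that the recurrence given by the denominator is the shortest one. This yields strictness in (iii) and,
   with the positivity of principal minors of definite matrices, in (iv).

   Minors with arbitrary rows and columns are reduced to the consecutive ones c_j by Fekete's argument:
   a row inserted into a gap gives, by a three-term Pluecker relation, a positive combination of minors
   with closer rows. A Cholesky factorization and the Cauchy-Binet formula make the matrices
   [c_j(t+a+b)] positive (semi)definite, which is (v).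

   For (i), a negative minor A yields the input adj(A) w with w alternating, which violates order
   preservation. Conversely, an input with m sign changes is split into its m + 1 blocks of constant
   sign; the minors of the matrix of block responses are nonnegative, and Cramer's rule shows that
   an output alternating m times begins with the first sign of the input. *)
theory Submission
  imports Defs
begin

text \<open>Nonnegative minors alone do not support the argument: Fekete's reduction divides by
  minors of the next lower order, and deriving (i) needs strictly positive cofactors. Hence the
  pivotal condition is strict below \<open>k\<close>. Minimality of the order is what excludes
  determinants that vanish from time 2 on.

  One identity serves twice: the three-term Pluecker relation gives the exchange of rows and, with
  unit rows in the first and last place, the Dodgson identity.

  In (i) an input may have infinitely many nonzero entries, and its series may converge only
  conditionally. Minors of the block responses are therefore treated as limits of minors of
  truncated sums; strict positivity survives the limit because one fixed positive term bounds all
  later truncations from below.\<close>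

section \<open>Determinants of real arrays\<close>


text \<open>Only the leading \<open>n\<close> by \<open>n\<close> part of the infinite array counts,
  so there are no carrier conditions; \<open>f i\<close> is a row, row replacement is
  \<open>f(p := x)\<close>, and passing to a submatrix is composition with index maps.\<close>

definition fdet :: "nat \<Rightarrow> (nat \<Rightarrow> nat \<Rightarrow> real) \<Rightarrow> real" where
  "fdet n f = det (mat n n (\<lambda>(i, j). f i j))"

definition fcof :: "nat \<Rightarrow> (nat \<Rightarrow> nat \<Rightarrow> real) \<Rightarrow> nat \<Rightarrow> nat \<Rightarrow> real" where
  "fcof n f i j = (-1) ^ (i + j) *
     fdet (n - 1) (\<lambda>a b. f (if a < i then a else Suc a) (if b < j then b else Suc b))"

lemma fdet_cong:
  assumes "\<And>i j. i < n \<Longrightarrow> j < n \<Longrightarrow> f i j = h i j"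
  shows "fdet n f = fdet n h"
  unfolding fdet_def by (rule arg_cong[of _ _ det]) (auto intro!: eq_matI simp: assms)

lemma fdet_0 [simp]: "fdet 0 f = 1"
  by (simp add: fdet_def)

lemma fdet_1: "fdet (Suc 0) f = f 0 0"
  unfolding fdet_def by (subst det_single) auto

lemma fdet_transpose: "fdet n (\<lambda>i j. f j i) = fdet n f"
proof -
  have "mat n n (\<lambda>(i, j). f j i) = transpose_mat (mat n n (\<lambda>(i, j). f i j))"
    by (rule eq_matI) auto
  then show ?thesis
    unfolding fdet_def by (simp add: det_transpose[of _ n])
qed

lemma fcof_eq_cofactor:
  assumes "i < n" "j < n"
  shows "cofactor (mat n n (\<lambda>(i, j). f i j)) i j = fcof n f i j"
  unfolding cofactor_def fcof_def fdet_def mat_delete_def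
  by (auto intro!: arg_cong[of _ _ det] eq_matI)

lemma laplace_row: "i < n \<Longrightarrow> fdet n f = (\<Sum>j<n. f i j * fcof n f i j)"
  unfolding fdet_def by (subst laplace_expansion_row[of _ n i]) (auto simp: fcof_eq_cofactor)

lemma laplace_col: "j < n \<Longrightarrow> fdet n f = (\<Sum>i<n. f i j * fcof n f i j)"
  unfolding fdet_def by (subst laplace_expansion_column[of _ n j]) (auto simp: fcof_eq_cofactor)

lemma fcof_upd_row: "fcof n (f(p := x)) p k = fcof n f p k"
  unfolding fcof_def by (auto intro!: fdet_cong)

lemma fdet_row_upd: "p < n \<Longrightarrow> fdet n (f(p := x)) = (\<Sum>k<n. x k * fcof n f p k)"
  by (subst laplace_row[of p]) (auto simp: fcof_upd_row)

lemma fdet_identical_rows: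
  assumes "i < n" "j < n" "i \<noteq> j" "\<And>k. k < n \<Longrightarrow> f i k = f j k"
  shows "fdet n f = 0"
  unfolding fdet_def
  by (rule Determinant.det_identical_rows[of _ n i j]) (use assms in \<open>auto intro!: eq_vecI\<close>)

lemma fdet_swap:
  assumes "i < n" "j < n" "i \<noteq> j"
  shows "fdet n (f(i := f j, j := f i)) = - fdet n f"
proof -
  have "mat n n (\<lambda>(a, b). (f(i := f j, j := f i)) a b) = swaprows i j (mat n n (\<lambda>(i, j). f i j))"
    by (rule eq_matI) (use assms in auto)
  moreover have "det (swaprows i j (mat n n (\<lambda>(i, j). f i j))) = - det (mat n n (\<lambda>(i, j). f i j))"
    by (rule det_swaprows) (use assms in auto)
  ultimately show ?thesis
    by (simp only: fdet_def)
qed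

text \<open>Overwriting column \<open>j\<close> by column \<open>i\<close> leaves the cofactors of
  column \<open>j\<close> alone; unless \<open>i = j\<close>, the sum is then the determinant of an
  array with two equal columns.\<close>

lemma fcof_col_orthogonal:
  assumes "i < n" "j < n"
  shows "(\<Sum>k<n. f k i * fcof n f k j) = (if i = j then fdet n f else 0)"
proof -
  define B where "B = (\<lambda>a b. if b = j then f a i else f a b)"
  have "(\<Sum>k<n. f k i * fcof n f k j) = (\<Sum>k<n. B k j * fcof n B k j)"
    by (rule sum.cong) (auto simp: B_def fcof_def intro!: fdet_cong)
  also have "\<dots> = fdet n B"
    using assms by (simp add: laplace_col[of j])
  also have "\<dots> = (if i = j then fdet n f else 0)"
  proof (cases "i = j")
    case True
    then show ?thesis by (auto simp: B_def intro!: fdet_cong)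
  next
    case False
    have "fdet n (\<lambda>a b. B b a) = 0"
      using assms False by (intro fdet_identical_rows[of i n j]) (auto simp: B_def)
    then show ?thesis using False fdet_transpose[of n B] by simp
  qed
  finally show ?thesis .
qed

text \<open>Cramer's rule freed of the division, so that it covers singular \<open>f\<close> too: a
  multiple of the row \<open>x\<close> is written in the rows of \<open>f\<close>.\<close>

lemma fdet_cramer:
  assumes "j < n"
  shows "fdet n f * x j = (\<Sum>i<n. fdet n (f(i := x)) * f i j)"
proof -
  have "(\<Sum>i<n. fdet n (f(i := x)) * f i j) = (\<Sum>i<n. \<Sum>k<n. x k * fcof n f i k * f i j)"
    by (simp add: fdet_row_upd sum_distrib_right)
  also have "\<dots> = (\<Sum>k<n. x k * (\<Sum>i<n. f i j * fcof n f i k))"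
    by (subst sum.swap) (simp add: sum_distrib_left mult_ac)
  also have "\<dots> = (\<Sum>k<n. x k * (if j = k then fdet n f else 0))"
    using assms by (intro sum.cong) (simp_all add: fcof_col_orthogonal)
  also have "\<dots> = fdet n f * x j"
    using assms by (simp add: if_distrib sum.delta mult.commute cong: if_cong)
  finally show ?thesis by simp
qed

text \<open>Expand \<open>c\<close> in the rows of the first matrix by Cramer's rule and put the result into slot \<open>p\<close>
  of the second matrix: only the rows in the slots \<open>p\<close> and \<open>q\<close> contribute.\<close>
lemma fdet_pluecker:
  assumes p: "p < n" and q: "q < n" and pq: "p \<noteq> q"
  shows "fdet n (f(p := a, q := b)) * fdet n (f(p := c, q := d)) =
         fdet n (f(p := c, q := b)) * fdet n (f(p := a, q := d)) +
         fdet n (f(p := a, q := c)) * fdet n (f(p := b, q := d))"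
proof -
  define A where "A = f(p := a, q := b)"
  define D where "D = f(q := d)"
  have up: "f(p := x, q := d) = D(p := x)" for x
    using pq by (auto simp: D_def fun_eq_iff)
  have "fdet n A * fdet n (D(p := c)) = (\<Sum>k<n. fdet n A * c k * fcof n D p k)"
    by (simp add: fdet_row_upd p sum_distrib_left mult_ac)
  also have "\<dots> = (\<Sum>k<n. \<Sum>i<n. fdet n (A(i := c)) * (A i k * fcof n D p k))"
    by (intro sum.cong refl) (simp add: fdet_cramer[of _ n A c] sum_distrib_right mult.assoc)
  also have "\<dots> = (\<Sum>i<n. fdet n (A(i := c)) * (\<Sum>k<n. A i k * fcof n D p k))"
    by (subst sum.swap) (simp add: sum_distrib_left)
  also have "\<dots> = (\<Sum>i<n. fdet n (A(i := c)) * fdet n (D(p := A i)))"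
    by (simp add: fdet_row_upd p)
  also have "\<dots> = (\<Sum>i\<in>{p, q}. fdet n (A(i := c)) * fdet n (D(p := A i)))"
  proof (rule sum.mono_neutral_right)
    show "\<forall>i\<in>{..<n} - {p, q}. fdet n (A(i := c)) * fdet n (D(p := A i)) = 0"
    proof
      fix i assume "i \<in> {..<n} - {p, q}"
      then have i: "i < n" "i \<noteq> p" "i \<noteq> q" by auto
      then have "D i = A i" by (simp add: A_def D_def)
      with i have "fdet n (D(p := A i)) = 0"
        using p by (intro fdet_identical_rows[of p n i]) simp_all
      then show "fdet n (A(i := c)) * fdet n (D(p := A i)) = 0" by simp
    qed
  qed (use p q in auto)
  also have "\<dots> = fdet n (A(p := c)) * fdet n (D(p := a)) + fdet n (A(q := c)) * fdet n (D(p := b))"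
    using pq by (simp add: A_def)
  finally have main: "fdet n A * fdet n (D(p := c)) =
    fdet n (A(p := c)) * fdet n (D(p := a)) + fdet n (A(q := c)) * fdet n (D(p := b))" .
  have "A(p := c) = f(p := c, q := b)" "A(q := c) = f(p := a, q := c)"
    using pq by (auto simp: A_def fun_eq_iff)
  with main show ?thesis by (simp only: up A_def)
qed

section \<open>Fekete's criterion for minors\<close>


text \<open>Polymorphic because it inserts rows as well as row indices; \<open>ins_comp\<close>
  translates between the two.\<close>

definition ins :: "nat \<Rightarrow> 'a \<Rightarrow> (nat \<Rightarrow> 'a) \<Rightarrow> nat \<Rightarrow> 'a" where
  "ins q y w = (\<lambda>i. if i < q then w i else if i = q then y else w (i - 1))"

lemma fdet_ins: "q < n \<Longrightarrow> fdet n (ins q y w) = (-1) ^ q * fdet n (ins 0 y w)"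
proof (induction q)
  case (Suc q)
  let ?f = "ins q y w"
  have eq: "ins (Suc q) y w = ?f(q := ?f (Suc q), Suc q := ?f q)"
    by (auto simp: ins_def fun_eq_iff)
  have "fdet n (ins (Suc q) y w) = - fdet n ?f"
    unfolding eq by (rule fdet_swap) (use Suc in auto)
  with Suc show ?case by simp
qed simp

lemma ins_comp: "ins q (v y) (\<lambda>i. v (w i)) = (\<lambda>i. v (ins q y w i))"
  by (auto simp: ins_def)

lemma fdet_ins_unit: "fdet (Suc m) (ins m (\<lambda>j. if j = m then 1 else 0) w) = fdet m w"
proof -
  let ?f = "ins m (\<lambda>j. if j = m then 1 else 0 :: real) w"
  have "fdet (Suc m) ?f = (\<Sum>j<Suc m. ?f m j * fcof (Suc m) ?f m j)"
    by (rule laplace_row) simp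
  also have "\<dots> = fcof (Suc m) ?f m m"
    by (simp add: ins_def)
  also have "\<dots> = fdet m w"
    by (simp add: fcof_def power_add flip: power_mult_distrib) (rule fdet_cong, simp add: ins_def)
  finally show ?thesis .
qed

lemma fdet_ins_ins:
  assumes "h \<le> m"
  shows "fdet (Suc (Suc m)) (ins 0 a (ins h b M)) =
         (-1) ^ h * fdet (Suc (Suc m)) (ins 0 a (ins 0 b M))"
proof -
  have eq: "ins 0 a (ins j b M) = ins (Suc j) b (ins 0 a M)" for j
    by (auto simp: ins_def fun_eq_iff)
  show ?thesis
    unfolding eq using assms by (subst (1 2) fdet_ins) auto
qed

text \<open>Bordering the two \<open>m\<close>-minors by a unit row turns this into a three-term Pluecker relation between
  determinants of size \<open>m + 1\<close>. Here \<open>r\<close> is \<open>v\<close> without its row \<open>q\<close>.\<close>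
lemma fekete_exchange:
  fixes v :: "nat \<Rightarrow> nat \<Rightarrow> real"
  assumes q: "1 \<le> q" "q \<le> m"
    and r_def: "r = (\<lambda>i. v (if i < q then i else Suc i))"
  shows "fdet (Suc m) r * fdet m (v \<circ> Suc) =
         fdet (Suc m) v * fdet m (r \<circ> Suc) + fdet (Suc m) (v \<circ> Suc) * fdet m r"
proof -
  obtain m' h where m: "m = Suc m'" and qh: "q = Suc h" and h: "h \<le> m'"
    using q by (cases m; cases q) auto
  have hm: "h < Suc m" using h m by simp
  \<comment> \<open>\<open>M\<close> lists the rows common to all the minors: \<open>v\<close>
    without its first row \<open>a\<close>, its last row \<open>b\<close> and the row
    \<open>y\<close> missing from \<open>r\<close>. Up to sign, each of the six minors is
    \<open>B\<close> of two of the rows \<open>a\<close>, \<open>b\<close>, \<open>y\<close>,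
    \<open>e\<close>.\<close>
  define M where "M = (\<lambda>i. v (if i < h then Suc i else Suc (Suc i)))"
  define e :: "nat \<Rightarrow> real" where "e = (\<lambda>j. if j = m then 1 else 0)"
  define a where "a = v 0"
  define b where "b = v (Suc m)"
  define y where "y = v q"
  define B where "B = (\<lambda>x z. fdet (Suc m) (ins 0 x (ins 0 z M)))"
  have B_ins: "fdet (Suc m) (ins 0 x (ins j z M)) = (-1) ^ j * B x z" if "j \<le> m'" for j x z
    using fdet_ins_ins[OF that] unfolding B_def m .
  have unit: "fdet m w = (-1) ^ m * fdet (Suc m) (ins 0 e w)" for w
    using fdet_ins_unit[of m w] fdet_ins[of m "Suc m" e w] by (simp add: e_def)
  define \<mu> where "\<mu> = (\<lambda>i. if i < h then Suc i else Suc (Suc i))"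
  have M: "M = (\<lambda>i. v (\<mu> i))"
    by (auto simp: M_def \<mu>_def)
  note idx = r_def M a_def b_def y_def ins_comp comp_def
  have "fdet (Suc m) r = fdet (Suc m) (ins 0 a (ins m' b M))"
    unfolding idx
    by (rule fdet_cong, rule fun_cong, rule arg_cong[of _ _ v]) (use h in \<open>auto simp: ins_def \<mu>_def qh m\<close>)
  then have 1: "fdet (Suc m) r = (-1) ^ m' * B a b"
    by (simp add: B_ins)
  have "fdet (Suc m) v = fdet (Suc m) (ins 0 a (ins h y M))"
    unfolding idx
    by (rule fdet_cong, rule fun_cong, rule arg_cong[of _ _ v]) (use h in \<open>auto simp: ins_def \<mu>_def qh m\<close>)
  then have 2: "fdet (Suc m) v = (-1) ^ h * B a y"
    using h by (simp add: B_ins)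
  have "fdet (Suc m) (v \<circ> Suc) = fdet (Suc m) (ins h y (ins m' b M))"
    unfolding idx
    by (rule fdet_cong, rule fun_cong, rule arg_cong[of _ _ v]) (use h in \<open>auto simp: ins_def \<mu>_def qh m\<close>)
  then have 3: "fdet (Suc m) (v \<circ> Suc) = (-1) ^ (h + m') * B y b"
    using fdet_ins[OF hm, of y "ins m' b M"] by (simp add: B_ins power_add)
  have "fdet m (v \<circ> Suc) = fdet m (ins h y M)"
    unfolding idx
    by (rule fdet_cong, rule fun_cong, rule arg_cong[of _ _ v]) (use h in \<open>auto simp: ins_def \<mu>_def qh m\<close>)
  then have 4: "fdet m (v \<circ> Suc) = (-1) ^ (m + h) * B e y"
    using h unit[of "ins h y M"] by (simp add: B_ins power_add)
  have "fdet m (r \<circ> Suc) = fdet m (ins m' b M)"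
    unfolding idx
    by (rule fdet_cong, rule fun_cong, rule arg_cong[of _ _ v]) (use h in \<open>auto simp: ins_def \<mu>_def qh m\<close>)
  then have 5: "fdet m (r \<circ> Suc) = (-1) ^ (m + m') * B e b"
    using unit[of "ins m' b M"] by (simp add: B_ins power_add)
  have "fdet m r = fdet m (ins 0 a M)"
    unfolding idx
    by (rule fdet_cong, rule fun_cong, rule arg_cong[of _ _ v]) (use h in \<open>auto simp: ins_def \<mu>_def qh m\<close>)
  then have 6: "fdet m r = (-1) ^ m * B e a"
    using unit[of "ins 0 a M"] by (simp add: B_def)
  have B_upd: "fdet (Suc m) ((ins 0 a (ins 0 b M))(0 := x, Suc 0 := z)) = B x z" for x z
    unfolding B_def by (rule arg_cong[of _ _ "fdet (Suc m)"]) (auto simp: ins_def fun_eq_iff)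
  have pl: "B a b * B e y = B e b * B a y + B a e * B b y"
    using fdet_pluecker[of 0 "Suc m" "Suc 0" "ins 0 a (ins 0 b M)" a b e y]
    unfolding B_upd by (simp add: m)
  have sw: "B x z = - B z x" for x z
  proof -
    let ?f = "ins 0 z (ins 0 x M)"
    have "ins 0 x (ins 0 z M) = ?f(0 := ?f (Suc 0), Suc 0 := ?f 0)"
      by (auto simp: ins_def fun_eq_iff)
    then show ?thesis
      unfolding B_def using fdet_swap[of 0 "Suc m" "Suc 0" ?f] by (simp add: m)
  qed
  have pl: "B a b * B e y = B a y * B e b + B y b * B e a"
    using pl sw[of a e] sw[of b y] by simp
  define \<sigma> \<tau> where "\<sigma> = ((-1) ^ m' :: real)" and "\<tau> = ((-1) ^ h :: real)"
  have ms: "(-1) ^ m = - \<sigma>" by (simp add: \<sigma>_def m)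
  have "\<sigma> * B a b * (- \<sigma> * \<tau> * B e y) = \<tau> * B a y * (- \<sigma> * \<sigma> * B e b) + \<tau> * \<sigma> * B y b * (- \<sigma> * B e a)"
  proof -
    have "\<sigma> * B a b * (- \<sigma> * \<tau> * B e y) = - (\<sigma> * \<sigma> * \<tau>) * (B a b * B e y)"
      by (simp add: mult_ac)
    also have "\<dots> = - (\<sigma> * \<sigma> * \<tau>) * (B a y * B e b + B y b * B e a)"
      by (simp only: pl)
    finally show ?thesis by (simp add: algebra_simps)
  qed
  then show ?thesis
    by (simp only: 1 2 3 4 5 6 power_add ms) (simp only: \<sigma>_def \<tau>_def)
qed

text \<open>Inserting a row into a gap reduces a minor to minors with closer rows.\<close>
lemma fekete_step:
  fixes Y :: "nat \<Rightarrow> nat \<Rightarrow> real" and P :: "real \<Rightarrow> bool"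
  assumes P: "P = (\<lambda>x. 0 < x) \<or> P = (\<lambda>x. 0 \<le> x)"
    and m: "\<And>r. (\<And>a. Suc a < m \<Longrightarrow> r a < r (Suc a)) \<Longrightarrow> 0 < fdet m (\<lambda>a. Y (r a))"
    and consec: "\<And>x. P (fdet (Suc m) (\<lambda>a. Y (x + a)))"
    and r: "\<And>a. a < m \<Longrightarrow> r a < r (Suc a)"
  shows "P (fdet (Suc m) (\<lambda>a. Y (r a)))"
  using r
proof (induction "r m - r 0" arbitrary: r rule: less_induct)
  case (less r)
  have mono: "r i \<le> r j" if "i \<le> j" "j \<le> m" for i j
    using that
  proof (induction j)
    case (Suc j)
    then show ?case using less.prems[of j] by (cases "i = Suc j") auto
  qed simp
  show ?case
  proof (cases "\<forall>a<m. r (Suc a) = Suc (r a)")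
    case True
    have "r a = r 0 + a" if "a \<le> m" for a
      using that by (induction a) (use True in auto)
    then have "fdet (Suc m) (\<lambda>a. Y (r a)) = fdet (Suc m) (\<lambda>a. Y (r 0 + a))"
      by (intro fdet_cong) (metis less_Suc_eq_le)
    then show ?thesis using consec[of "r 0"] by simp
  next
    case False
    then obtain q' where q': "q' < m" "r (Suc q') \<noteq> Suc (r q')" by auto
    have gap: "Suc (r q') < r (Suc q')" using less.prems[OF q'(1)] q'(2) by auto
    define q where "q = Suc q'"
    have q: "1 \<le> q" "q \<le> m" using q' by (auto simp: q_def)
    \<comment> \<open>Filling the gap makes room for descent: \<open>s\<close> without its last row
      and \<open>s\<close> without its first row both have a smaller spread than \<open>r\<close>,
      which is the induction measure.\<close>
    define s where "s = ins q (Suc (r q')) r"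
    have r_s: "r i = s (if i < q then i else Suc i)" for i
      by (auto simp: s_def ins_def)
    have smono: "s i < s (Suc i)" if i: "i \<le> m" for i
    proof -
      have "Suc i < q \<or> i = q' \<or> i = q \<or> i > q" unfolding q_def by linarith
      then consider "Suc i < q" | "i = q'" | "i = q" | "i > q" by blast
      then show ?thesis
      proof cases
        case 4
        then show ?thesis using less.prems[of "i - 1"] i by (auto simp: s_def ins_def)
      qed (use less.prems[of i] gap i q in \<open>auto simp: s_def ins_def q_def\<close>)
    qed
    have s0: "s 0 = r 0" using q by (simp add: s_def ins_def)
    have sm: "s m < r m" "s (Suc m) = r m"
      using q smono[of m] by (auto simp: s_def ins_def split: if_splits)
    have s1: "r 0 < s 1" using smono[of 0] s0 by simp
    have sm0: "r 0 < r m" using less.prems[of 0] mono[of 1 m] q by simp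
    have s1m: "s 1 \<le> r m"
      using q mono[of 1 m] gap mono[of "Suc q'" m] q'(1) by (auto simp: s_def ins_def q_def)
    let ?F = "\<lambda>n w. fdet n (\<lambda>a. Y (w a))"
    have A: "P (?F (Suc m) s)"
      by (rule less.hyps) (use sm s0 sm0 smono in auto)
    have B: "P (?F (Suc m) (\<lambda>i. s (Suc i)))"
      by (rule less.hyps) (use sm s1 sm0 s1m smono in auto)
    have pos: "?F m (\<lambda>i. s (Suc i)) > 0" "?F m (\<lambda>i. r (Suc i)) > 0" "?F m r > 0"
      by (auto intro!: m smono less.prems)
    have eq: "?F (Suc m) r * ?F m (\<lambda>i. s (Suc i)) =
        ?F (Suc m) s * ?F m (\<lambda>i. r (Suc i)) + ?F (Suc m) (\<lambda>i. s (Suc i)) * ?F m r"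
      using fekete_exchange[OF q, of "\<lambda>i. Y (r i)" "\<lambda>i. Y (s i)"] r_s by (simp add: comp_def)
    from P show ?thesis
    proof
      assume P: "P = (\<lambda>x. 0 < x)"
      then have "?F (Suc m) r * ?F m (\<lambda>i. s (Suc i)) > 0"
        unfolding eq using A B pos by (simp add: add_pos_pos)
      then show ?thesis using pos P by (simp add: zero_less_mult_iff)
    next
      assume P: "P = (\<lambda>x. 0 \<le> x)"
      then have "?F (Suc m) r * ?F m (\<lambda>i. s (Suc i)) \<ge> 0"
        unfolding eq using A B pos by simp
      then show ?thesis using pos P by (simp add: zero_le_mult_iff)
    qed
  qed
qed


text \<open>By induction on the order: the positive minors of order one less are the divisors that
  the exchange relation requires.\<close>

lemma fekete_rows_pos:
  assumes pos: "\<And>i x. i \<le> m \<Longrightarrow> 0 < fdet i (\<lambda>a. Y (x + a))"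
    and r: "\<And>a. Suc a < m \<Longrightarrow> r a < r (Suc a)"
  shows "0 < fdet m (\<lambda>a. Y (r a))"
  using assms
proof (induction m arbitrary: r)
  case (Suc m)
  have "0 < fdet m (\<lambda>a. Y (r a))" if "\<And>a. Suc a < m \<Longrightarrow> r a < r (Suc a)" for r
    by (rule Suc.IH) (use that Suc.prems(1) in simp_all)
  then show ?case
    using Suc.prems by (intro fekete_step[where P = "\<lambda>x. 0 < x" and Y = Y and r = r]) auto
qed simp

text \<open>The exchange relation is divided only by minors one order lower, so strictness below
  \<open>m\<close> suffices and order \<open>m\<close> itself may be merely nonnegative.\<close>

lemma fekete_rows_nonneg:
  assumes pos: "\<And>i x. i < m \<Longrightarrow> 0 < fdet i (\<lambda>a. Y (x + a))"
    and nonneg: "\<And>x. 0 \<le> fdet m (\<lambda>a. Y (x + a))"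
    and r: "\<And>a. Suc a < m \<Longrightarrow> r a < r (Suc a)"
  shows "0 \<le> fdet m (\<lambda>a. Y (r a))"
proof (cases m)
  case (Suc m')
  have "0 < fdet m' (\<lambda>a. Y (r a))" if "\<And>a. Suc a < m' \<Longrightarrow> r a < r (Suc a)" for r
    using that pos Suc by (intro fekete_rows_pos[where Y = Y and r = r]) auto
  then show ?thesis
    unfolding Suc using assms Suc by (intro fekete_step[where P = "\<lambda>x. 0 \<le> x" and Y = Y and r = r]) auto
qed simp

text \<open>The sequence c_j without the convention that \<open>compound\<close> makes at time 0.
  The determinant of size 0 is 1, which starts the inductions on \<open>j\<close>.\<close>

definition cdet :: "nat \<Rightarrow> (nat \<Rightarrow> real) \<Rightarrow> nat \<Rightarrow> real" where
  "cdet j g t = fdet j (\<lambda>a b. g (t + a + b))"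

lemma cdet_0 [simp]: "cdet 0 g t = 1"
  by (simp add: cdet_def)

lemma cdet_1 [simp]: "cdet (Suc 0) g t = g t"
  by (simp add: cdet_def fdet_1)

section \<open>Fekete's criterion for Hankel matrices\<close>

lemma fekete_hankel_rows:
  assumes pos: "\<And>i t. i \<le> m \<Longrightarrow> t0 \<le> t \<Longrightarrow> 0 < cdet i f t"
    and r: "\<And>a. Suc a < m \<Longrightarrow> r a < r (Suc a)"
  shows "0 < fdet m (\<lambda>a b. f (t0 + r a + (y + b)))"
proof (rule fekete_rows_pos[of m "\<lambda>x b. f (t0 + x + (y + b))"])
  fix i x assume "i \<le> m"
  then have "0 < cdet i f (t0 + x + y)" by (intro pos) auto
  then show "0 < fdet i (\<lambda>a b. f (t0 + (x + a) + (y + b)))"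
    by (simp add: cdet_def ac_simps)
qed (use r in auto)

lemma fekete_hankel_rows_nonneg:
  assumes pos: "\<And>i t. i < m \<Longrightarrow> t0 \<le> t \<Longrightarrow> 0 < cdet i f t"
    and nonneg: "\<And>t. t0 \<le> t \<Longrightarrow> 0 \<le> cdet m f t"
    and r: "\<And>a. Suc a < m \<Longrightarrow> r a < r (Suc a)"
  shows "0 \<le> fdet m (\<lambda>a b. f (t0 + r a + (y + b)))"
proof (rule fekete_rows_nonneg[of m "\<lambda>x b. f (t0 + x + (y + b))"])
  fix i x assume "i < m"
  then have "0 < cdet i f (t0 + x + y)" by (intro pos) auto
  then show "0 < fdet i (\<lambda>a b. f (t0 + (x + a) + (y + b)))"
    by (simp add: cdet_def ac_simps)
next
  fix x
  have "0 \<le> cdet m f (t0 + x + y)" by (intro nonneg) auto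
  then show "0 \<le> fdet m (\<lambda>a b. f (t0 + (x + a) + (y + b)))"
    by (simp add: cdet_def ac_simps)
qed (use r in auto)

text \<open>Fekete's reduction is used twice, for rows against consecutive columns and, after
  transposition, for columns against arbitrary rows. What remains are minors with consecutive rows
  and columns, and these are values of \<open>cdet\<close>.\<close>

lemma fekete_hankel_pos:
  assumes pos: "\<And>i t. i \<le> m \<Longrightarrow> t0 \<le> t \<Longrightarrow> 0 < cdet i f t"
    and r: "\<And>a. Suc a < m \<Longrightarrow> r a < r (Suc a)"
    and c: "\<And>a. Suc a < m \<Longrightarrow> c a < c (Suc a)"
  shows "0 < fdet m (\<lambda>a b. f (t0 + r a + c b))"
proof -
  have "0 < fdet m (\<lambda>a b. f (t0 + r b + c a))"
  proof (rule fekete_rows_pos[of m "\<lambda>x b. f (t0 + r b + x)"])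
    fix i x assume "i \<le> m"
    then have "0 < fdet i (\<lambda>a b. f (t0 + r a + (x + b)))"
      by (intro fekete_hankel_rows pos r) simp_all
    then show "0 < fdet i (\<lambda>a b. f (t0 + r b + (x + a)))"
      by (subst fdet_transpose)
  qed (use c in auto)
  then show ?thesis by (subst fdet_transpose)
qed

lemma fekete_hankel_nonneg:
  assumes pos: "\<And>i t. i < m \<Longrightarrow> t0 \<le> t \<Longrightarrow> 0 < cdet i f t"
    and nonneg: "\<And>t. t0 \<le> t \<Longrightarrow> 0 \<le> cdet m f t"
    and r: "\<And>a. Suc a < m \<Longrightarrow> r a < r (Suc a)"
    and c: "\<And>a. Suc a < m \<Longrightarrow> c a < c (Suc a)"
  shows "0 \<le> fdet m (\<lambda>a b. f (t0 + r a + c b))"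
proof -
  have "0 \<le> fdet m (\<lambda>a b. f (t0 + r b + c a))"
  proof (rule fekete_rows_nonneg[of m "\<lambda>x b. f (t0 + r b + x)"])
    fix i x assume "i < m"
    then have "0 < fdet i (\<lambda>a b. f (t0 + r a + (x + b)))"
      by (intro fekete_hankel_rows pos r) simp_all
    then show "0 < fdet i (\<lambda>a b. f (t0 + r b + (x + a)))"
      by (subst fdet_transpose)
  next
    fix x
    have "0 \<le> fdet m (\<lambda>a b. f (t0 + r a + (x + b)))"
      by (intro fekete_hankel_rows_nonneg pos nonneg r) simp_all
    then show "0 \<le> fdet m (\<lambda>a b. f (t0 + r b + (x + a)))"
      by (subst fdet_transpose)
  qed (use c in auto)
  then show ?thesis by (subst fdet_transpose)
qed

section \<open>Unit rows and Dodgson condensation\<close>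

lemma fdet_unit_row:
  assumes "p < n" "c < n" "\<And>k. k < n \<Longrightarrow> F p k = (if k = c then \<alpha> else 0)"
  shows "fdet n F = \<alpha> * (-1) ^ (p + c) *
    fdet (n - 1) (\<lambda>a b. F (if a < p then a else Suc a) (if b < c then b else Suc b))"
proof -
  have "fdet n F = (\<Sum>k<n. F p k * fcof n F p k)"
    by (rule laplace_row[OF assms(1)])
  also have "\<dots> = (\<Sum>k<n. if k = c then \<alpha> * fcof n F p k else 0)"
    using assms by (intro sum.cong) auto
  also have "\<dots> = \<alpha> * fcof n F p c"
    using assms by simp
  finally show ?thesis by (simp add: fcof_def mult.assoc)
qed

lemma fdet_unit_last_last:
  assumes "\<And>k. k \<le> q \<Longrightarrow> F q k = (if k = q then \<alpha> else 0)"
  shows "fdet (Suc q) F = \<alpha> * fdet q F"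
proof -
  have "fdet (Suc q) F = \<alpha> * (-1) ^ (q + q) * fdet q (\<lambda>a b. F (if a < q then a else Suc a) (if b < q then b else Suc b))"
    using fdet_unit_row[of q "Suc q" q F \<alpha>] assms by simp
  also have "fdet q (\<lambda>a b. F (if a < q then a else Suc a) (if b < q then b else Suc b)) = fdet q F"
    by (rule fdet_cong) simp
  finally show ?thesis by simp
qed

lemma fdet_unit_first_first:
  assumes "\<And>k. k \<le> q \<Longrightarrow> F 0 k = (if k = 0 then \<alpha> else 0)"
  shows "fdet (Suc q) F = \<alpha> * fdet q (\<lambda>a b. F (Suc a) (Suc b))"
  using fdet_unit_row[of 0 "Suc q" 0 F \<alpha>] assms by simp

lemma fdet_unit_last_first:
  assumes "\<And>k. k \<le> q \<Longrightarrow> F q k = (if k = 0 then \<alpha> else 0)"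
  shows "fdet (Suc q) F = \<alpha> * (-1) ^ q * fdet q (\<lambda>a b. F a (Suc b))"
proof -
  have "fdet (Suc q) F = \<alpha> * (-1) ^ q * fdet q (\<lambda>a b. F (if a < q then a else Suc a) (Suc b))"
    using fdet_unit_row[of q "Suc q" 0 F \<alpha>] assms by simp
  also have "fdet q (\<lambda>a b. F (if a < q then a else Suc a) (Suc b)) = fdet q (\<lambda>a b. F a (Suc b))"
    by (rule fdet_cong) simp
  finally show ?thesis .
qed

lemma fdet_unit_first_last:
  assumes "\<And>k. k \<le> q \<Longrightarrow> F 0 k = (if k = q then \<alpha> else 0)"
  shows "fdet (Suc q) F = \<alpha> * (-1) ^ q * fdet q (\<lambda>a b. F (Suc a) b)"
proof -
  have "fdet (Suc q) F = \<alpha> * (-1) ^ q * fdet q (\<lambda>a b. F (Suc a) (if b < q then b else Suc b))"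
    using fdet_unit_row[of 0 "Suc q" q F \<alpha>] assms by simp
  also have "fdet q (\<lambda>a b. F (Suc a) (if b < q then b else Suc b)) = fdet q (\<lambda>a b. F (Suc a) b)"
    by (rule fdet_cong) simp
  finally show ?thesis .
qed

text \<open>The Pluecker relation for the first and last rows, with the unit rows of the first and
  last columns as replacements: each unit row deletes a row and a column. Both mixed minors are the
  Hankel array shifted by one, so they give a square; its minus sign comes from swapping two
  rows.\<close>

lemma cdet_dodgson:
  "cdet (Suc (Suc j)) g t * cdet j g (Suc (Suc t)) =
   cdet (Suc j) g t * cdet (Suc j) g (Suc (Suc t)) - (cdet (Suc j) g (Suc t))\<^sup>2"
proof -
  define q where "q = Suc j"
  define n where "n = Suc q"
  define f where "f = (\<lambda>a b. g (t + a + b))"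
  define e0 :: "nat \<Rightarrow> real" where "e0 = (\<lambda>k. if k = 0 then 1 else 0)"
  define e1 :: "nat \<Rightarrow> real" where "e1 = (\<lambda>k. if k = q then 1 else 0)"
  define F where "F = (\<lambda>x y. f(0 := x, q := y))"
  have q: "q \<noteq> 0" and F0: "F x y 0 = x" and Fq: "F x y q = y"
    and Fo: "a \<noteq> 0 \<Longrightarrow> a \<noteq> q \<Longrightarrow> F x y a = f a" for x y a
    by (auto simp: q_def F_def)
  have "F (f 0) (f q) = f" by (simp add: F_def)
  then have f1: "fdet n (F (f 0) (f q)) = cdet (Suc (Suc j)) g t"
    by (simp add: cdet_def f_def n_def q_def)
  have "fdet n (F e0 e1) = fdet q (\<lambda>a b. F e0 e1 (Suc a) (Suc b))"
    unfolding n_def by (subst fdet_unit_first_first[of _ _ 1]) (auto simp: F0 e0_def)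
  also have "\<dots> = fdet j (\<lambda>a b. F e0 e1 (Suc a) (Suc b))"
    unfolding q_def by (subst fdet_unit_last_last[of _ _ 1]) (auto simp: Fq[unfolded q_def] e1_def q_def)
  also have "\<dots> = cdet j g (Suc (Suc t))"
    unfolding cdet_def by (rule fdet_cong) (simp add: Fo f_def q_def)
  finally have f2: "fdet n (F e0 e1) = cdet j g (Suc (Suc t))" .
  have "fdet n (F e0 (f q)) = fdet q (\<lambda>a b. F e0 (f q) (Suc a) (Suc b))"
    unfolding n_def by (subst fdet_unit_first_first[of _ _ 1]) (auto simp: F0 e0_def)
  also have "\<dots> = cdet (Suc j) g (Suc (Suc t))"
    unfolding cdet_def q_def by (rule fdet_cong) (simp add: F_def f_def q_def)
  finally have f3: "fdet n (F e0 (f q)) = cdet (Suc j) g (Suc (Suc t))" .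
  have "fdet n (F (f 0) e1) = fdet q (F (f 0) e1)"
    unfolding n_def by (subst fdet_unit_last_last[of _ _ 1]) (auto simp: Fq e1_def)
  also have "\<dots> = cdet (Suc j) g t"
    unfolding cdet_def q_def by (rule fdet_cong) (simp add: F_def f_def q_def)
  finally have f4: "fdet n (F (f 0) e1) = cdet (Suc j) g t" .
  have "fdet n (F (f 0) e0) = (-1) ^ q * fdet q (\<lambda>a b. F (f 0) e0 a (Suc b))"
    unfolding n_def by (subst fdet_unit_last_first[of _ _ 1]) (auto simp: Fq e0_def)
  also have "fdet q (\<lambda>a b. F (f 0) e0 a (Suc b)) = cdet (Suc j) g (Suc t)"
    unfolding cdet_def q_def by (rule fdet_cong) (simp add: F_def f_def q_def)
  finally have f5: "fdet n (F (f 0) e0) = (-1) ^ q * cdet (Suc j) g (Suc t)" .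
  have "F (f q) e1 = (F e1 (f q))(0 := F e1 (f q) q, q := F e1 (f q) 0)"
    using q by (auto simp: F_def fun_eq_iff)
  then have "fdet n (F (f q) e1) = - fdet n (F e1 (f q))"
    using fdet_swap[of 0 n q "F e1 (f q)"] q by (simp only: n_def)
  also have "fdet n (F e1 (f q)) = (-1) ^ q * fdet q (\<lambda>a b. F e1 (f q) (Suc a) b)"
    unfolding n_def by (subst fdet_unit_first_last[of _ _ 1]) (auto simp: F0 e1_def)
  also have "fdet q (\<lambda>a b. F e1 (f q) (Suc a) b) = cdet (Suc j) g (Suc t)"
    unfolding cdet_def q_def by (rule fdet_cong) (simp add: F_def f_def q_def)
  finally have f6: "fdet n (F (f q) e1) = - ((-1) ^ q * cdet (Suc j) g (Suc t))" .
  have sg: "(-1) ^ q * x * - ((-1) ^ q * x) = - (x\<^sup>2)" for x :: real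
  proof -
    have "(-1) ^ q * x * - ((-1) ^ q * x) = - ((-1) ^ (q + q) * (x * x))"
      by (simp only: power_add) (simp add: mult_ac)
    then show ?thesis by (simp add: power2_eq_square)
  qed
  have "fdet n (F (f 0) (f q)) * fdet n (F e0 e1) =
      fdet n (F e0 (f q)) * fdet n (F (f 0) e1) + fdet n (F (f 0) e0) * fdet n (F (f q) e1)"
    unfolding F_def by (rule fdet_pluecker) (auto simp: n_def q_def)
  then show ?thesis
    unfolding f1 f2 f3 f4 f5 f6 sg by (simp add: mult.commute)
qed

section \<open>Definite matrices and Cholesky factorization\<close>


lemma fdet_eq_0_iff:
  "fdet n f = 0 \<longleftrightarrow> (\<exists>x. (\<exists>b<n. x b \<noteq> 0) \<and> (\<forall>a<n. (\<Sum>b<n. f a b * x b) = 0))"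
proof -
  let ?A = "mat n n (\<lambda>(i, j). f i j)"
  have mv: "(?A *\<^sub>v v) $ a = (\<Sum>b<n. f a b * v $ b)" if "v \<in> carrier_vec n" "a < n" for v a
    using that by (auto simp: scalar_prod_def atLeast0LessThan intro!: sum.cong)
  have "fdet n f = 0 \<longleftrightarrow>
      (\<exists>v. v \<in> carrier_vec n \<and> v \<noteq> 0\<^sub>v n \<and> ?A *\<^sub>v v = 0\<^sub>v n)"
    unfolding fdet_def by (rule det_0_iff_vec_prod_zero_field) simp
  also have "\<dots> \<longleftrightarrow> (\<exists>x. (\<exists>b<n. x b \<noteq> 0) \<and> (\<forall>a<n. (\<Sum>b<n. f a b * x b) = 0))"
  proof safe
    fix v assume v: "v \<in> carrier_vec n" "v \<noteq> 0\<^sub>v n" "?A *\<^sub>v v = 0\<^sub>v n"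
    have "\<exists>b<n. v $ b \<noteq> 0"
    proof (rule ccontr)
      assume "\<not> ?thesis"
      then have "v = 0\<^sub>v n" using v(1) by (intro eq_vecI) auto
      with v show False by simp
    qed
    moreover have "(\<Sum>b<n. f a b * v $ b) = 0" if "a < n" for a
      using mv[OF v(1) that] v(3) that by simp
    ultimately show "\<exists>x. (\<exists>b<n. x b \<noteq> 0) \<and> (\<forall>a<n. (\<Sum>b<n. f a b * x b) = 0)"
      by (intro exI[of _ "\<lambda>b. v $ b"]) blast
  next
    fix x b assume x: "b < n" "x b \<noteq> 0" "\<forall>a<n. (\<Sum>b<n. f a b * x b) = 0"
    have "?A *\<^sub>v vec n x = 0\<^sub>v n"
      using x(3) by (intro eq_vecI) (simp_all add: mv del: index_mult_mat_vec)
    moreover have "vec n x \<noteq> 0\<^sub>v n"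
      using x(1,2) by (metis index_vec index_zero_vec(1))
    ultimately show "\<exists>v. v \<in> carrier_vec n \<and> v \<noteq> 0\<^sub>v n \<and> ?A *\<^sub>v v = 0\<^sub>v n"
      by (intro exI[of _ "vec n x"]) simp
  qed
  finally show ?thesis .
qed

lemma fdet_solve:
  assumes "fdet n f \<noteq> 0"
  shows "\<exists>x. \<forall>a<n. (\<Sum>b<n. f a b * x b) = w a"
proof (intro exI allI impI)
  fix a assume a: "a < n"
  let ?g = "\<lambda>i j. f j i"
  have "fdet n ?g * w a = (\<Sum>i<n. fdet n (?g(i := w)) * f a i)"
    by (rule fdet_cramer[OF a])
  then have "fdet n f * w a = (\<Sum>i<n. fdet n (?g(i := w)) * f a i)"
    by (simp only: fdet_transpose[of n f])
  then show "(\<Sum>b<n. f a b * (fdet n (?g(b := w)) / fdet n f)) = w a"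
    using assms by (simp add: sum_divide_distrib[symmetric] field_simps)
qed

lemma fdet_mult: "fdet n (\<lambda>a b. \<Sum>c<n. f a c * h c b) = fdet n f * fdet n h"
proof -
  let ?A = "mat n n (\<lambda>(i, j). f i j)" and ?B = "mat n n (\<lambda>(i, j). h i j)"
  have "mat n n (\<lambda>(a, b). \<Sum>c<n. f a c * h c b) = ?A * ?B"
    by (rule eq_matI) (auto simp: scalar_prod_def atLeast0LessThan)
  then show ?thesis
    unfolding fdet_def by (simp add: det_mult[of _ n])
qed

lemma fdet_leibniz: "fdet n f = (\<Sum>p | p permutes {..<n}. signof p * (\<Prod>i<n. f i (p i)))"
  unfolding fdet_def
  by (subst det_def'[of _ n])
    (auto simp: atLeast0LessThan permutes_in_image intro!: sum.cong prod.cong)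

lemma fdet_permute:
  assumes "p permutes {..<n}"
  shows "fdet n (\<lambda>i. f (p i)) = signof p * fdet n f"
proof -
  have p: "p permutes {0..<n}" using assms by (simp add: atLeast0LessThan)
  let ?A = "mat n n (\<lambda>(i, j). f i j)"
  have "mat n n (\<lambda>(i, j). f (p i) j) = mat n n (\<lambda>(i, j). ?A $$ (p i, j))"
    by (rule eq_matI) (use permutes_in_image[OF p] in auto)
  moreover have "det (mat n n (\<lambda>(i, j). ?A $$ (p i, j))) = signof p * det ?A"
    by (rule det_permute_rows[OF _ p]) simp
  ultimately show ?thesis
    by (simp only: fdet_def)
qed

lemma fdet_one: "fdet n (\<lambda>a b. if a = b then 1 else 0) = 1"
proof -
  have "mat n n (\<lambda>(i, j). if i = j then 1 else 0 :: real) = 1\<^sub>m n"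
    by (rule eq_matI) auto
  then show ?thesis by (simp add: fdet_def)
qed

lemma continuous_on_fdet:
  assumes "\<And>a b. a < n \<Longrightarrow> b < n \<Longrightarrow> continuous_on S (\<lambda>s. f s a b)"
  shows "continuous_on S (\<lambda>s. fdet n (f s))"
  unfolding fdet_leibniz
proof (intro continuous_intros)
  fix p i assume "p \<in> {p. p permutes {..<n}}" "i \<in> {..<n}"
  then show "continuous_on S (\<lambda>s. f s i (p i))"
    using permutes_in_image[of p "{..<n}" i] by (intro assms) auto
qed

lemma tendsto_fdet:
  assumes "\<And>a b. a < n \<Longrightarrow> b < n \<Longrightarrow> ((\<lambda>s. f s a b) \<longlongrightarrow> h a b) F"
  shows "((\<lambda>s. fdet n (f s)) \<longlongrightarrow> fdet n h) F"
  unfolding fdet_leibniz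
proof (intro tendsto_intros)
  fix p i assume "p \<in> {p. p permutes {..<n}}" "i \<in> {..<n}"
  then show "((\<lambda>s. f s i (p i)) \<longlongrightarrow> h i (p i)) F"
    using permutes_in_image[of p "{..<n}" i] by (intro assms) auto
qed

definition qform :: "nat \<Rightarrow> (nat \<Rightarrow> nat \<Rightarrow> real) \<Rightarrow> (nat \<Rightarrow> real) \<Rightarrow> real" where
  "qform n f x = (\<Sum>a<n. \<Sum>b<n. x a * f a b * x b)"

lemma qform_eq: "qform n f x = (\<Sum>a<n. x a * (\<Sum>b<n. f a b * x b))"
  by (simp add: qform_def sum_distrib_left mult.assoc)

lemma qform_homotopy:
  "qform n (\<lambda>a b. (1 - s) * f a b + s * (if a = b then 1 else 0)) x =
   (1 - s) * qform n f x + s * (\<Sum>a<n. (x a)\<^sup>2)"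
proof -
  have "(\<Sum>b<n. x a * ((1 - s) * f a b + s * (if a = b then 1 else 0)) * x b) =
      (1 - s) * (\<Sum>b<n. x a * f a b * x b) + s * (x a)\<^sup>2" if "a < n" for a
  proof -
    have "(\<Sum>b<n. x a * ((1 - s) * f a b + s * (if a = b then 1 else 0)) * x b) =
        (\<Sum>b<n. (1 - s) * (x a * f a b * x b) + (if a = b then s * (x a)\<^sup>2 else 0))"
      by (intro sum.cong refl) (simp add: algebra_simps power2_eq_square)
    also have "\<dots> = (1 - s) * (\<Sum>b<n. x a * f a b * x b) + s * (x a)\<^sup>2"
      using that by (simp add: sum.distrib sum_distrib_left)
    finally show ?thesis .
  qed
  then show ?thesis
    unfolding qform_def by (simp add: sum.distrib sum_distrib_left)
qed

text \<open>The form stays positive on the segment from \<open>f\<close> to the identity, so the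
  determinant has no zero there and keeps the sign it has at the identity.\<close>

lemma fdet_pos_if_qform_pos:
  assumes pos: "\<And>x. (\<exists>b<n. x b \<noteq> 0) \<Longrightarrow> 0 < qform n f x"
  shows "0 < fdet n f"
proof (rule ccontr)
  assume neg: "\<not> 0 < fdet n f"
  define F where "F = (\<lambda>s a b. (1 - s) * f a b + s * (if a = b then 1 else 0 :: real))"
  have cont: "continuous_on {0..1} (\<lambda>s. fdet n (F s))"
    unfolding F_def by (intro continuous_on_fdet continuous_intros)
  have "fdet n (F 0) \<le> 0"
    using neg by (simp add: F_def)
  moreover have "0 \<le> fdet n (F 1)"
    by (simp add: F_def fdet_one)
  ultimately obtain s where s: "0 \<le> s" "s \<le> 1" "fdet n (F s) = 0"
    using IVT'[of "\<lambda>s. fdet n (F s)" 0 0 1] cont by auto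
  then obtain x where x: "\<exists>b<n. x b \<noteq> 0" "\<forall>a<n. (\<Sum>b<n. F s a b * x b) = 0"
    by (auto simp: fdet_eq_0_iff)
  have "qform n (F s) x = 0"
    using x(2) by (simp add: qform_eq)
  then have "(1 - s) * qform n f x + s * (\<Sum>a<n. (x a)\<^sup>2) = 0"
    unfolding F_def qform_homotopy .
  moreover have "0 < (\<Sum>a<n. (x a)\<^sup>2)"
    using x(1) by (auto intro!: sum_pos2)
  moreover have "0 < qform n f x"
    using pos x(1) by blast
  ultimately show False
    using s by (cases "s = 0") (auto simp: add_nonneg_eq_0_iff)
qed

text \<open>For \<open>0 < s < 1\<close>, mixing in the identity makes the form strictly positive;
  the determinants tend to that of \<open>f\<close> as \<open>s\<close> decreases to 0.\<close>

lemma fdet_nonneg_if_qform_nonneg: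
  assumes nonneg: "\<And>x. 0 \<le> qform n f x"
  shows "0 \<le> fdet n f"
proof -
  define F where "F = (\<lambda>s a b. (1 - s) * f a b + s * (if a = b then 1 else 0 :: real))"
  have "0 < fdet n (F s)" if s: "0 < s" "s < 1" for s
  proof (rule fdet_pos_if_qform_pos)
    fix x :: "nat \<Rightarrow> real" assume "\<exists>b<n. x b \<noteq> 0"
    then have "0 < (\<Sum>a<n. (x a)\<^sup>2)"
      by (auto intro!: sum_pos2)
    then show "0 < qform n (F s) x"
      unfolding F_def qform_homotopy using s nonneg[of x]
      by (simp add: add_nonneg_pos)
  qed
  then have "eventually (\<lambda>s. 0 \<le> fdet n (F s)) (at_right 0)"
    unfolding eventually_at_right_field by (intro exI[of _ 1]) (auto intro: less_imp_le)
  moreover have "((\<lambda>s. fdet n (F s)) \<longlongrightarrow> fdet n (F 0)) (at_right 0)"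
    unfolding F_def by (intro tendsto_fdet tendsto_intros)
  ultimately have "0 \<le> fdet n (F 0)"
    by (intro tendsto_lowerbound[of _ _ "at_right (0::real)"]) auto
  then show ?thesis by (simp add: F_def)
qed

text \<open>Allowing the last leading minor to vanish covers the strict and the boundary case of the
  compound matrices at once; the diagonal of \<open>L\<close> is claimed positive only where the
  leading minor is.\<close>

lemma cholesky:
  assumes sym: "\<And>a b. f a b = f b a"
    and pos: "\<And>j. j < p \<Longrightarrow> 0 < fdet j f"
    and nonneg: "0 \<le> fdet p f"
  shows "\<exists>L. (\<forall>a b. a < b \<longrightarrow> L a b = 0) \<and> (\<forall>a<p. 0 < fdet (Suc a) f \<longrightarrow> 0 < L a a) \<and>
           (\<forall>a<p. \<forall>b<p. f a b = (\<Sum>c<p. L a c * L b c))"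
  using pos nonneg
proof (induction p)
  case 0
  show ?case by (rule exI[of _ "\<lambda>_ _. 0"]) simp
next
  case (Suc p)
  have "\<And>j. j < p \<Longrightarrow> 0 < fdet j f" "0 \<le> fdet p f"
    using Suc.prems(1) by (auto intro: less_imp_le)
  from Suc.IH[OF this] obtain L where L: "\<And>a b. a < b \<Longrightarrow> L a b = 0"
    "\<And>a. a < p \<Longrightarrow> 0 < L a a" "\<And>a b. a < p \<Longrightarrow> b < p \<Longrightarrow> f a b = (\<Sum>c<p. L a c * L b c)"
    using Suc.prems(1) by (metis Suc_less_eq)
  have "fdet p f = fdet p (\<lambda>a b. \<Sum>c<p. L a c * L b c)"
    by (rule fdet_cong) (simp add: L(3))
  also have "\<dots> = fdet p L * fdet p L"
    using fdet_mult[of p L "\<lambda>c b. L b c"] fdet_transpose[of p L] by simp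
  finally have det: "fdet p f = fdet p L * fdet p L" .
  have f_pos: "0 < fdet p f" using Suc.prems(1) by simp
  then have "fdet p L \<noteq> 0" using det by auto
  then obtain x where x: "\<And>b. b < p \<Longrightarrow> (\<Sum>c<p. L b c * x c) = f p b"
    using fdet_solve[of p L "f p"] by blast
  \<comment> \<open>The Schur complement of the leading block, that is, the square of the new
    diagonal entry.\<close>
  define \<delta> where "\<delta> = f p p - (\<Sum>c<p. x c * x c)"
  \<comment> \<open>With a 1 in the corner instead of the root of \<delta>, \<open>f\<close> is
    \<open>U\<close>, times a diagonal matrix ending in \<delta>, times the transpose of
    \<open>U\<close>. Taking determinants isolates \<delta> and yields its sign before any root is
    taken.\<close>
  define U where "U = (\<lambda>a c. if a < p then L a c else if c < p then x c else if c = p \<and> a = p then 1 else 0)"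
  have U_tri: "U a c = 0" if "a < c" "a \<le> p" for a c
    using that L(1) by (auto simp: U_def)
  have f_U: "f a b = (\<Sum>c<Suc p. U a c * ((if c = p then \<delta> else 1) * U b c))"
    if ab: "a < Suc p" "b < Suc p" for a b
  proof -
    consider "a < p" "b < p" | "a = p" "b < p" | "a < p" "b = p" | "a = p" "b = p"
      using ab unfolding less_Suc_eq by blast
    then show ?thesis
    proof cases
      case 1
      then show ?thesis by (simp add: U_def L)
    next
      case 2
      then show ?thesis using x[of b] L(1)[of b p] by (simp add: U_def mult.commute)
    next
      case 3
      then show ?thesis using x[of a] L(1)[of a p] sym[of a p] by (simp add: U_def)
    next
      case 4
      then show ?thesis by (simp add: U_def \<delta>_def)
    qed
  qed
  have "fdet (Suc p) f = fdet (Suc p) (\<lambda>a b. \<Sum>c<Suc p. U a c * ((if c = p then \<delta> else 1) * U b c))"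
    by (rule fdet_cong) (rule f_U)
  also have "\<dots> = fdet (Suc p) U * fdet (Suc p) (\<lambda>c b. (if c = p then \<delta> else 1) * U b c)"
    by (rule fdet_mult)
  also have "fdet (Suc p) U = fdet (Suc p) (\<lambda>a b. U b a)"
    by (simp only: fdet_transpose[of _ U])
  also have "\<dots> = 1 * fdet p (\<lambda>a b. U b a)"
    by (rule fdet_unit_last_last) (auto simp: U_def L(1))
  also have "fdet p (\<lambda>a b. U b a) = fdet p (\<lambda>a b. L b a)"
    by (rule fdet_cong) (simp add: U_def)
  also have "fdet (Suc p) (\<lambda>c b. (if c = p then \<delta> else 1) * U b c) =
      \<delta> * fdet p (\<lambda>c b. (if c = p then \<delta> else 1) * U b c)"
    by (rule fdet_unit_last_last) (auto simp: U_def L(1))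
  also have "fdet p (\<lambda>c b. (if c = p then \<delta> else 1) * U b c) = fdet p (\<lambda>a b. L b a)"
    by (rule fdet_cong) (simp add: U_def)
  finally have det': "fdet (Suc p) f = \<delta> * fdet p f"
    by (simp add: det fdet_transpose[of p L])
  have \<delta>: "0 \<le> \<delta>" "0 < fdet (Suc p) f \<Longrightarrow> 0 < \<delta>"
    using det' f_pos Suc.prems(2) by (auto simp: zero_le_mult_iff zero_less_mult_iff)
  define V where "V = (\<lambda>a c. if a < p then L a c else if c < p then x c else if c = p \<and> a = p then sqrt \<delta> else 0)"
  define W where "W = (\<lambda>a c. if a < c then 0 else V a c)"
  have W: "W a c = (if c = p then sqrt \<delta> * U a c else U a c)" if "a \<le> p" "c \<le> p" for a c
    using that L(1) by (auto simp: U_def V_def W_def)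
  show ?case
  proof (intro exI[of _ W] conjI allI impI)
    fix a b assume ab: "a < Suc p" "b < Suc p"
    have "(\<Sum>c<Suc p. W a c * W b c) = (\<Sum>c<Suc p. U a c * ((if c = p then \<delta> else 1) * U b c))"
    proof (rule sum.cong[OF refl])
      fix c assume "c \<in> {..<Suc p}"
      moreover have "sqrt \<delta> * (sqrt \<delta> * y) = \<delta> * y" for y
        using \<delta>(1) by (simp add: mult.assoc[symmetric])
      ultimately show "W a c * W b c = U a c * ((if c = p then \<delta> else 1) * U b c)"
        using W[of a c] W[of b c] ab by (simp add: mult_ac)
    qed
    then show "f a b = (\<Sum>c<Suc p. W a c * W b c)"
      using f_U[OF ab] by simp
  next
    fix a assume a: "a < Suc p" "0 < fdet (Suc a) f"
    then show "0 < W a a"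
      using \<delta>(2) L(2)[of a] by (cases "a = p") (auto simp: W_def V_def)
  qed (simp add: W_def)
qed

section \<open>Compound matrices and the Cauchy--Binet formula\<close>


text \<open>Multilinearity: each row \<open>u\<close> picks its own summand \<open>\<phi> u\<close>.
  It serves the Cauchy-Binet formula and, later, the minors of truncated block responses.\<close>

lemma fdet_sum_rows:
  assumes "finite S"
  shows "fdet j (\<lambda>u v. \<Sum>c\<in>S. A u c * B c v) =
    (\<Sum>\<phi>\<in>PiE {..<j} (\<lambda>_. S). (\<Prod>u<j. A u (\<phi> u)) * fdet j (\<lambda>u v. B (\<phi> u) v))"
proof -
  have "fdet j (\<lambda>u v. \<Sum>c\<in>S. A u c * B c v) =
      (\<Sum>p | p permutes {..<j}. signof p *
        (\<Sum>\<phi>\<in>PiE {..<j} (\<lambda>_. S). (\<Prod>u<j. A u (\<phi> u)) * (\<Prod>u<j. B (\<phi> u) (p u))))"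
    unfolding fdet_leibniz using assms by (simp add: prod_sum_PiE prod.distrib)
  also have "\<dots> = (\<Sum>\<phi>\<in>PiE {..<j} (\<lambda>_. S). \<Sum>p | p permutes {..<j}.
      signof p * ((\<Prod>u<j. A u (\<phi> u)) * (\<Prod>u<j. B (\<phi> u) (p u))))"
    unfolding sum_distrib_left by (rule sum.swap)
  also have "\<dots> = (\<Sum>\<phi>\<in>PiE {..<j} (\<lambda>_. S). (\<Prod>u<j. A u (\<phi> u)) * fdet j (\<lambda>u v. B (\<phi> u) v))"
    unfolding fdet_leibniz by (simp add: sum_distrib_left mult_ac)
  finally show ?thesis .
qed

text \<open>The Cauchy--Binet formula, summed over all index maps rather than over index sets: each set
  is then counted \<open>fact j\<close> times.\<close>
lemma cauchy_binet:
  assumes S: "finite S"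
  shows "fact j * fdet j (\<lambda>u v. \<Sum>c\<in>S. A u c * B v c) =
    (\<Sum>\<phi>\<in>PiE {..<j} (\<lambda>_. S). fdet j (\<lambda>u v. A u (\<phi> v)) * fdet j (\<lambda>u v. B u (\<phi> v)))"
proof -
  let ?P = "PiE {..<j} (\<lambda>_. S)"
  define D where "D = (\<lambda>\<phi>. fdet j (\<lambda>u v. B u (\<phi> v)))"
  have D: "D \<phi> = fdet j (\<lambda>u v. B v (\<phi> u))" for \<phi>
    unfolding D_def by (rule fdet_transpose)
  \<comment> \<open>Composing all maps with \<open>p\<close> moves \<open>p\<close> out of the
    determinant, as a sign, and into the product. Summing over all \<open>p\<close> then builds the
    second determinant and accounts for the factor \<open>fact j\<close>.\<close>
  have inv: "(\<Sum>\<phi>\<in>?P. (\<Prod>u<j. A u (\<phi> u)) * D \<phi>) =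
      (\<Sum>\<phi>\<in>?P. signof p * (\<Prod>u<j. A u (\<phi> (p u))) * D \<phi>)" if p: "p permutes {..<j}" for p
  proof -
    have comp: "\<phi> \<circ> q \<in> ?P" if "\<phi> \<in> ?P" "q permutes {..<j}" for \<phi> q
      using that permutes_in_image[OF that(2)] permutes_not_in[OF that(2)]
      by (auto simp: PiE_def extensional_def Pi_def)
    have "(\<Sum>\<phi>\<in>?P. (\<Prod>u<j. A u (\<phi> u)) * D \<phi>) = (\<Sum>\<phi>\<in>?P. (\<Prod>u<j. A u ((\<phi> \<circ> p) u)) * D (\<phi> \<circ> p))"
      by (rule sum.reindex_bij_witness[of _ "\<lambda>\<phi>. \<phi> \<circ> p" "\<lambda>\<phi>. \<phi> \<circ> inv_into UNIV p"])
        (simp_all add: comp p permutes_inv comp_assoc permutes_inv_o[OF p])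
    also have "\<dots> = (\<Sum>\<phi>\<in>?P. signof p * (\<Prod>u<j. A u (\<phi> (p u))) * D \<phi>)"
    proof (rule sum.cong[OF refl])
      fix \<phi>
      have "D (\<phi> \<circ> p) = signof p * D \<phi>"
        unfolding D using fdet_permute[OF p, of "\<lambda>u v. B v (\<phi> u)"] by simp
      then show "(\<Prod>u<j. A u ((\<phi> \<circ> p) u)) * D (\<phi> \<circ> p) = signof p * (\<Prod>u<j. A u (\<phi> (p u))) * D \<phi>"
        by simp
    qed
    finally show ?thesis .
  qed
  have "fact j * fdet j (\<lambda>u v. \<Sum>c\<in>S. A u c * B v c) =
      (\<Sum>p | p permutes {..<j}. \<Sum>\<phi>\<in>?P. (\<Prod>u<j. A u (\<phi> u)) * D \<phi>)"
    using fdet_sum_rows[OF S, of j A "\<lambda>c v. B v c"]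
    by (simp add: D card_permutations[of "{..<j}" j])
  also have "\<dots> = (\<Sum>p | p permutes {..<j}. \<Sum>\<phi>\<in>?P. signof p * (\<Prod>u<j. A u (\<phi> (p u))) * D \<phi>)"
    by (rule sum.cong) (use inv in auto)
  also have "\<dots> = (\<Sum>\<phi>\<in>?P. \<Sum>p | p permutes {..<j}. signof p * (\<Prod>u<j. A u (\<phi> (p u))) * D \<phi>)"
    by (rule sum.swap)
  also have "\<dots> = (\<Sum>\<phi>\<in>?P. fdet j (\<lambda>u v. A u (\<phi> v)) * D \<phi>)"
    by (simp add: fdet_leibniz sum_distrib_right)
  finally show ?thesis by (simp add: D_def)
qed

lemma fdet_lower_triangular_pos:
  assumes "\<And>a b. a < b \<Longrightarrow> b < n \<Longrightarrow> f a b = 0" "\<And>a. a < n \<Longrightarrow> 0 < f a a"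
  shows "0 < fdet n f"
  using assms
proof (induction n arbitrary: f)
  case (Suc n)
  have "fdet (Suc n) f = f 0 0 * fdet n (\<lambda>a b. f (Suc a) (Suc b))"
    using Suc.prems(1)[of 0] by (intro fdet_unit_first_first) auto
  moreover have "0 < fdet n (\<lambda>a b. f (Suc a) (Suc b))"
    using Suc.prems by (intro Suc.IH) auto
  ultimately show ?case using Suc.prems(2)[of 0] by simp
qed simp

text \<open>By Cauchy-Binet, consecutive minors of \<open>L\<close> times its transpose form a Gram
  matrix, so their quadratic form is a sum of squares. The indices reach at most
  \<open>i + j - 2\<close>, which the bound on \<open>i + j\<close> keeps below
  \<open>p\<close>.\<close>

lemma qform_compound:
  assumes f: "\<And>a b. a < p \<Longrightarrow> b < p \<Longrightarrow> f a b = (\<Sum>c<p. L a c * L b c)"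
    and ij: "i + j \<le> Suc p"
  shows "fact j * qform i (\<lambda>a b. fdet j (\<lambda>u v. f (a + u) (b + v))) x =
    (\<Sum>\<phi>\<in>PiE {..<j} (\<lambda>_. {..<p}). (\<Sum>a<i. x a * fdet j (\<lambda>u v. L (a + u) (\<phi> v)))\<^sup>2)"
proof -
  let ?P = "PiE {..<j} (\<lambda>_. {..<p})"
  let ?D = "\<lambda>a \<phi>. fdet j (\<lambda>u v. L (a + u) (\<phi> v))"
  have minor: "fact j * fdet j (\<lambda>u v. f (a + u) (b + v)) = (\<Sum>\<phi>\<in>?P. ?D a \<phi> * ?D b \<phi>)"
    if "a < i" "b < i" for a b
  proof -
    have "fdet j (\<lambda>u v. f (a + u) (b + v)) = fdet j (\<lambda>u v. \<Sum>c<p. L (a + u) c * L (b + v) c)"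
      using that ij by (intro fdet_cong f) auto
    then show ?thesis by (simp add: cauchy_binet)
  qed
  have "fact j * qform i (\<lambda>a b. fdet j (\<lambda>u v. f (a + u) (b + v))) x =
      (\<Sum>a<i. \<Sum>b<i. x a * (fact j * fdet j (\<lambda>u v. f (a + u) (b + v))) * x b)"
    by (simp add: qform_def sum_distrib_left mult_ac)
  also have "\<dots> = (\<Sum>a<i. \<Sum>b<i. x a * (\<Sum>\<phi>\<in>?P. ?D a \<phi> * ?D b \<phi>) * x b)"
    by (intro sum.cong refl) (simp add: minor)
  also have "\<dots> = (\<Sum>a<i. \<Sum>b<i. \<Sum>\<phi>\<in>?P. (x a * ?D a \<phi>) * (x b * ?D b \<phi>))"
    by (simp add: sum_distrib_left sum_distrib_right mult_ac)
  also have "\<dots> = (\<Sum>a<i. \<Sum>\<phi>\<in>?P. \<Sum>b<i. (x a * ?D a \<phi>) * (x b * ?D b \<phi>))"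
    by (intro sum.cong refl sum.swap)
  also have "\<dots> = (\<Sum>\<phi>\<in>?P. \<Sum>a<i. \<Sum>b<i. (x a * ?D a \<phi>) * (x b * ?D b \<phi>))"
    by (rule sum.swap)
  also have "\<dots> = (\<Sum>\<phi>\<in>?P. (\<Sum>a<i. x a * ?D a \<phi>)\<^sup>2)"
    by (simp add: power2_eq_square sum_product)
  finally show ?thesis .
qed

lemma qform_compound_nonneg:
  assumes sym: "\<And>a b. f a b = f b a"
    and pos: "\<And>l. l < p \<Longrightarrow> 0 < fdet l f" and nonneg: "0 \<le> fdet p f"
    and ij: "i + j \<le> Suc p"
  shows "0 \<le> qform i (\<lambda>a b. fdet j (\<lambda>u v. f (a + u) (b + v))) x"
proof -
  obtain L where "\<And>a b. a < p \<Longrightarrow> b < p \<Longrightarrow> f a b = (\<Sum>c<p. L a c * L b c)"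
    using cholesky[of f p] assms by metis
  then have "0 \<le> fact j * qform i (\<lambda>a b. fdet j (\<lambda>u v. f (a + u) (b + v))) x"
    using ij by (subst qform_compound) (auto intro!: sum_nonneg)
  moreover have "\<not> fact j \<le> (0 :: real)" by (simp add: not_le)
  ultimately show ?thesis by (simp add: zero_le_mult_iff)
qed

text \<open>One square is nonzero. Let \<open>b\<close> be the last index with
  \<open>x b \<noteq> 0\<close> and take the columns from \<open>b\<close> to
  \<open>b + j - 1\<close>: the minor of \<open>L\<close> starting at row \<open>b\<close> is
  triangular with positive diagonal, while those starting higher up have a zero first row.\<close>

lemma qform_compound_pos:
  assumes sym: "\<And>a b. f a b = f b a"
    and pos: "\<And>l. l \<le> p \<Longrightarrow> 0 < fdet l f"
    and ij: "i + j \<le> Suc p" and j: "0 < j"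
    and x: "\<exists>b<i. x b \<noteq> 0"
  shows "0 < qform i (\<lambda>a b. fdet j (\<lambda>u v. f (a + u) (b + v))) x"
proof -
  have "\<And>l. l < p \<Longrightarrow> 0 < fdet l f" "0 \<le> fdet p f"
    using pos by (auto intro: less_imp_le)
  from cholesky[of f p, OF sym this] pos
  obtain L where L: "\<And>a b. a < b \<Longrightarrow> L a b = 0" "\<And>a. a < p \<Longrightarrow> 0 < L a a"
    "\<And>a b. a < p \<Longrightarrow> b < p \<Longrightarrow> f a b = (\<Sum>c<p. L a c * L b c)"
    by (metis Suc_leI)
  define b where "b = Max {b. b < i \<and> x b \<noteq> 0}"
  have "b \<in> {b. b < i \<and> x b \<noteq> 0}"
    unfolding b_def using x by (intro Max_in) auto
  then have b: "b < i" "x b \<noteq> 0" by auto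
  have b_max: "x a = 0" if "b < a" "a < i" for a
  proof (rule ccontr)
    assume "x a \<noteq> 0"
    with that have "a \<le> b" unfolding b_def by (intro Max_ge) auto
    with that show False by simp
  qed
  let ?P = "PiE {..<j} (\<lambda>_. {..<p})"
  let ?D = "\<lambda>a \<phi>. fdet j (\<lambda>u v. L (a + u) (\<phi> v))"
  define \<phi> where "\<phi> = restrict (\<lambda>v. b + v) {..<j}"
  have \<phi>: "\<phi> \<in> ?P"
    using ij b by (auto simp: \<phi>_def)
  have low: "?D a \<phi> = 0" if "a < b" for a
  proof -
    have "?D a \<phi> = (\<Sum>k<j. L (a + 0) (\<phi> k) * fcof j (\<lambda>u v. L (a + u) (\<phi> v)) 0 k)"
      by (rule laplace_row[OF j])
    also have "\<dots> = 0"
      using that by (intro sum.neutral) (auto simp: \<phi>_def L(1))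
    finally show ?thesis .
  qed
  have diag: "0 < ?D b \<phi>"
    by (rule fdet_lower_triangular_pos) (use b ij in \<open>auto simp: \<phi>_def L\<close>)
  have "(\<Sum>a<i. x a * ?D a \<phi>) = (\<Sum>a\<in>{b}. x a * ?D a \<phi>)"
  proof (rule sum.mono_neutral_right)
    show "\<forall>a\<in>{..<i} - {b}. x a * ?D a \<phi> = 0"
      using low b_max by (auto simp: nat_neq_iff)
  qed (use b in auto)
  then have "0 < (\<Sum>a<i. x a * ?D a \<phi>)\<^sup>2"
    using b diag by simp
  also have "\<dots> \<le> (\<Sum>\<phi>\<in>?P. (\<Sum>a<i. x a * ?D a \<phi>)\<^sup>2)"
    by (rule member_le_sum[OF \<phi>]) (auto intro: finite_PiE)
  also have "\<dots> = fact j * qform i (\<lambda>a b. fdet j (\<lambda>u v. f (a + u) (b + v))) x"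
    by (rule qform_compound[symmetric, OF L(3) ij])
  finally show ?thesis by (simp add: zero_less_mult_iff)
qed

text \<open>The singular matrix of size \<open>m + 1\<close> at time \<open>s\<close> has a kernel
  vector, unique once its last coordinate is 1 because the minor of size \<open>m\<close> is
  nonzero. Neighbouring times share this vector, which is therefore a recurrence.\<close>

lemma cdet_zero_recurrence:
  assumes zero: "\<And>s. t0 \<le> s \<Longrightarrow> cdet (Suc m) g s = 0"
    and nonzero: "\<And>s. t0 \<le> s \<Longrightarrow> cdet m g s \<noteq> 0"
  shows "\<exists>x. x m = 1 \<and> (\<forall>s\<ge>t0. (\<Sum>b<Suc m. x b * g (s + b)) = 0)"
proof -
  have inj: "x b = 0" if s: "t0 \<le> s" and b: "b < m"
    and eq: "\<And>a. a < m \<Longrightarrow> (\<Sum>b<m. g (s + a + b) * x b) = 0" for s x b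
    using nonzero[OF s] fdet_eq_0_iff[of m "\<lambda>a b. g (s + a + b)"] b eq
    unfolding cdet_def by blast
  have ex: "\<exists>x. x m = 1 \<and> (\<forall>a<Suc m. (\<Sum>b<Suc m. g (s + a + b) * x b) = 0)" if s: "t0 \<le> s" for s
  proof -
    obtain x where x: "\<exists>b<Suc m. x b \<noteq> 0"
      "\<And>a. a < Suc m \<Longrightarrow> (\<Sum>b<Suc m. g (s + a + b) * x b) = 0"
      using zero[OF s] fdet_eq_0_iff[of "Suc m" "\<lambda>a b. g (s + a + b)"]
      unfolding cdet_def by blast
    have "x m \<noteq> 0"
    proof
      assume xm: "x m = 0"
      have "x b = 0" if "b < m" for b
      proof (rule inj[OF s that])
        fix a assume "a < m"
        then show "(\<Sum>b<m. g (s + a + b) * x b) = 0" using x(2)[of a] xm by simp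
      qed
      with x(1) xm show False by (auto simp: less_Suc_eq)
    qed
    then show ?thesis
      using x(2)
      by (intro exI[of _ "\<lambda>b. x b / x m"]) (simp add: sum_divide_distrib[symmetric] del: sum.lessThan_Suc)
  qed
  define X where "X = (\<lambda>s. SOME x. x m = 1 \<and> (\<forall>a<Suc m. (\<Sum>b<Suc m. g (s + a + b) * x b) = 0))"
  have X: "X s m = 1" "\<And>a. a < Suc m \<Longrightarrow> (\<Sum>b<Suc m. g (s + a + b) * X s b) = 0" if "t0 \<le> s" for s
    using someI_ex[OF ex[OF that]] unfolding X_def by auto
  \<comment> \<open>The last \<open>m\<close> equations at \<open>s\<close> are the first
    \<open>m\<close> equations at \<open>Suc s\<close>. The difference of the two vectors ends in 0
    and so solves a regular homogeneous system of size \<open>m\<close>.\<close>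
  have step: "X (Suc s) b = X s b" if s: "t0 \<le> s" and b: "b < Suc m" for s b
  proof (cases "b = m")
    case True
    then show ?thesis using X(1) s by simp
  next
    case False
    have "X (Suc s) b - X s b = 0"
    proof (rule inj[of "Suc s"])
      fix a assume a: "a < m"
      have "(\<Sum>b<Suc m. g (Suc s + a + b) * X s b) = 0"
        using X(2)[OF s, of "Suc a"] a by simp
      moreover have "(\<Sum>b<Suc m. g (Suc s + a + b) * X (Suc s) b) = 0"
        using X(2)[of "Suc s" a] a s by simp
      ultimately show "(\<Sum>b<m. g (Suc s + a + b) * (X (Suc s) b - X s b)) = 0"
        using X(1)[of s] X(1)[of "Suc s"] s by (simp add: right_diff_distrib sum_subtractf)
    qed (use s b False in auto)
    then show ?thesis by simp
  qed
  have const: "X s b = X t0 b" if "t0 \<le> s" "b < Suc m" for s b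
    using that(1) by (induction rule: dec_induct) (use step that(2) in auto)
  show ?thesis
  proof (intro exI[of _ "X t0"] conjI allI impI)
    fix s assume s: "t0 \<le> s"
    have "(\<Sum>b<Suc m. X t0 b * g (s + b)) = (\<Sum>b<Suc m. g (s + 0 + b) * X s b)"
      using const[OF s] by (intro sum.cong) auto
    then show "(\<Sum>b<Suc m. X t0 b * g (s + b)) = 0"
      using X(2)[OF s, of 0] by simp
  qed (use X in auto)
qed

section \<open>Recurrences of the impulse response\<close>


text \<open>The point 0 is excluded since \<open>x\<close> stands for the inverse of
  \<open>z\<close>. The constant coefficient is recovered as a limit at 0, and division by
  \<open>x\<close> shifts the series.\<close>

lemma powser_coeffs_zero:
  fixes a :: "nat \<Rightarrow> real"
  assumes s: "0 < s" and sm: "\<And>x. x \<noteq> 0 \<Longrightarrow> norm x < s \<Longrightarrow> (\<lambda>n. a n * x ^ n) sums 0"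
  shows "a n = 0"
  using sm
proof (induction n arbitrary: a)
  case 0
  have "((\<lambda>x :: real. 0 :: real) \<longlongrightarrow> a 0) (at 0)"
    by (rule powser_limit_0_strong[OF s, of a]) (use 0 in auto)
  then show ?case
    by (metis tendsto_const LIM_unique)
next
  case (Suc n)
  have a0: "a 0 = 0"
  proof -
    have "((\<lambda>x :: real. 0 :: real) \<longlongrightarrow> a 0) (at 0)"
      by (rule powser_limit_0_strong[OF s, of a]) (use Suc.prems in auto)
    then show ?thesis by (metis tendsto_const LIM_unique)
  qed
  show ?case
  proof (rule Suc.IH)
    fix x :: real assume x: "x \<noteq> 0" "norm x < s"
    have "(\<lambda>n. a (Suc n) * x ^ Suc n) sums 0"
      using Suc.prems[OF x] a0 by (subst sums_Suc_iff) simp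
    then have "(\<lambda>n. a (Suc n) * x ^ Suc n / x) sums (0 / x)"
      by (rule sums_divide)
    then show "(\<lambda>n. a (Suc n) * x ^ n) sums 0" using x by simp
  qed
qed

lemma poly_cpoly_of_real: "poly (cpoly p) (of_real x) = of_real (poly p x)"
  by (induction p) (auto simp: map_poly_pCons)

lemma cpoly_mult: "cpoly (p * q) = cpoly p * cpoly q"
  by (rule poly_eqI) (simp add: coeff_map_poly coeff_mult)

lemma cpoly_eq_0_iff: "cpoly p = 0 \<longleftrightarrow> p = 0"
  by (simp add: poly_eq_iff coeff_map_poly)

text \<open>Extension by zero to negative indices; it allows the coefficients of products with
  shifted sequences to be written over a fixed range of summation.\<close>

definition zext :: "(nat \<Rightarrow> real) \<Rightarrow> int \<Rightarrow> real" where
  "zext f c = (if c < 0 then 0 else f (nat c))"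

lemma zext_of_nat [simp]: "zext f (int c) = f c"
  by (simp add: zext_def)

lemma coeff_mult_zext:
  "coeff (p * q) n = (\<Sum>a\<le>degree p. coeff p a * zext (coeff q) (int n - int a))"
proof -
  let ?h = "\<lambda>a. coeff p a * zext (coeff q) (int n - int a)"
  have "coeff (p * q) n = (\<Sum>a\<le>n. ?h a)"
    unfolding coeff_mult by (intro sum.cong refl) (simp flip: of_nat_diff)
  also have "\<dots> = (\<Sum>a\<le>max n (degree p). ?h a)"
    by (rule sum.mono_neutral_left) (auto simp: zext_def)
  also have "\<dots> = (\<Sum>a\<le>degree p. ?h a)"
    by (rule sum.mono_neutral_right) (auto simp: coeff_eq_0)
  finally show ?thesis .
qed

lemma system_denominator:
  assumes "is_system P Q g"
  shows "Q \<noteq> 0" "degree P < degree Q" "g 0 = 0" "Bseq g"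
  using assms by (auto simp: is_system_def)

lemma system_sums:
  assumes "is_system P Q g"
  shows "\<exists>s>0. \<forall>w. w \<noteq> 0 \<and> norm w < s \<longrightarrow>
    poly Q (inverse w) \<noteq> 0 \<and> (\<lambda>t. g t * w ^ t) sums (poly P (inverse w) / poly Q (inverse w))"
proof -
  have "Q \<noteq> 0" by (rule system_denominator[OF assms])
  then have fin: "finite {x. poly Q x = 0}" by (rule poly_roots_finite)
  define b1 where "b1 = Max (norm ` {x. poly Q x = 0})"
  have b1: "norm x \<le> b1" if "poly Q x = 0" for x
    unfolding b1_def by (rule Max_ge) (use fin that in auto)
  have "\<forall>\<^sub>F z in at_infinity. (\<lambda>t. complex_of_real (g t) * inverse z ^ t) sums transfer P Q z"
    using assms by (simp add: is_system_def)
  then obtain b2 where b2: "\<And>z. b2 \<le> norm z \<Longrightarrow> (\<lambda>t. complex_of_real (g t) * inverse z ^ t) sums transfer P Q z"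
    by (auto simp: eventually_at_infinity)
  \<comment> \<open>Large enough to be positive, to exceed all real roots of \<open>Q\<close> in
    modulus, and to lie where the expansion is valid. If \<open>Q\<close> has no real root, the
    value of \<open>b1\<close> is arbitrary and harmless.\<close>
  define b where "b = max 1 (max (b1 + 1) b2)"
  have b: "0 < b" "b1 < b" "b2 \<le> b" by (auto simp: b_def)
  show ?thesis
  proof (intro exI[of _ "inverse b"] conjI allI impI)
    fix w :: real assume w: "w \<noteq> 0 \<and> norm w < inverse b"
    then have "b < inverse (norm w)"
      using b(1) by (simp add: field_simps)
    then have nw: "b < norm (inverse w)" by (simp add: norm_inverse)
    show "poly Q (inverse w) \<noteq> 0" using b1[of "inverse w"] nw b by auto
    have "(\<lambda>t. complex_of_real (g t) * inverse (of_real (inverse w)) ^ t) sums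
        transfer P Q (of_real (inverse w))"
      by (rule b2) (use nw b in \<open>simp add: norm_of_real del: of_real_inverse\<close>)
    then have "(\<lambda>t. complex_of_real (g t * w ^ t)) sums
        complex_of_real (poly P (inverse w) / poly Q (inverse w))"
      using w by (simp add: transfer_def poly_cpoly_of_real flip: of_real_inverse)
    then show "(\<lambda>t. g t * w ^ t) sums (poly P (inverse w) / poly Q (inverse w))"
      by (simp only: sums_of_real_iff)
  qed (use b in auto)
qed

text \<open>This compares the coefficients of \<open>z^c\<close> in \<open>Q G = P\<close>. Negative
  \<open>c\<close> give the recurrence of the denominator, the others the numerator.\<close>

lemma system_recurrence:
  assumes sys: "is_system P Q g"
  shows "(\<Sum>b\<le>degree Q. coeff Q b * zext g (int b - c)) = zext (coeff P) c"
proof -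
  define d where "d = degree Q"
  have dP: "degree P < d" and g0: "g 0 = 0"
    using system_denominator[OF sys] by (auto simp: d_def)
  obtain s where s: "0 < s" "\<And>w. w \<noteq> 0 \<Longrightarrow> norm w < s \<Longrightarrow> poly Q (inverse w) \<noteq> 0"
    "\<And>w. w \<noteq> 0 \<Longrightarrow> norm w < s \<Longrightarrow> (\<lambda>t. g t * w ^ t) sums (poly P (inverse w) / poly Q (inverse w))"
    using system_sums[OF sys] by auto
  \<comment> \<open>The coefficient of \<open>w^t\<close> in \<open>w^d * (Q G - P)\<close> for
    \<open>w\<close> the inverse of \<open>z\<close>; the factor \<open>w^d\<close> removes negative
    exponents, and \<open>t = d - c\<close>.\<close>
  define f where "f = (\<lambda>t. (\<Sum>b\<le>d. coeff Q b * zext g (int b + int t - int d)) - (if t \<le> d then coeff P (d - t) else 0))"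
  have "f t = 0" for t
  proof (rule powser_coeffs_zero[OF s(1)])
    fix w :: real assume w: "w \<noteq> 0" "norm w < s"
    let ?G = "poly P (inverse w) / poly Q (inverse w)"
    have wpow: "w ^ d * inverse w ^ b = w ^ (d - b)" if "b \<le> d" for b
      using that w by (simp add: power_diff field_simps)
    have shift: "(\<lambda>t. zext g (int b + int t - int d) * w ^ t) sums (w ^ (d - b) * ?G)" if b: "b \<le> d" for b
    proof -
      have "(\<lambda>t. w ^ (d - b) * (g t * w ^ t)) sums (w ^ (d - b) * ?G)"
        by (rule sums_mult) (rule s(3)[OF w])
      moreover have "w ^ (d - b) * (g t * w ^ t) =
          zext g (int b + int (t + (d - b)) - int d) * w ^ (t + (d - b))" for t
      proof -
        have "int b + int (t + (d - b)) - int d = int t" using b by linarith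
        then show ?thesis by (simp only: zext_of_nat power_add) (simp add: mult_ac)
      qed
      ultimately have "(\<lambda>t. zext g (int b + int (t + (d - b)) - int d) * w ^ (t + (d - b))) sums (w ^ (d - b) * ?G)"
        by simp
      then show ?thesis
        by (subst (asm) sums_zero_iff_shift) (use b in \<open>auto simp: zext_def\<close>)
    qed
    have "(\<lambda>t. \<Sum>b\<le>d. coeff Q b * (zext g (int b + int t - int d) * w ^ t)) sums
        (\<Sum>b\<le>d. coeff Q b * (w ^ (d - b) * ?G))"
      by (intro sums_sum sums_mult shift) auto
    also have "(\<Sum>b\<le>d. coeff Q b * (w ^ (d - b) * ?G)) = w ^ d * poly Q (inverse w) * ?G"
    proof -
      have "(\<Sum>b\<le>d. coeff Q b * (w ^ (d - b) * ?G)) = (\<Sum>b\<le>d. coeff Q b * (w ^ d * inverse w ^ b)) * ?G"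
        unfolding sum_distrib_right by (intro sum.cong refl) (simp add: wpow)
      also have "(\<Sum>b\<le>d. coeff Q b * (w ^ d * inverse w ^ b)) = w ^ d * poly Q (inverse w)"
        by (simp add: poly_altdef d_def sum_distrib_left mult_ac)
      finally show ?thesis .
    qed
    also have "\<dots> = w ^ d * poly P (inverse w)"
      using s(2)[OF w] by simp
    finally have 1: "(\<lambda>t. \<Sum>b\<le>d. coeff Q b * (zext g (int b + int t - int d) * w ^ t)) sums
        (w ^ d * poly P (inverse w))" .
    have "(\<lambda>t. (if t \<le> d then coeff P (d - t) else 0) * w ^ t) sums
        (\<Sum>t\<le>d. (if t \<le> d then coeff P (d - t) else 0) * w ^ t)"
      by (rule sums_finite) auto
    also have "(\<Sum>t\<le>d. (if t \<le> d then coeff P (d - t) else 0) * w ^ t) = (\<Sum>t\<le>d. coeff P t * w ^ (d - t))"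
      by (rule sum.reindex_bij_witness[of _ "\<lambda>t. d - t" "\<lambda>t. d - t"]) auto
    also have "\<dots> = (\<Sum>t\<le>d. coeff P t * (w ^ d * inverse w ^ t))"
      by (intro sum.cong refl) (simp add: wpow)
    also have "\<dots> = (\<Sum>t\<le>degree P. coeff P t * (w ^ d * inverse w ^ t))"
      by (rule sum.mono_neutral_right) (use dP in \<open>auto simp: coeff_eq_0\<close>)
    also have "\<dots> = w ^ d * poly P (inverse w)"
      by (simp add: poly_altdef[of P] sum_distrib_left mult_ac)
    finally have 2: "(\<lambda>t. (if t \<le> d then coeff P (d - t) else 0) * w ^ t) sums (w ^ d * poly P (inverse w))" .
    have "f t * w ^ t = (\<Sum>b\<le>d. coeff Q b * (zext g (int b + int t - int d) * w ^ t)) -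
        (if t \<le> d then coeff P (d - t) else 0) * w ^ t" for t
      unfolding f_def by (simp add: left_diff_distrib sum_distrib_right mult.assoc)
    then show "(\<lambda>t. f t * w ^ t) sums 0"
      using sums_diff[OF 1 2] by simp
  qed
  then have main: "(\<Sum>b\<le>d. coeff Q b * zext g (int b + int t - int d)) = (if t \<le> d then coeff P (d - t) else 0)" for t
    by (simp add: f_def)
  show ?thesis
  proof (cases "c \<le> int d")
    case True
    define t where "t = nat (int d - c)"
    have t: "int t = int d - c" using True by (simp add: t_def)
    have "zext (coeff P) c = (if t \<le> d then coeff P (d - t) else 0)"
    proof (cases "c < 0")
      case True
      then have "\<not> t \<le> d" using t by linarith
      then show ?thesis using True by (simp add: zext_def)
    next
      case False
      then have "t \<le> d" "nat c = d - t" using t by linarith+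
      then show ?thesis using False by (simp add: zext_def)
    qed
    moreover have "int b - c = int b + int t - int d" for b using t by simp
    ultimately show ?thesis using main[of t] by (simp only: d_def[symmetric])
  next
    case False
    then have "zext (coeff P) c = 0"
      using dP by (auto simp: zext_def intro!: coeff_eq_0)
    moreover have "(\<Sum>b\<le>degree Q. coeff Q b * zext g (int b - c)) = 0"
      using False by (intro sum.neutral) (auto simp: zext_def d_def)
    ultimately show ?thesis by simp
  qed
qed

text \<open>A polynomial \<open>R\<close> that annihilates the impulse response makes \<open>R G\<close> a polynomial \<open>S\<close>; as
  \<open>R P = S Q\<close> and \<open>P\<close>, \<open>Q\<close> share no roots, all poles are roots of \<open>R\<close>.\<close>
lemma system_order_minimal:
  assumes sys: "is_system P Q g"
    and x: "\<exists>b\<le>m. x b \<noteq> 0"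
    and rec: "\<And>s. 1 \<le> s \<Longrightarrow> (\<Sum>b<Suc m. x b * g (s + b)) = 0"
  shows "system_order Q \<le> m"
proof -
  define R where "R = Poly (map x [0..<Suc m])"
  have cR: "coeff R b = (if b \<le> m then x b else 0)" for b
    by (auto simp: R_def nth_default_def simp del: upt_Suc)
  have R0: "R \<noteq> 0" using x cR by (metis coeff_0)
  have degR: "degree R \<le> m" by (rule degree_le) (simp add: cR)
  \<comment> \<open>\<open>Sc c\<close> is the coefficient of \<open>z^c\<close> in
    \<open>R G\<close>. It vanishes for negative \<open>c\<close> by \<open>rec\<close>, and for
    \<open>c > m\<close> because \<open>R\<close> has degree at most \<open>m\<close>; so
    \<open>R G\<close> is the polynomial \<open>S\<close>.\<close>
  define Sc where "Sc = (\<lambda>c. \<Sum>b\<le>degree R. coeff R b * zext g (int b - c))"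
  have Sc_sum: "Sc c = (\<Sum>b<Suc m. x b * zext g (int b - c))" for c
  proof -
    have "Sc c = (\<Sum>b\<le>m. coeff R b * zext g (int b - c))"
      unfolding Sc_def by (rule sum.mono_neutral_left) (use degR in \<open>auto simp: coeff_eq_0\<close>)
    then show ?thesis by (simp add: cR lessThan_Suc_atMost)
  qed
  define S where "S = Poly (map (\<lambda>c. Sc (int c)) [0..<Suc m])"
  have g0: "g 0 = 0" using system_denominator[OF sys] by simp
  have cS: "zext (coeff S) c = Sc c" for c
  proof -
    consider "c < 0" | "0 \<le> c" "nat c \<le> m" | "0 \<le> c" "m < nat c" by linarith
    then show ?thesis
    proof cases
      case 1
      have "zext g (int b - c) = g (nat (- c) + b)" for b
      proof -
        have "int b - c = int (nat (- c) + b)" using 1 by simp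
        then show ?thesis by (simp only: zext_of_nat)
      qed
      then have "Sc c = 0" using rec[of "nat (- c)"] 1 by (simp add: Sc_sum del: sum.lessThan_Suc)
      then show ?thesis using 1 by (simp add: zext_def)
    next
      case 2
      then show ?thesis by (simp add: zext_def S_def nth_default_def del: upt_Suc)
    next
      case 3
      have "Sc c = 0" unfolding Sc_sum
        by (rule sum.neutral) (use 3 in \<open>auto simp: zext_def g0\<close>)
      then show ?thesis using 3 by (simp add: zext_def S_def nth_default_def del: upt_Suc)
    qed
  qed
  have "R * P = Q * S"
  proof (rule poly_eqI)
    fix e
    have "coeff (R * P) e = (\<Sum>a\<le>degree R. coeff R a * (\<Sum>b\<le>degree Q. coeff Q b * zext g (int b - (int e - int a))))"
      unfolding coeff_mult_zext by (simp only: system_recurrence[OF sys])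
    also have "\<dots> = (\<Sum>b\<le>degree Q. \<Sum>a\<le>degree R. coeff R a * (coeff Q b * zext g (int b - (int e - int a))))"
      unfolding sum_distrib_left by (rule sum.swap)
    also have "\<dots> = (\<Sum>b\<le>degree Q. coeff Q b * Sc (int e - int b))"
      unfolding Sc_def sum_distrib_left by (intro sum.cong refl) (simp add: algebra_simps)
    also have "\<dots> = coeff (Q * S) e"
      unfolding coeff_mult_zext by (simp only: cS)
    finally show "coeff (R * P) e = coeff (Q * S) e" .
  qed
  then have RP: "cpoly R * cpoly P = cpoly Q * cpoly S" by (metis cpoly_mult)
  have P0: "P \<noteq> 0" and coprime: "system_zeros P \<inter> system_poles Q = {}"
    using sys by (auto simp: is_system_def)
  have RP0: "cpoly R * cpoly P \<noteq> 0"
    using R0 P0 by (simp add: cpoly_eq_0_iff)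
  have ord: "Polynomial.order z (cpoly Q) \<le> Polynomial.order z (cpoly R)" if "z \<in> system_poles Q" for z
  proof -
    have "poly (cpoly P) z \<noteq> 0" using coprime that by (auto simp: system_zeros_def)
    then have "Polynomial.order z (cpoly R * cpoly P) = Polynomial.order z (cpoly R)"
      using RP0 by (simp add: order_mult order_0I)
    moreover have "Polynomial.order z (cpoly Q * cpoly S) = Polynomial.order z (cpoly Q) + Polynomial.order z (cpoly S)"
      using RP0 by (intro order_mult) (simp add: RP)
    ultimately show ?thesis by (simp add: RP)
  qed
  have "system_order Q \<le> (\<Sum>z\<in>system_poles Q. Polynomial.order z (cpoly R))"
    unfolding system_order_def by (rule sum_mono) (rule ord)
  also have "\<dots> \<le> (\<Sum>z | poly (cpoly R) z = 0. Polynomial.order z (cpoly R))"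
  proof (rule sum_mono2)
    show "finite {z. poly (cpoly R) z = 0}"
      using R0 by (intro poly_roots_finite) (simp add: cpoly_eq_0_iff)
    show "system_poles Q \<subseteq> {z. poly (cpoly R) z = 0}"
    proof
      fix z assume z: "z \<in> system_poles Q"
      then have "Polynomial.order z (cpoly Q) \<noteq> 0"
        using system_denominator(1)[OF sys] by (simp add: system_poles_def order_root cpoly_eq_0_iff)
      with ord[OF z] show "z \<in> {z. poly (cpoly R) z = 0}" by (simp add: order_root)
    qed
  qed auto
  also have "\<dots> \<le> degree (cpoly R)"
    using R0 by (intro sum_order_le_degree) (simp add: cpoly_eq_0_iff)
  also have "\<dots> \<le> m" using degR by (simp add: degree_map_poly)
  finally show ?thesis .
qed

lemma system_recurrence_nat:
  assumes sys: "is_system P Q g" and s: "1 \<le> s"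
  shows "(\<Sum>b\<le>degree Q. coeff Q b * g (s + b)) = 0"
proof -
  have "zext g (int b - - int s) = g (s + b)" for b
    by (simp add: zext_def nat_add_distrib add.commute)
  then show ?thesis
    using system_recurrence[OF sys, of "- int s"] s by (simp add: zext_def)
qed

section \<open>Positivity of Hankel determinants\<close>


text \<open>Isolates what the sign arguments need of the transfer function. Any nonzero coefficient
  counts, so a relation may be padded with zeros.\<close>

locale minimal_recurrence =
  fixes g :: "nat \<Rightarrow> real" and n :: nat
  assumes minimal: "\<lbrakk>\<exists>b\<le>m. x b \<noteq> 0; \<And>s. 1 \<le> s \<Longrightarrow> (\<Sum>b<Suc m. x b * g (s + b)) = 0\<rbrakk> \<Longrightarrow> n \<le> m"
begin

lemma no_degenerate_tail:
  assumes zero: "\<And>s. 2 \<le> s \<Longrightarrow> cdet (Suc m) g s = 0"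
    and nonzero: "\<And>s. 2 \<le> s \<Longrightarrow> cdet m g s \<noteq> 0"
  shows "n \<le> Suc m"
proof -
  obtain x where x: "x m = 1" "\<And>s. 2 \<le> s \<Longrightarrow> (\<Sum>b<Suc m. x b * g (s + b)) = 0"
    using cdet_zero_recurrence[of 2 m g] zero nonzero by blast
  \<comment> \<open>The relation holds only from 2 on. A coefficient 0 put in front makes its
    instance at \<open>s\<close> the old one at \<open>Suc s\<close>, so it holds from 1 on at the
    cost of one order.\<close>
  show ?thesis
  proof (rule minimal)
    show "\<exists>b\<le>Suc m. (case b of 0 \<Rightarrow> 0 | Suc b' \<Rightarrow> x b') \<noteq> 0"
      using x(1) by (intro exI[of _ "Suc m"]) simp
    show "(\<Sum>b<Suc (Suc m). (case b of 0 \<Rightarrow> 0 | Suc b' \<Rightarrow> x b') * g (s + b)) = 0" if "1 \<le> s" for s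
      using x(2)[of "Suc s"] that by (subst sum.lessThan_Suc_shift) (simp del: sum.lessThan_Suc)
  qed
qed

lemma cdet_pos_if_nonneg:
  assumes k: "k \<le> n" and nonneg: "\<And>j t. j \<le> k \<Longrightarrow> 1 \<le> t \<Longrightarrow> 0 \<le> cdet j g t"
    and "j < k" "1 \<le> t"
  shows "0 < cdet j g t"
  using \<open>j < k\<close> \<open>1 \<le> t\<close>
proof (induction j arbitrary: t)
  case (Suc j)
  let ?c = "cdet (Suc j) g"
  have pos: "0 < cdet j g t" if "1 \<le> t" for t
    using Suc.IH Suc.prems(1) that by simp
  have log: "(?c (Suc t))\<^sup>2 \<le> ?c t * ?c (Suc (Suc t))" if "1 \<le> t" for t
  proof -
    have "0 \<le> cdet (Suc (Suc j)) g t * cdet j g (Suc (Suc t))"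
      using nonneg[of "Suc (Suc j)" t] pos[of "Suc (Suc t)"] Suc.prems(1) that by simp
    then show ?thesis using cdet_dodgson[of j g t] by simp
  qed
  show ?case
  proof (rule ccontr)
    assume "\<not> 0 < ?c t"
    then have ct: "?c t = 0" using nonneg[of "Suc j" t] Suc.prems by simp
    have up: "?c (Suc s) = 0" if "?c s = 0" "1 \<le> s" for s
      using log[of s] that by simp
    \<comment> \<open>Downward propagation ends at 2: log-convexity centred at 1 would involve time
      0.\<close>
    have down: "?c (Suc s) = 0" if "?c (Suc (Suc s)) = 0" "1 \<le> s" for s
      using log[of s] that by simp
    have "?c s = 0" if "2 \<le> s" for s
    proof (cases "t \<le> s")
      case True
      then show ?thesis
        by (induction s rule: dec_induct) (use ct up Suc.prems(2) in auto)
    next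
      case False
      then have "s \<le> t" by simp
      then show ?thesis using that
      proof (induction s rule: inc_induct)
        case (step s)
        then obtain s' where "s = Suc s'" "1 \<le> s'" by (cases s) auto
        then show ?case using step down by simp
      qed (use ct in simp)
    qed
    then have "n \<le> Suc j"
      by (intro no_degenerate_tail) (use pos in \<open>auto simp: less_imp_neq[symmetric]\<close>)
    then show False using Suc.prems(1) k by simp
  qed
qed simp

text \<open>Two consecutive times determine the next: the product of the values at \<open>t\<close>
  and \<open>t + 2\<close> is at least the positive square at \<open>t + 1\<close>. The lower-order
  factor at \<open>t + 2\<close> in Dodgson's identity is supplied by the inner induction on
  \<open>j\<close>.\<close>

lemma cdet_pos_propagate:
  assumes init: "\<And>j. j \<le> K \<Longrightarrow> 0 < cdet j g 1 \<and> 0 < cdet j g 2"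
    and nonneg: "\<And>t. 1 \<le> t \<Longrightarrow> 0 \<le> cdet (Suc K) g t"
    and t: "1 \<le> t" and "j \<le> K"
  shows "0 < cdet j g t"
proof -
  have "\<forall>j\<le>K. 0 < cdet j g t \<and> 0 < cdet j g (Suc t)"
    using t
  proof (induction t rule: dec_induct)
    case base
    then show ?case using init by (simp add: numeral_2_eq_2)
  next
    case (step t)
    have "0 < cdet j g (Suc (Suc t))" if "j \<le> K" for j
      using that
    proof (induction j)
      case (Suc j)
      have "0 \<le> cdet (Suc (Suc j)) g t"
        using step nonneg[of t] Suc.prems by (cases "Suc j = K") (auto intro: less_imp_le)
      then have "0 \<le> cdet (Suc (Suc j)) g t * cdet j g (Suc (Suc t))"
        using Suc by simp
      then have "(cdet (Suc j) g (Suc t))\<^sup>2 \<le> cdet (Suc j) g t * cdet (Suc j) g (Suc (Suc t))"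
        using cdet_dodgson[of j g t] by simp
      moreover have "0 < cdet (Suc j) g t" "0 < (cdet (Suc j) g (Suc t))\<^sup>2"
        using step Suc.prems by auto
      ultimately show ?case
        by (metis less_le_trans zero_less_mult_pos)
    qed simp
    then show ?case using step by simp
  qed
  then show ?thesis using \<open>j \<le> K\<close> by simp
qed

text \<open>The scenario to be refuted, where order \<open>Suc L\<close> vanishes at time 2: the
  zero then persists while all lower orders stay positive, exactly the tail excluded by
  \<open>no_degenerate_tail\<close>.\<close>

lemma cdet_degenerate_propagate:
  assumes init: "\<And>j. j \<le> L \<Longrightarrow> 0 < cdet j g 1 \<and> 0 < cdet j g 2"
    and zero: "0 \<le> cdet (Suc L) g 1" "cdet (Suc L) g 2 = 0"
    and nonneg: "\<And>t. 1 \<le> t \<Longrightarrow> 0 \<le> cdet (Suc (Suc L)) g t"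
    and t: "1 \<le> t"
  shows "(\<forall>j\<le>L. 0 < cdet j g t \<and> 0 < cdet j g (Suc t)) \<and> 0 \<le> cdet (Suc L) g t \<and> cdet (Suc L) g (Suc t) = 0"
  using t
proof (induction t rule: dec_induct)
  case base
  then show ?case using init zero by (simp add: numeral_2_eq_2)
next
  case (step t)
  have next_pos: "0 < cdet j g (Suc (Suc s))"
    if pos: "\<And>j. j \<le> L \<Longrightarrow> 0 < cdet j g s \<and> 0 < cdet j g (Suc s)" and nn: "0 \<le> cdet (Suc L) g s" and "j \<le> L" for s j
    using \<open>j \<le> L\<close>
  proof (induction j)
    case (Suc j)
    have "0 \<le> cdet (Suc (Suc j)) g s"
      using pos nn Suc.prems by (cases "Suc j = L") (auto intro: less_imp_le)
    then have "0 \<le> cdet (Suc (Suc j)) g s * cdet j g (Suc (Suc s))"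
      using Suc by simp
    then have "(cdet (Suc j) g (Suc s))\<^sup>2 \<le> cdet (Suc j) g s * cdet (Suc j) g (Suc (Suc s))"
      using cdet_dodgson[of j g s] by simp
    moreover have "0 < cdet (Suc j) g s" "0 < (cdet (Suc j) g (Suc s))\<^sup>2"
      using pos[of "Suc j"] Suc.prems by auto
    ultimately show ?case
      by (metis less_le_trans zero_less_mult_pos)
  qed simp
  have p2: "0 < cdet j g (Suc (Suc t))" if "j \<le> L" for j
    using next_pos[of t j] step that by blast
  have p3: "0 < cdet j g (Suc (Suc (Suc t)))" if "j \<le> L" for j
    using next_pos[of "Suc t" j] step that p2 by simp
  have "0 \<le> cdet (Suc (Suc L)) g (Suc t) * cdet L g (Suc (Suc (Suc t)))"
    using nonneg[of "Suc t"] p3[of L] by simp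
  then have "(cdet (Suc L) g (Suc (Suc t)))\<^sup>2 \<le> 0"
    using cdet_dodgson[of L g "Suc t"] step by simp
  then show ?case using step p2 by simp
qed

text \<open>The values at 1 and 2 are leading principal minors of the two matrices in (iv), those at
  3 and 4 principal minors from the second row on, hence the smaller range of \<open>j\<close>.
  Dodgson's identity centred at 3 makes the values at 2 positive for \<open>j < K\<close>; order
  \<open>K\<close> would degenerate for good if it vanished at 2.\<close>

lemma cdet_pos_if_definite:
  assumes K: "Suc K \<le> n"
    and one: "\<And>j. j \<le> K \<Longrightarrow> 0 < cdet j g 1" and two: "\<And>j. j \<le> K \<Longrightarrow> 0 \<le> cdet j g 2"
    and three: "\<And>j. j < K \<Longrightarrow> 0 < cdet j g 3" and four: "\<And>j. j < K \<Longrightarrow> 0 \<le> cdet j g 4"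
    and nonneg: "\<And>t. 1 \<le> t \<Longrightarrow> 0 \<le> cdet (Suc K) g t"
    and "1 \<le> t" "j \<le> K"
  shows "0 < cdet j g t"
proof -
  have two': "0 < cdet j g 2" if "j < K" for j
  proof (cases j)
    case (Suc i)
    have "0 \<le> cdet (Suc (Suc i)) g 2 * cdet i g 4"
      using two[of "Suc (Suc i)"] four[of i] that Suc by simp
    then have "(cdet j g 3)\<^sup>2 \<le> cdet j g 2 * cdet j g 4"
      using cdet_dodgson[of i g 2] Suc by (simp add: numeral_eq_Suc)
    moreover have "0 < (cdet j g 3)\<^sup>2" using three[OF that] by simp
    ultimately have "cdet j g 2 \<noteq> 0" by auto
    then show ?thesis using two[of j] that by simp
  qed simp
  have "0 < cdet K g 2"
  proof (cases K)
    case (Suc L)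
    show ?thesis
    proof (rule ccontr)
      assume "\<not> ?thesis"
      then have z: "cdet K g 2 = 0" using two[of K] by simp
      have deg: "(\<forall>j\<le>L. 0 < cdet j g t \<and> 0 < cdet j g (Suc t)) \<and> 0 \<le> cdet (Suc L) g t \<and> cdet (Suc L) g (Suc t) = 0"
        if "1 \<le> t" for t
        by (rule cdet_degenerate_propagate)
          (use Suc one[of K] one two' z nonneg that in \<open>auto simp: less_Suc_eq_le intro: less_imp_le\<close>)
      have "n \<le> Suc L"
      proof (rule no_degenerate_tail)
        fix s :: nat assume s: "2 \<le> s"
        then obtain s' where "s = Suc s'" "1 \<le> s'" by (cases s) auto
        then show "cdet (Suc L) g s = 0" "cdet L g s \<noteq> 0"
          using deg[of s'] by auto
      qed
      then show False using K Suc by simp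
    qed
  qed simp
  then have "0 < cdet j g 1 \<and> 0 < cdet j g 2" if "j \<le> K" for j
    using one two' that by (cases "j = K") auto
  then show ?thesis
    by (rule cdet_pos_propagate) (use nonneg assms in auto)
qed

end

section \<open>Definiteness and principal minors of Hankel matrices\<close>

lemma qform_embed:
  assumes "o' + i \<le> n"
  shows "qform i (\<lambda>a b. f (o' + a) (o' + b)) x =
    qform n f (\<lambda>a. if o' \<le> a \<and> a < o' + i then x (a - o') else 0)"
proof -
  let ?y = "\<lambda>a. if o' \<le> a \<and> a < o' + i then x (a - o') else 0"
  have tr: "(\<Sum>a<n. ?y a * h a) = (\<Sum>a<i. x a * h (o' + a))" for h :: "nat \<Rightarrow> real"
  proof -
    have "(\<Sum>a<n. ?y a * h a) = (\<Sum>a\<in>{o'..<o' + i}. x (a - o') * h a)"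
      by (rule sum.mono_neutral_cong_right) (use assms in auto)
    also have "\<dots> = (\<Sum>a<i. x a * h (o' + a))"
      by (rule sum.reindex_bij_witness[of _ "\<lambda>a. o' + a" "\<lambda>a. a - o'"]) auto
    finally show ?thesis .
  qed
  have "qform n f ?y = (\<Sum>a<n. ?y a * (\<Sum>b<n. ?y b * f a b))"
    by (simp add: qform_eq mult.commute)
  also have "\<dots> = (\<Sum>a<i. x a * (\<Sum>b<i. x b * f (o' + a) (o' + b)))"
    by (simp only: tr)
  finally show ?thesis by (simp add: qform_eq mult.commute)
qed

lemma hankel_quadratic_form:
  assumes "v \<in> carrier_vec j"
  shows "v \<bullet> (hankel_mat g t j *\<^sub>v v) = qform j (\<lambda>a b. g (t + a + b)) (\<lambda>a. v $ a)"
  using assms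
  by (auto simp: hankel_mat_def scalar_prod_def qform_eq atLeast0LessThan intro!: sum.cong)

lemma hankel_symmetric: "transpose_mat (hankel_mat g t j) = hankel_mat g t j"
  by (rule eq_matI) (auto simp: hankel_mat_def ac_simps)

lemma hankel_square: "square_mat (hankel_mat g t j)" "dim_row (hankel_mat g t j) = j"
  by (auto simp: hankel_mat_def)

lemma pos_def_hankel_iff:
  "pos_def (hankel_mat g t j) \<longleftrightarrow>
    (\<forall>x. (\<exists>b<j. x b \<noteq> 0) \<longrightarrow> 0 < qform j (\<lambda>a b. g (t + a + b)) x)"
proof -
  have ex: "(\<exists>b<j. x b \<noteq> 0) \<longleftrightarrow> vec j x \<noteq> 0\<^sub>v j" for x :: "nat \<Rightarrow> real"
    by (auto simp: vec_eq_iff)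
  have qf: "qform j f (\<lambda>a. vec j x $ a) = qform j f x" for f x
    by (simp add: qform_def)
  have "(\<forall>x. (\<exists>b<j. x b \<noteq> 0) \<longrightarrow> 0 < qform j (\<lambda>a b. g (t + a + b)) x) \<longleftrightarrow>
      (\<forall>v\<in>carrier_vec j. v \<noteq> 0\<^sub>v j \<longrightarrow> 0 < v \<bullet> (hankel_mat g t j *\<^sub>v v))"
  proof (intro iffI ballI allI impI)
    fix v :: "real vec"
    assume *: "\<forall>x. (\<exists>b<j. x b \<noteq> 0) \<longrightarrow> 0 < qform j (\<lambda>a b. g (t + a + b)) x"
      and v: "v \<in> carrier_vec j" "v \<noteq> 0\<^sub>v j"
    have "vec j (\<lambda>a. v $ a) = v" using v(1) by auto
    then show "0 < v \<bullet> (hankel_mat g t j *\<^sub>v v)"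
      using * v ex[of "\<lambda>a. v $ a"] by (simp add: hankel_quadratic_form)
  next
    fix x :: "nat \<Rightarrow> real"
    assume *: "\<forall>v\<in>carrier_vec j. v \<noteq> 0\<^sub>v j \<longrightarrow> 0 < v \<bullet> (hankel_mat g t j *\<^sub>v v)" and "\<exists>b<j. x b \<noteq> 0"
    then have "0 < vec j x \<bullet> (hankel_mat g t j *\<^sub>v vec j x)" using ex by simp
    then show "0 < qform j (\<lambda>a b. g (t + a + b)) x"
      using hankel_quadratic_form[of "vec j x" j g t] qf by simp
  qed
  then show ?thesis
    by (simp add: pos_def_def hankel_symmetric hankel_square del: square_mat.simps)
qed

lemma pos_semidef_hankel_iff:
  "pos_semidef (hankel_mat g t j) \<longleftrightarrow> (\<forall>x. 0 \<le> qform j (\<lambda>a b. g (t + a + b)) x)"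
proof -
  have qf: "qform j f (\<lambda>a. vec j x $ a) = qform j f x" for f x
    by (simp add: qform_def)
  have "(\<forall>x. 0 \<le> qform j (\<lambda>a b. g (t + a + b)) x) \<longleftrightarrow>
      (\<forall>v\<in>carrier_vec j. 0 \<le> v \<bullet> (hankel_mat g t j *\<^sub>v v))"
  proof (intro iffI ballI allI)
    fix x :: "nat \<Rightarrow> real"
    assume *: "\<forall>v\<in>carrier_vec j. 0 \<le> v \<bullet> (hankel_mat g t j *\<^sub>v v)"
    then have "0 \<le> vec j x \<bullet> (hankel_mat g t j *\<^sub>v vec j x)" by simp
    then show "0 \<le> qform j (\<lambda>a b. g (t + a + b)) x"
      using hankel_quadratic_form[of "vec j x" j g t] qf by simp
  qed (simp add: hankel_quadratic_form)
  then show ?thesis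
    by (simp add: pos_semidef_def hankel_symmetric hankel_square del: square_mat.simps)
qed

text \<open>A principal block starting at offset \<open>o'\<close> shifts both indices, so it is the
  Hankel matrix at time \<open>t + 2 * o'\<close>.\<close>

lemma pos_def_hankel_cdet:
  assumes "pos_def (hankel_mat g t K)" "o' + j \<le> K"
  shows "0 < cdet j g (t + 2 * o')"
proof -
  have eq: "(\<lambda>a b. g (t + 2 * o' + a + b)) = (\<lambda>a b. g (t + (o' + a) + (o' + b)))"
    by (intro ext arg_cong[of _ _ g]) simp
  show ?thesis
    unfolding cdet_def eq
  proof (rule fdet_pos_if_qform_pos)
    fix x :: "nat \<Rightarrow> real" assume "\<exists>b<j. x b \<noteq> 0"
    then obtain b where "b < j" "x b \<noteq> 0" by blast
    then have "\<exists>a<K. (if o' \<le> a \<and> a < o' + j then x (a - o') else 0) \<noteq> 0"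
      using assms(2) by (intro exI[of _ "o' + b"]) auto
    then show "0 < qform j (\<lambda>a b. g (t + (o' + a) + (o' + b))) x"
      using assms by (subst qform_embed[OF assms(2), of "\<lambda>a b. g (t + a + b)"]) (simp add: pos_def_hankel_iff)
  qed
qed

lemma pos_semidef_hankel_cdet:
  assumes "pos_semidef (hankel_mat g t K)" "o' + j \<le> K"
  shows "0 \<le> cdet j g (t + 2 * o')"
proof -
  have eq: "(\<lambda>a b. g (t + 2 * o' + a + b)) = (\<lambda>a b. g (t + (o' + a) + (o' + b)))"
    by (intro ext arg_cong[of _ _ g]) simp
  show ?thesis
    unfolding cdet_def eq
  proof (rule fdet_nonneg_if_qform_nonneg)
    fix x :: "nat \<Rightarrow> real"
    show "0 \<le> qform j (\<lambda>a b. g (t + (o' + a) + (o' + b))) x"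
      using assms by (subst qform_embed[OF assms(2), of "\<lambda>a b. g (t + a + b)"]) (simp add: pos_semidef_hankel_iff)
  qed
qed


section \<open>The pivotal condition, minors and compound systems\<close>

definition hankel_minors_pos :: "nat \<Rightarrow> (nat \<Rightarrow> real) \<Rightarrow> bool" where
  "hankel_minors_pos k g \<longleftrightarrow>
     (\<forall>t\<ge>1. (\<forall>j<k. 0 < cdet j g t) \<and> 0 \<le> cdet k g t)"

lemma compound_eq_cdet: "1 \<le> t \<Longrightarrow> compound j g t = cdet j g t"
  by (simp add: compound_def cdet_def fdet_def hankel_mat_def)

lemma externally_positive_compound_iff:
  "externally_positive (compound j g) \<longleftrightarrow> (\<forall>t\<ge>1. 0 \<le> cdet j g t)"
proof
  assume "externally_positive (compound j g)"
  then show "\<forall>t\<ge>1. 0 \<le> cdet j g t"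
    by (metis externally_positive_def compound_eq_cdet)
next
  assume *: "\<forall>t\<ge>1. 0 \<le> cdet j g t"
  show "externally_positive (compound j g)"
    unfolding externally_positive_def
  proof
    fix t show "0 \<le> compound j g t"
      using * compound_eq_cdet[of t j g] by (cases "t = 0") (auto simp: compound_def)
  qed
qed

lemma det_submatrix_hankel:
  assumes "I \<subseteq> {..<N}" "J \<subseteq> {..<N}" "card I = j" "card J = j"
  shows "det (submatrix (hankel_mat f t N) I J) = fdet j (\<lambda>a b. f (t + pick I a + pick J b))"
proof -
  have dims: "card {i. i < N \<and> i \<in> I} = j" "card {i. i < N \<and> i \<in> J} = j"
  proof -
    have "{i. i < N \<and> i \<in> I} = I" "{i. i < N \<and> i \<in> J} = J" using assms(1,2) by auto
    then show "card {i. i < N \<and> i \<in> I} = j" "card {i. i < N \<and> i \<in> J} = j"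
      using assms(3,4) by simp_all
  qed
  have "submatrix (hankel_mat f t N) I J = mat j j (\<lambda>(a, b). f (t + pick I a + pick J b))"
  proof (rule eq_matI)
    fix a b assume "a < dim_row (mat j j (\<lambda>(a, b). f (t + pick I a + pick J b)))"
      "b < dim_col (mat j j (\<lambda>(a, b). f (t + pick I a + pick J b)))"
    then have ab: "a < j" "b < j" by auto
    then have "pick I a < N" "pick J b < N"
      using assms pick_in_set_le[of a I] pick_in_set_le[of b J] by auto
    then show "submatrix (hankel_mat f t N) I J $$ (a, b) = mat j j (\<lambda>(a, b). f (t + pick I a + pick J b)) $$ (a, b)"
      using ab dims by (simp add: submatrix_def hankel_mat_def)
  qed (use dims in \<open>simp_all add: submatrix_def hankel_mat_def\<close>)
  then show ?thesis by (simp add: fdet_def)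
qed

lemma k_positiveD:
  assumes "k_positive k A" "1 \<le> j" "j \<le> k" "I \<subseteq> {..<dim_row A}" "J \<subseteq> {..<dim_col A}"
    "card I = j" "card J = j"
  shows "0 \<le> det (submatrix A I J)"
proof -
  have "\<forall>I \<subseteq> {..<dim_row A}. \<forall>J \<subseteq> {..<dim_col A}.
      card I = j \<longrightarrow> card J = j \<longrightarrow> 0 \<le> det (submatrix A I J)"
    using assms(1-3) by (simp add: k_positive_def)
  then show ?thesis using assms(4-7) by blast
qed

lemma pick_less_Suc: "Suc a < card I \<Longrightarrow> pick I a < pick I (Suc a)"
  by (rule pick_mono_le) auto

lemma hankel_minors_pos_imp_k_positive:
  assumes "hankel_minors_pos k f"
  shows "hankel_k_positive k f"
  unfolding hankel_k_positive_def k_positive_def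
proof (intro allI ballI impI)
  fix N j I J
  assume j: "j \<in> {1..k}" and IJ: "I \<subseteq> {..<dim_row (hankel_mat f 1 N)}" "J \<subseteq> {..<dim_col (hankel_mat f 1 N)}"
    "card I = j" "card J = j"
  have pos: "0 < cdet i f t" if "i < k" "1 \<le> t" for i t
    using assms that by (simp add: hankel_minors_pos_def)
  have nonneg: "0 \<le> cdet k f t" if "1 \<le> t" for t
    using assms that by (simp add: hankel_minors_pos_def)
  have "0 \<le> cdet j f t" if "1 \<le> t" for t
    using pos[of j t] nonneg[OF that] j that by (cases "j = k") (auto intro: less_imp_le)
  then have "0 \<le> fdet j (\<lambda>a b. f (1 + pick I a + pick J b))"
    by (intro fekete_hankel_nonneg[of j 1 f] pos pick_less_Suc) (use j IJ in simp_all)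
  then show "0 \<le> det (submatrix (hankel_mat f 1 N) I J)"
    using IJ by (subst det_submatrix_hankel[of _ N _ j]) (auto simp: hankel_mat_def)
qed

lemma pick_interval: "i < j \<Longrightarrow> pick {s..<s + j} i = s + i"
proof -
  assume i: "i < j"
  have "{a \<in> {s..<s + j}. a < s + i} = {s..<s + i}" using i by auto
  then show ?thesis
    using pick_card_in_set[of "s + i" "{s..<s + j}"] i by simp
qed

lemma hankel_k_positive_cdet_nonneg:
  assumes "hankel_k_positive k g" "1 \<le> j" "j \<le> k" "1 \<le> t"
  shows "0 \<le> cdet j g t"
proof -
  define s where "s = t - 1"
  \<comment> \<open>Large enough for the window of rows starting at \<open>s\<close> and for the
    requirement \<open>k \<le> N\<close>.\<close>
  define N where "N = s + j + k"
  let ?I = "{s..<s + j}" and ?J = "{0..<0 + j}"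
  have "k_positive k (hankel_mat g 1 N)"
    using assms(1) by (simp add: hankel_k_positive_def N_def)
  then have "0 \<le> det (submatrix (hankel_mat g 1 N) ?I ?J)"
    by (rule k_positiveD[of k _ j]) (use assms in \<open>auto simp: hankel_mat_def N_def\<close>)
  also have "\<dots> = fdet j (\<lambda>a b. g (1 + pick ?I a + pick ?J b))"
    by (rule det_submatrix_hankel) (auto simp: N_def)
  also have "\<dots> = cdet j g t"
    unfolding cdet_def
  proof (rule fdet_cong)
    fix a b assume "a < j" "b < j"
    then show "g (1 + pick ?I a + pick ?J b) = g (t + a + b)"
      using assms(4) by (simp only: pick_interval) (simp add: s_def)
  qed
  finally show ?thesis .
qed

lemma hankel_k_positive_cong:
  assumes "\<And>t. 1 \<le> t \<Longrightarrow> f t = h t"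
  shows "hankel_k_positive k f \<longleftrightarrow> hankel_k_positive k h"
proof -
  have "hankel_mat f 1 N = hankel_mat h 1 N" for N
    by (rule eq_matI) (auto simp: hankel_mat_def assms)
  then show ?thesis by (simp add: hankel_k_positive_def)
qed

text \<open>The entries of a Hankel matrix of \<open>compound j g\<close> are the consecutive
  \<open>j\<close>-minors of the Hankel matrix of \<open>g\<close>, so the Gram representation
  applies.\<close>

lemma hankel_minors_pos_compound:
  assumes sp: "hankel_minors_pos k g" and j: "1 \<le> j" "j \<le> k"
  shows "hankel_minors_pos (k - j + 1) (compound j g)"
  unfolding hankel_minors_pos_def
proof (intro allI impI conjI)
  fix t :: nat assume t: "1 \<le> t"
  define h where "h = (\<lambda>a b. g (t + a + b))"
  have sym: "h a b = h b a" for a b by (simp add: h_def ac_simps)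
  have h: "fdet l h = cdet l g t" for l by (simp add: h_def cdet_def)
  have pos: "0 < fdet l h" if "l < k" for l
    using sp that t by (simp add: h hankel_minors_pos_def)
  have nonneg: "0 \<le> fdet k h"
    using sp t by (simp add: h hankel_minors_pos_def)
  have eq: "cdet i (compound j g) t = fdet i (\<lambda>a b. fdet j (\<lambda>u v. h (a + u) (b + v)))" for i
    unfolding cdet_def
  proof (rule fdet_cong)
    fix a b
    show "compound j g (t + a + b) = fdet j (\<lambda>u v. h (a + u) (b + v))"
      using t by (simp add: compound_eq_cdet cdet_def h_def ac_simps)
  qed
  \<comment> \<open>Here only leading minors of order up to \<open>i + j - 1 < k\<close> occur, all
    positive. At \<open>i = k - j + 1\<close> the order \<open>k\<close> is reached and strictness
    is lost.\<close>
  show "0 < cdet i (compound j g) t" if i: "i < k - j + 1" for i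
  proof (cases "i = 0")
    case False
    show ?thesis unfolding eq
    proof (rule fdet_pos_if_qform_pos)
      fix x :: "nat \<Rightarrow> real" assume "\<exists>b<i. x b \<noteq> 0"
      then show "0 < qform i (\<lambda>a b. fdet j (\<lambda>u v. h (a + u) (b + v))) x"
        by (intro qform_compound_pos[of h "i + j - 1"] sym pos) (use i j False in auto)
    qed
  qed simp
  show "0 \<le> cdet (k - j + 1) (compound j g) t"
    unfolding eq
    by (intro fdet_nonneg_if_qform_nonneg qform_compound_nonneg[of h k] sym pos nonneg) (use j in auto)
qed

text \<open>The compound of 1-minors is the matrix itself.\<close>

lemma hankel_minors_pos_pos_def:
  assumes sp: "hankel_minors_pos (Suc K) g" and t: "1 \<le> t"
  shows "pos_def (hankel_mat g t K)"
  unfolding pos_def_hankel_iff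
proof (intro allI impI)
  fix x :: "nat \<Rightarrow> real" assume x: "\<exists>b<K. x b \<noteq> 0"
  have "0 < qform K (\<lambda>a b. fdet 1 (\<lambda>u v. g (t + (a + u) + (b + v)))) x"
  proof (rule qform_compound_pos[of "\<lambda>a b. g (t + a + b)" K, OF _ _ _ _ x])
    show "g (t + a + b) = g (t + b + a)" for a b by (simp add: ac_simps)
    show "0 < fdet l (\<lambda>a b. g (t + a + b))" if "l \<le> K" for l
      using sp t that by (simp add: hankel_minors_pos_def cdet_def)
  qed auto
  then show "0 < qform K (\<lambda>a b. g (t + a + b)) x"
    by (simp add: fdet_1)
qed

lemma pos_def_imp_pos_semidef: "pos_def A \<Longrightarrow> pos_semidef A"
  unfolding pos_def_def pos_semidef_def
proof safe
  fix v :: "real vec"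
  assume *: "\<forall>v\<in>carrier_vec (dim_row A). v \<noteq> 0\<^sub>v (dim_row A) \<longrightarrow> 0 < v \<bullet> (A *\<^sub>v v)"
    and v: "v \<in> carrier_vec (dim_row A)"
  show "0 \<le> v \<bullet> (A *\<^sub>v v)"
  proof (cases "v = 0\<^sub>v (dim_row A)")
    case True
    then have "v \<bullet> (A *\<^sub>v v) = 0" by (simp add: scalar_prod_def)
    then show ?thesis by simp
  next
    case False
    then show ?thesis using * v by (simp add: less_imp_le)
  qed
qed

context minimal_recurrence
begin

lemma hankel_minors_pos_iff_externally_positive:
  assumes "k \<le> n" "1 \<le> k"
  shows "hankel_minors_pos k g \<longleftrightarrow> (\<forall>j\<in>{1..k}. externally_positive (compound j g))"
proof
  assume sp: "hankel_minors_pos k g"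
  have "0 \<le> cdet j g t" if "j \<le> k" "1 \<le> t" for j t
    using sp that by (cases "j = k") (auto simp: hankel_minors_pos_def intro: less_imp_le)
  then show "\<forall>j\<in>{1..k}. externally_positive (compound j g)"
    by (simp add: externally_positive_compound_iff)
next
  assume *: "\<forall>j\<in>{1..k}. externally_positive (compound j g)"
  have "0 \<le> cdet j g t" if "j \<le> k" "1 \<le> t" for j t
    using * that by (cases "j = 0") (auto simp: externally_positive_compound_iff)
  then show "hankel_minors_pos k g"
    unfolding hankel_minors_pos_def using cdet_pos_if_nonneg[OF assms(1)] by blast
qed

lemma hankel_minors_pos_iff_definite:
  assumes "k \<le> n" "1 \<le> k"
  shows "hankel_minors_pos k g \<longleftrightarrow>
    pos_def (hankel_mat g 1 (k - 1)) \<and> pos_semidef (hankel_mat g 2 (k - 1)) \<and>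
    externally_positive (compound k g)"
proof -
  obtain K where k: "k = Suc K" using assms(2) by (cases k) auto
  show ?thesis
  proof
    assume sp: "hankel_minors_pos k g"
    then have "externally_positive (compound k g)"
      by (simp add: hankel_minors_pos_def externally_positive_compound_iff)
    then show "pos_def (hankel_mat g 1 (k - 1)) \<and> pos_semidef (hankel_mat g 2 (k - 1)) \<and>
        externally_positive (compound k g)"
      using hankel_minors_pos_pos_def[of K g] sp pos_def_imp_pos_semidef unfolding k by simp
  next
    assume "pos_def (hankel_mat g 1 (k - 1)) \<and> pos_semidef (hankel_mat g 2 (k - 1)) \<and>
        externally_positive (compound k g)"
    then have pd: "pos_def (hankel_mat g 1 K)" and psd: "pos_semidef (hankel_mat g 2 K)"
      and ep: "\<And>t. 1 \<le> t \<Longrightarrow> 0 \<le> cdet (Suc K) g t"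
      by (auto simp: k externally_positive_compound_iff)
    have "0 < cdet j g t" if "j \<le> K" "1 \<le> t" for j t
    proof (rule cdet_pos_if_definite[OF _ _ _ _ _ ep that(2,1)])
      show "Suc K \<le> n" using assms k by simp
    next
      fix j assume "j \<le> K"
      then show "0 < cdet j g 1" using pos_def_hankel_cdet[OF pd, of 0 j] by simp
    next
      fix j assume "j \<le> K"
      then show "0 \<le> cdet j g 2" using pos_semidef_hankel_cdet[OF psd, of 0 j] by simp
    next
      fix j assume "j < K"
      then show "0 < cdet j g 3" using pos_def_hankel_cdet[OF pd, of 1 j] by (simp add: numeral_eq_Suc)
    next
      fix j assume "j < K"
      then show "0 \<le> cdet j g 4" using pos_semidef_hankel_cdet[OF psd, of 1 j] by (simp add: numeral_eq_Suc)
    qed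
    then show "hankel_minors_pos k g"
      using ep by (simp add: hankel_minors_pos_def k)
  qed
qed

lemma hankel_minors_pos_iff_k_positive:
  assumes "k \<le> n" "1 \<le> k"
  shows "hankel_minors_pos k g \<longleftrightarrow> hankel_k_positive k g"
proof
  assume "hankel_k_positive k g"
  then have "\<forall>j\<in>{1..k}. externally_positive (compound j g)"
    by (auto simp: externally_positive_compound_iff intro!: hankel_k_positive_cdet_nonneg)
  then show "hankel_minors_pos k g"
    by (simp only: hankel_minors_pos_iff_externally_positive[OF assms])
qed (rule hankel_minors_pos_imp_k_positive)

text \<open>The converse reads off \<open>j = 1\<close>, where the compound system is
  \<open>g\<close> at all times from 1 on.\<close>

lemma hankel_minors_pos_iff_compound_k_positive:
  assumes "k \<le> n" "1 \<le> k"
  shows "hankel_minors_pos k g \<longleftrightarrow> (\<forall>j\<in>{1..k}. hankel_k_positive (k - j + 1) (compound j g))"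
proof
  assume sp: "hankel_minors_pos k g"
  show "\<forall>j\<in>{1..k}. hankel_k_positive (k - j + 1) (compound j g)"
  proof
    fix j assume "j \<in> {1..k}"
    then show "hankel_k_positive (k - j + 1) (compound j g)"
      by (intro hankel_minors_pos_imp_k_positive hankel_minors_pos_compound sp) simp_all
  qed
next
  assume *: "\<forall>j\<in>{1..k}. hankel_k_positive (k - j + 1) (compound j g)"
  have "hankel_k_positive (k - 1 + 1) (compound 1 g)"
    by (rule bspec[OF *]) (use assms in simp)
  moreover have "hankel_k_positive k (compound 1 g) \<longleftrightarrow> hankel_k_positive k g"
    by (rule hankel_k_positive_cong) (simp add: compound_eq_cdet)
  ultimately show "hankel_minors_pos k g"
    using assms hankel_minors_pos_iff_k_positive by simp
qed

end

section \<open>Sign changes and blocks\<close>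


text \<open>Labels the maximal blocks of constant sign of \<open>u\<close>.\<close>
definition block :: "(nat \<Rightarrow> real) \<Rightarrow> nat \<Rightarrow> nat" where
  "block u i = card {pq \<in> sign_changes u. snd pq \<le> i}"

lemma finite_sign_changes_upto: "finite {pq \<in> sign_changes u. snd pq \<le> i}"
  by (rule finite_subset[of _ "{..i} \<times> {..i}"]) (auto simp: sign_changes_def)

lemma block_mono: "i \<le> j \<Longrightarrow> block u i \<le> block u j"
  unfolding block_def by (rule card_mono[OF finite_sign_changes_upto]) auto

lemma block_less: "block u i < block u j \<Longrightarrow> i < j"
  using block_mono[of j i u] by (meson leD not_le_imp_less)

lemma sign_changes_unique_end:
  assumes "(p, q) \<in> sign_changes u" "(p', q) \<in> sign_changes u"
  shows "p = p'"
proof (rule ccontr)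
  assume "p \<noteq> p'"
  then consider "p < p'" | "p' < p" by linarith
  then show False
    using assms by cases (auto simp: sign_changes_def)
qed

lemma block_Suc_le: "block u (Suc i) \<le> Suc (block u i)"
  and block_Suc_nonzero: "block u (Suc i) \<noteq> block u i \<Longrightarrow> u (Suc i) \<noteq> 0"
proof -
  let ?S = "\<lambda>i. {pq \<in> sign_changes u. snd pq \<le> i}" and ?T = "{pq \<in> sign_changes u. snd pq = Suc i}"
  have S: "?S (Suc i) = ?S i \<union> ?T" by auto
  have T: "finite ?T" by (rule finite_subset[OF _ finite_sign_changes_upto[of u "Suc i"]]) auto
  have card_S: "block u (Suc i) = block u i + card ?T"
    unfolding block_def S by (rule card_Un_disjoint) (use T finite_sign_changes_upto in auto)
  have "card ?T \<le> 1"
    by (rule card_le_Suc0_iff_eq[THEN iffD2, OF T, unfolded One_nat_def[symmetric]])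
      (auto dest: sign_changes_unique_end)
  then show "block u (Suc i) \<le> Suc (block u i)" using card_S by simp
  assume "block u (Suc i) \<noteq> block u i"
  then have "?T \<noteq> {}" using card_S by (metis add.right_neutral card.empty)
  then show "u (Suc i) \<noteq> 0" by (auto simp: sign_changes_def)
qed

lemma block_first:
  assumes "\<And>p. p < i \<Longrightarrow> u p = 0"
  shows "block u i = 0"
proof -
  have "{pq \<in> sign_changes u. snd pq \<le> i} = {}"
    using assms by (fastforce simp: sign_changes_def)
  then show ?thesis by (simp only: block_def card.empty)
qed

lemma block_0 [simp]: "block u 0 = 0"
  by (rule block_first) simp

lemma block_next:
  assumes p: "p < i" "u p \<noteq> 0" "u i \<noteq> 0" and zero: "\<And>l. p < l \<Longrightarrow> l < i \<Longrightarrow> u l = 0"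
  shows "block u i = block u p + (if u p * u i < 0 then 1 else 0)"
proof -
  let ?S = "\<lambda>i. {pq \<in> sign_changes u. snd pq \<le> i}"
  have S: "?S i = ?S p \<union> (if u p * u i < 0 then {(p, i)} else {})" (is "_ = ?R")
  proof
    show "?S i \<subseteq> ?R"
    proof
      fix x assume "x \<in> ?S i"
      then obtain a q where x: "x = (a, q)" "(a, q) \<in> sign_changes u" "q \<le> i"
        by (cases x) auto
      then have aq: "a < q" "u a * u q < 0" "\<And>l. a < l \<Longrightarrow> l < q \<Longrightarrow> u l = 0"
        by (auto simp: sign_changes_def)
      show "x \<in> ?R"
      proof (cases "q \<le> p")
        case False
        then have "q = i" using zero[of q] x(3) aq(2) by (cases "q = i") auto
        moreover have "a = p"
          using zero[of a] aq p \<open>q = i\<close> by (cases a p rule: linorder_cases) auto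
        ultimately show ?thesis using aq(2) x(1) by simp
      qed (use x in auto)
    qed
    show "?R \<subseteq> ?S i"
      using p zero by (auto simp: sign_changes_def split: if_splits)
  qed
  show ?thesis
  proof (cases "u p * u i < 0")
    case True
    have "card (?S p \<union> {(p, i)}) = card (?S p) + card {(p, i)}"
      by (rule card_Un_disjoint) (use finite_sign_changes_upto p in auto)
    then show ?thesis using S True by (simp add: block_def)
  next
    case False
    then show ?thesis using S by (simp add: block_def)
  qed
qed

text \<open>From one nonzero entry to the next, the label rises by one exactly when the sign flips;
  the induction descends to the preceding nonzero entry.\<close>

lemma sgn_eq_block:
  assumes "u i \<noteq> 0"
  shows "sgn (u i) = first_sign u * (-1) ^ block u i"
  using assms
proof (induction i rule: less_induct)
  case (less i)
  show ?case
  proof (cases "\<exists>p<i. u p \<noteq> 0")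
    case False
    then have "(LEAST i. u i \<noteq> 0) = i"
      using less.prems by (intro Least_equality) (auto simp: not_le[symmetric])
    then show ?thesis using False block_first[of i u] by (simp add: first_sign_def)
  next
    case True
    define p where "p = Max {p. p < i \<and> u p \<noteq> 0}"
    have "p \<in> {p. p < i \<and> u p \<noteq> 0}"
      unfolding p_def using True by (intro Max_in) auto
    then have p: "p < i" "u p \<noteq> 0" by auto
    have zero: "u l = 0" if "p < l" "l < i" for l
    proof (rule ccontr)
      assume "u l \<noteq> 0"
      with that have "l \<le> p" unfolding p_def by (intro Max_ge) auto
      with that show False by simp
    qed
    have "sgn (u i) = (if u p * u i < 0 then - sgn (u p) else sgn (u p))"
      using p less.prems by (auto simp: sgn_real_def mult_less_0_iff)
    then show ?thesis
      using less.IH[OF p] block_next[of p i u] p less.prems zero by (simp split: if_splits)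
  qed
qed

text \<open>Reduces a possibly infinite variation to finite counts: any finite set of sign changes
  is complete up to some position, where the label has at least its size.\<close>

lemma variation_ge_iff: "enat b \<le> variation u \<longleftrightarrow> (\<exists>i. b \<le> block u i)"
proof
  assume "\<exists>i. b \<le> block u i"
  then obtain i where "b \<le> block u i" by blast
  moreover have "block u i \<le> card (sign_changes u)" if "finite (sign_changes u)"
    unfolding block_def using that by (intro card_mono) auto
  ultimately show "enat b \<le> variation u"
    by (auto simp: variation_def)
next
  assume b: "enat b \<le> variation u"
  obtain F where F: "finite F" "F \<subseteq> sign_changes u" "b \<le> card F"
  proof (cases "finite (sign_changes u)")
    case True
    then show ?thesis using that[of "sign_changes u"] b by (simp add: variation_def)
  next
    case False
    then show ?thesis using infinite_arbitrarily_large[of "sign_changes u" b] that by auto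
  qed
  define i where "i = Max (insert 0 (snd ` F))"
  have "F \<subseteq> {pq \<in> sign_changes u. snd pq \<le> i}"
    using F(1,2) by (auto simp: i_def intro!: Max_ge)
  then have "card F \<le> block u i"
    unfolding block_def by (intro card_mono finite_sign_changes_upto)
  then show "\<exists>i. b \<le> block u i" using F(3) le_trans by blast
qed

lemma block_le_variation: "variation u = enat m \<Longrightarrow> block u i \<le> m"
  using variation_ge_iff[of "block u i" u] by auto

text \<open>Labels rise in unit steps and only at nonzero entries, so none is skipped.\<close>

lemma block_attained:
  assumes "enat b \<le> variation u" and nz: "u \<noteq> (\<lambda>_. 0)"
  shows "\<exists>i. u i \<noteq> 0 \<and> block u i = b"
proof (cases b)
  case 0
  obtain i where "u i \<noteq> 0" using nz by auto
  then have *: "u (LEAST i. u i \<noteq> 0) \<noteq> 0" by (rule LeastI)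
  moreover have "block u (LEAST i. u i \<noteq> 0) = 0"
    by (rule block_first) (use not_less_Least in blast)
  ultimately show ?thesis using 0 by blast
next
  case (Suc b')
  obtain i0 where "b \<le> block u i0" using assms(1) variation_ge_iff by blast
  then have *: "b \<le> block u (LEAST i. b \<le> block u i)" by (rule LeastI)
  obtain i where i: "(LEAST i. b \<le> block u i) = Suc i"
    using * Suc by (cases "LEAST i. b \<le> block u i") auto
  have "\<not> b \<le> block u i" using not_less_Least[of i "\<lambda>i. b \<le> block u i"] i by simp
  then have "block u (Suc i) = b" "block u (Suc i) \<noteq> block u i"
    using * i block_Suc_le[of u i] by auto
  then show ?thesis using block_Suc_nonzero[of u i] by blast
qed

text \<open>One nonzero entry is picked from each block. This is the form in which variation meets
  minors, the chosen times serving as rows.\<close>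

lemma variation_imp_alternation:
  assumes "enat m \<le> variation y" and "y \<noteq> (\<lambda>_. 0)"
  shows "\<exists>t. (\<forall>b<m. t b < t (Suc b)) \<and> (\<forall>b\<le>m. y (t b) \<noteq> 0 \<and> sgn (y (t b)) = first_sign y * (-1) ^ b)"
proof -
  have "\<exists>i. y i \<noteq> 0 \<and> block y i = b" if "b \<le> m" for b
    by (rule block_attained) (use assms that in \<open>auto intro: order_trans[of _ "enat m"]\<close>)
  then obtain t where t: "\<And>b. b \<le> m \<Longrightarrow> y (t b) \<noteq> 0 \<and> block y (t b) = b" by metis
  show ?thesis
  proof (intro exI[of _ t] conjI allI impI)
    fix b assume "b < m"
    then have "block y (t b) < block y (t (Suc b))" using t[of b] t[of "Suc b"] by simp
    then show "t b < t (Suc b)" by (rule block_less)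
  next
    fix b assume "b \<le> m"
    then show "y (t b) \<noteq> 0" "sgn (y (t b)) = first_sign y * (-1) ^ b"
      using t sgn_eq_block[of y "t b"] by auto
  qed
qed

lemma first_sign_cases:
  assumes "y \<noteq> (\<lambda>_. 0)"
  shows "first_sign y = 1 \<or> first_sign y = -1"
proof -
  obtain i where "y i \<noteq> 0" using assms by auto
  then have "y (LEAST i. y i \<noteq> 0) \<noteq> 0" by (rule LeastI)
  then show ?thesis by (auto simp: first_sign_def sgn_real_def)
qed

lemma alternation_imp_block:
  assumes mono: "\<And>b. b < m \<Longrightarrow> t b < t (Suc b)"
    and alt: "\<And>b. b \<le> m \<Longrightarrow> y (t b) \<noteq> 0 \<and> sgn (y (t b)) = \<sigma> * (-1) ^ b"
    and "b \<le> m"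
  shows "block y (t 0) + b \<le> block y (t b)"
  using \<open>b \<le> m\<close>
proof (induction b)
  case (Suc b)
  have ne: "y (t b) \<noteq> 0" "y (t (Suc b)) \<noteq> 0" using alt Suc.prems by auto
  have "sgn (y (t (Suc b))) = - sgn (y (t b))"
    using alt[of b] alt[of "Suc b"] Suc.prems by simp
  then have "first_sign y * (-1) ^ block y (t (Suc b)) \<noteq> first_sign y * (-1) ^ block y (t b)"
    using sgn_eq_block[of y] ne by (metis neg_equal_zero sgn_eq_0_iff)
  then have "block y (t (Suc b)) \<noteq> block y (t b)" by auto
  moreover have "block y (t b) \<le> block y (t (Suc b))"
    using mono[of b] Suc.prems by (intro block_mono) simp
  ultimately show ?case using Suc by simp
qed simp

lemma alternation_imp_variation:
  assumes "\<And>b. b < m \<Longrightarrow> t b < t (Suc b)"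
    and "\<And>b. b \<le> m \<Longrightarrow> y (t b) \<noteq> 0 \<and> sgn (y (t b)) = \<sigma> * (-1) ^ b"
  shows "enat m \<le> variation y"
  using alternation_imp_block[OF assms, of m] variation_ge_iff[of m y]
  by (meson le_add2 le_trans order_refl)

text \<open>The alternation uses up the whole variation, so no sign change can precede
  \<open>t 0\<close>.\<close>

lemma alternation_imp_first_sign:
  assumes "\<And>b. b < m \<Longrightarrow> t b < t (Suc b)"
    and "\<And>b. b \<le> m \<Longrightarrow> y (t b) \<noteq> 0 \<and> sgn (y (t b)) = \<sigma> * (-1) ^ b"
    and var: "variation y = enat m"
  shows "first_sign y = \<sigma>"
proof -
  have "block y (t 0) + m \<le> m"
    using alternation_imp_block[OF assms(1,2) order_refl] block_le_variation[OF var, of "t m"]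
    by (rule order_trans)
  then have "block y (t 0) = 0" by simp
  then show ?thesis
    using sgn_eq_block[of y "t 0"] assms(2)[of 0] by simp
qed

section \<open>Order preservation implies nonnegative minors\<close>


lemma fcof_row_orthogonal:
  assumes "i < n" "p < n"
  shows "(\<Sum>k<n. f i k * fcof n f p k) = (if i = p then fdet n f else 0)"
proof (cases "i = p")
  case True
  then show ?thesis using assms laplace_row[of p n f] by simp
next
  case False
  have "fdet n (f(p := f i)) = 0"
    by (rule fdet_identical_rows[of p n i]) (use assms False in auto)
  then show ?thesis using False fdet_row_upd[OF assms(2), of f "f i"] by simp
qed

lemma increasing_less:
  fixes r :: "nat \<Rightarrow> nat"
  assumes "\<And>a. Suc a < m \<Longrightarrow> r a < r (Suc a)" "i < j" "j < m"
  shows "r i < r j"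
  using assms(2,3)
proof (induction j)
  case (Suc j)
  show ?case
  proof (cases "i = j")
    case True
    then show ?thesis using assms(1)[of j] Suc.prems by simp
  next
    case False
    then have "r i < r j" using Suc by simp
    also have "r j < r (Suc j)" using assms(1)[of j] Suc.prems by simp
    finally show ?thesis .
  qed
qed simp

lemma increasing_skip:
  fixes r :: "nat \<Rightarrow> nat"
  assumes "\<And>a. Suc a < Suc m \<Longrightarrow> r a < r (Suc a)" "Suc a < m"
  shows "r (if a < p then a else Suc a) < r (if Suc a < p then Suc a else Suc (Suc a))"
  by (rule increasing_less[of "Suc m" r, OF assms(1)]) (use assms(2) in auto)

text \<open>The finitely supported input with value \<open>w b\<close> at position
  \<open>c b\<close>. Being a sum over \<open>b\<close>, its response is linear in \<open>w\<close>
  before injectivity of \<open>c\<close> is known.\<close>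

definition comb :: "nat \<Rightarrow> (nat \<Rightarrow> nat) \<Rightarrow> (nat \<Rightarrow> real) \<Rightarrow> nat \<Rightarrow> real" where
  "comb j c w i = (\<Sum>b<j. if c b = i then w b else 0)"

lemma comb_support: "comb j c w i \<noteq> 0 \<Longrightarrow> i \<in> c ` {..<j}"
proof (rule ccontr)
  assume nz: "comb j c w i \<noteq> 0" and "i \<notin> c ` {..<j}"
  then have "comb j c w i = 0"
    unfolding comb_def by (intro sum.neutral) auto
  with nz show False by simp
qed

lemma comb_at:
  assumes "inj_on c {..<j}" "b < j"
  shows "comb j c w (c b) = w b"
proof -
  have "comb j c w (c b) = (\<Sum>b'<j. if b' = b then w b' else 0)"
    unfolding comb_def by (rule sum.cong) (use assms in \<open>auto simp: inj_on_def\<close>)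
  then show ?thesis using assms(2) by simp
qed

lemma hankel_comb_sums:
  "(\<lambda>i. g (t + Suc i) * comb j c w i) sums (\<Sum>b<j. g (t + Suc (c b)) * w b)"
proof -
  have "(\<lambda>i. g (t + Suc i) * comb j c w i) sums (\<Sum>i\<in>c ` {..<j}. g (t + Suc i) * comb j c w i)"
    by (rule sums_finite) (use comb_support in auto)
  also have "(\<Sum>i\<in>c ` {..<j}. g (t + Suc i) * comb j c w i) =
      (\<Sum>b<j. \<Sum>i\<in>c ` {..<j}. if c b = i then g (t + Suc i) * w b else 0)"
    unfolding comb_def sum_distrib_left by (subst sum.swap) (auto intro!: sum.cong)
  also have "\<dots> = (\<Sum>b<j. g (t + Suc (c b)) * w b)"
    by (intro sum.cong refl) (simp add: sum.delta)
  finally show ?thesis .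
qed

lemma hankel_op_comb: "hankel_op g (comb j c w) t = (\<Sum>b<j. g (t + Suc (c b)) * w b)"
  unfolding hankel_op_def using hankel_comb_sums by (rule sums_unique[symmetric])

lemma comb_in_hankel_domain:
  assumes "Bseq g"
  shows "comb j c w \<in> hankel_domain g"
proof -
  have "norm (comb j c w i) \<le> (\<Sum>b<j. norm (w b))" for i
    unfolding comb_def by (rule sum_norm_le) simp
  then have 1: "Bseq (comb j c w)" by (rule BseqI')
  obtain C where C: "\<And>t. norm (g t) \<le> C" using assms by (auto simp: Bseq_def)
  have "norm (hankel_op g (comb j c w) t) \<le> (\<Sum>b<j. C * norm (w b))" for t
    unfolding hankel_op_comb
    by (rule sum_norm_le) (auto simp: norm_mult intro!: mult_right_mono C simp del: real_norm_def)
  then have 2: "Bseq (hankel_op g (comb j c w))" by (rule BseqI')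
  show ?thesis
    using 1 2 hankel_comb_sums by (auto simp: hankel_domain_def sums_iff)
qed

text \<open>An alternation with \<open>j\<close> changes would need \<open>j + 1\<close> distinct
  points in the support.\<close>

lemma comb_variation_le:
  assumes "0 < j"
  shows "variation (comb j c w) \<le> enat (j - 1)"
proof (rule ccontr)
  let ?u = "comb j c w"
  assume "\<not> ?thesis"
  then have *: "enat j \<le> variation ?u"
    using assms by (cases "variation ?u") auto
  have "?u \<noteq> (\<lambda>_. 0)"
  proof
    assume "?u = (\<lambda>_. 0)"
    then have "variation ?u = 0" by (simp add: variation_def sign_changes_def zero_enat_def)
    then show False using * assms by (simp add: zero_enat_def)
  qed
  from variation_imp_alternation[OF * this] obtain t where
    t: "\<And>b. b < j \<Longrightarrow> t b < t (Suc b)" "\<And>b. b \<le> j \<Longrightarrow> ?u (t b) \<noteq> 0" by blast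
  have less: "t a < t b" if "a < b" "b \<le> j" for a b
    by (rule increasing_less[of "Suc j" t]) (use t(1) that in auto)
  have "inj_on t {..j}"
    unfolding inj_on_def by (metis less atMost_iff linorder_neqE_nat less_irrefl)
  moreover have "t ` {..j} \<subseteq> c ` {..<j}"
    using t(2) comb_support by blast
  ultimately have "card {..j} \<le> card (c ` {..<j})"
    by (metis card_image card_mono finite_imageI finite_lessThan)
  also have "\<dots> \<le> j" using card_image_le[of "{..<j}" c] by simp
  finally show False by simp
qed

text \<open>If a minor with rows \<open>r\<close> and columns \<open>c\<close> were negative, the input supported on \<open>c\<close> with values
  \<open>adj A\<close> applied to an alternating vector would alternate with positive first sign, while the output
  alternates along \<open>r\<close> with negative first sign.\<close>
lemma ovd_minors_nonneg:
  assumes ovd: "hankel_ovd (k - 1) g" and g: "Bseq g" and "j \<le> k"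
    and "\<And>a. Suc a < j \<Longrightarrow> r a < r (Suc a)" "\<And>a. Suc a < j \<Longrightarrow> c a < c (Suc a)"
  shows "0 \<le> fdet j (\<lambda>a b. g (r a + Suc (c b)))"
  using assms(3-5)
proof (induction j arbitrary: r c)
  case (Suc j)
  define A where "A = (\<lambda>a b. g (r a + Suc (c b)))"
  define p where "p = (\<lambda>b. \<Sum>a<Suc j. \<bar>fcof (Suc j) A a b\<bar>)"
  \<comment> \<open>By induction the minors of order \<open>j\<close> are nonnegative, so the
    cofactors follow the checkerboard pattern. The sums in the adjugate applied to the alternating
    vector then have no cancellation, and \<open>w b\<close> has the sign
    \<open>(-1)^b\<close>.\<close>
  have fcof_abs: "\<bar>fcof (Suc j) A a b\<bar> = (-1) ^ (a + b) * fcof (Suc j) A a b" for a b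
  proof -
    define r' where "r' = (\<lambda>a'. r (if a' < a then a' else Suc a'))"
    define c' where "c' = (\<lambda>b'. c (if b' < b then b' else Suc b'))"
    have "0 \<le> fdet j (\<lambda>a b. g (r' a + Suc (c' b)))"
    proof (rule Suc.IH)
      show "j \<le> k" using Suc.prems(1) by simp
      show "r' a < r' (Suc a)" if "Suc a < j" for a
        unfolding r'_def by (rule increasing_skip[where m = j and r = r]) (use Suc.prems(2) that in blast)+
      show "c' a < c' (Suc a)" if "Suc a < j" for a
        unfolding c'_def by (rule increasing_skip[where m = j and r = c]) (use Suc.prems(3) that in blast)+
    qed
    then have nn: "0 \<le> fdet j (\<lambda>a' b'. A (if a' < a then a' else Suc a') (if b' < b then b' else Suc b'))"
      by (simp only: A_def r'_def c'_def)
    have sq: "(-1 :: real) ^ (a + b) * (-1) ^ (a + b) = 1"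
      by (simp add: power_mult_distrib[symmetric])
    show ?thesis using nn sq unfolding fcof_def by (simp add: abs_mult mult.assoc[symmetric])
  qed
  show ?case
  proof (rule ccontr)
    assume "\<not> ?thesis"
    then have neg: "fdet (Suc j) A < 0" by (simp add: A_def)
    have p_pos: "0 < p b" if "b < Suc j" for b
    proof -
      have "\<exists>a<Suc j. fcof (Suc j) A a b \<noteq> 0"
        using laplace_col[OF that, of A] neg by (metis (no_types, lifting) lessThan_iff less_irrefl mult_zero_right sum.neutral)
      then obtain a where "a < Suc j" "fcof (Suc j) A a b \<noteq> 0" by blast
      then show ?thesis unfolding p_def by (intro sum_pos2[of _ a]) auto
    qed
    define w where "w = (\<lambda>b. (-1) ^ b * p b)"
    define u where "u = comb (Suc j) c w"
    define y where "y = hankel_op g u"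
    have c_less: "c a < c b" if "a < b" "b < Suc j" for a b
      using increasing_less[of "Suc j" c] Suc.prems(3) that by blast
    have "inj_on c {..<Suc j}"
      unfolding inj_on_def by (metis c_less lessThan_iff linorder_neqE_nat less_irrefl)
    then have u_c: "u (c b) = w b" if "b < Suc j" for b
      unfolding u_def using that by (rule comb_at)
    have u_alt: "u (c b) \<noteq> 0 \<and> sgn (u (c b)) = 1 * (-1) ^ b" if "b \<le> j" for b
      using u_c[of b] p_pos[of b] that by (simp add: w_def sgn_mult)
    have w_eq: "w b = (\<Sum>a<Suc j. (-1) ^ a * fcof (Suc j) A a b)" for b
    proof -
      have "(-1) ^ b * ((-1) ^ (a + b) * x) = (-1) ^ a * x" for a and x :: real
      proof -
        have "(-1) ^ b * ((-1) ^ (a + b) * x) = (-1) ^ (b + b) * ((-1) ^ a * x)"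
          by (simp only: power_add mult_ac)
        then show ?thesis by simp
      qed
      then show ?thesis
        unfolding w_def p_def fcof_abs sum_distrib_left by (simp only:)
    qed
    have y_r: "y (r a) = (-1) ^ a * fdet (Suc j) A" if a: "a < Suc j" for a
    proof -
      have "y (r a) = (\<Sum>b<Suc j. A a b * w b)"
        by (simp add: y_def u_def hankel_op_comb A_def del: sum.lessThan_Suc)
      also have "\<dots> = (\<Sum>b<Suc j. \<Sum>i<Suc j. (-1) ^ i * (A a b * fcof (Suc j) A i b))"
        unfolding w_eq sum_distrib_left by (simp only: mult_ac)
      also have "\<dots> = (\<Sum>i<Suc j. (-1) ^ i * (\<Sum>b<Suc j. A a b * fcof (Suc j) A i b))"
        unfolding sum_distrib_left by (rule sum.swap)
      also have "\<dots> = (\<Sum>i<Suc j. if i = a then (-1) ^ i * fdet (Suc j) A else 0)"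
        using a by (intro sum.cong refl) (auto simp: fcof_row_orthogonal simp del: sum.lessThan_Suc)
      also have "\<dots> = (-1) ^ a * fdet (Suc j) A"
        using a by (simp del: sum.lessThan_Suc)
      finally show ?thesis .
    qed
    have y_alt: "y (r b) \<noteq> 0 \<and> sgn (y (r b)) = -1 * (-1) ^ b" if "b \<le> j" for b
      using y_r[of b] neg that by (simp add: sgn_mult)
    have var_u: "variation u = enat j"
    proof (rule antisym)
      show "variation u \<le> enat j" using comb_variation_le[of "Suc j" c w] by (simp add: u_def)
      show "enat j \<le> variation u"
        by (rule alternation_imp_variation[of j c u 1]) (use Suc.prems(3) u_alt in auto)
    qed
    have sign_u: "first_sign u = 1"
      by (rule alternation_imp_first_sign[of j c u 1, OF _ _ var_u]) (use Suc.prems(3) u_alt in auto)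
    have "enat j \<le> enat (k - 1)" using Suc.prems(1) by simp
    then have *: "variation y \<le> variation u" "variation u = variation y \<and> y \<noteq> (\<lambda>_. 0) \<longrightarrow> first_sign u = first_sign y"
      using ovd comb_in_hankel_domain[OF g, of "Suc j" c w] var_u
      unfolding hankel_ovd_def ovd_def y_def u_def[symmetric] by (metis min.boundedE)+
    have "enat j \<le> variation y"
      by (rule alternation_imp_variation[of j r y "-1"]) (use Suc.prems(2) y_alt in auto)
    then have var_y: "variation y = enat j" using *(1) var_u by simp
    have "first_sign y = -1"
      by (rule alternation_imp_first_sign[of j r y "-1", OF _ _ var_y]) (use Suc.prems(2) y_alt in auto)
    moreover have "y \<noteq> (\<lambda>_. 0)" using y_alt[of 0] by auto
    ultimately show False using * var_u var_y sign_u by simp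
  qed
qed simp

lemma hankel_ovd_cdet_nonneg:
  assumes "hankel_ovd (k - 1) g" "Bseq g" "j \<le> k" "1 \<le> t"
  shows "0 \<le> cdet j g t"
proof -
  have "0 \<le> fdet j (\<lambda>a b. g ((t - 1 + a) + Suc b))"
    by (rule ovd_minors_nonneg[OF assms(1-3), of "\<lambda>a. t - 1 + a" "\<lambda>b. b"]) auto
  moreover have "t - 1 + a + Suc b = t + a + b" for a b using assms(4) by simp
  ultimately show ?thesis unfolding cdet_def by (simp only:)
qed

section \<open>Nonnegative minors imply order preservation\<close>


locale block_input =
  fixes g u :: "nat \<Rightarrow> real" and m :: nat
  assumes var: "variation u = enat m" and nonzero: "u \<noteq> (\<lambda>_. 0)"
    and summable_input: "\<And>t. summable (\<lambda>i. g (t + Suc i) * u i)"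
begin

definition weight :: "nat \<Rightarrow> nat \<Rightarrow> real" where
  "weight b i = (if block u i = b then \<bar>u i\<bar> else 0)"

text \<open>Truncation of \<open>mode\<close>: multilinearity expands its minors into finite sums,
  and the minors of \<open>mode\<close> are their limits.\<close>

definition part :: "nat \<Rightarrow> nat \<Rightarrow> nat \<Rightarrow> real" where
  "part N t b = (\<Sum>i<N. weight b i * g (t + Suc i))"

definition mode :: "nat \<Rightarrow> nat \<Rightarrow> real" where
  "mode t b = (\<Sum>i. weight b i * g (t + Suc i))"

lemma abs_eq_block: "\<bar>u i\<bar> = first_sign u * (-1) ^ block u i * u i"
proof (cases "u i = 0")
  case False
  then show ?thesis using sgn_eq_block[of u i] by (metis abs_sgn mult.commute)
qed simp

lemma input_eq: "u i = first_sign u * (\<Sum>b<Suc m. (-1) ^ b * weight b i)"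
proof -
  have "(\<Sum>b<Suc m. (-1) ^ b * weight b i) = (\<Sum>b<Suc m. if b = block u i then (-1) ^ b * \<bar>u i\<bar> else 0)"
    by (intro sum.cong refl) (simp add: weight_def)
  also have "\<dots> = (-1) ^ block u i * \<bar>u i\<bar>"
    using block_le_variation[OF var, of i] by (subst sum.delta) auto
  finally have "first_sign u * (\<Sum>b<Suc m. (-1) ^ b * weight b i) = first_sign u * (-1) ^ block u i * \<bar>u i\<bar>"
    by (simp only: mult.assoc)
  also have "\<dots> = (if u i = 0 then 0 else sgn (u i) * \<bar>u i\<bar>)"
    by (simp add: sgn_eq_block)
  also have "\<dots> = u i" by (simp add: sgn_mult_abs)
  finally show ?thesis by simp
qed

text \<open>Splitting a conditionally convergent series needs care. Every block but the last is
  finite, and the last one is eventually the input itself up to a fixed sign.\<close>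

lemma weight_summable:
  assumes "b \<le> m"
  shows "summable (\<lambda>i. weight b i * g (t + Suc i))"
proof -
  obtain i0 where i0: "block u i0 = m"
    using block_attained[of m u] var nonzero by auto
  let ?c = "if b = m then first_sign u * (-1) ^ m else 0"
  have "weight b i * g (t + Suc i) = ?c * (g (t + Suc i) * u i)" if "i0 \<le> i" for i
  proof -
    have "block u i = m"
      using block_mono[OF that, of u] i0 block_le_variation[OF var, of i] by simp
    then show ?thesis using abs_eq_block[of i] by (simp add: weight_def)
  qed
  then have "\<forall>\<^sub>F i in sequentially. weight b i * g (t + Suc i) = ?c * (g (t + Suc i) * u i)"
    by (rule eventually_sequentiallyI)
  from summable_cong[OF this] show ?thesis
    using summable_mult[OF summable_input[of t], of ?c] by simp
qed

lemma part_tendsto: "b \<le> m \<Longrightarrow> (\<lambda>N. part N t b) \<longlonglongrightarrow> mode t b"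
  unfolding part_def mode_def by (intro summable_LIMSEQ weight_summable)

lemma output_eq: "hankel_op g u t = first_sign u * (\<Sum>b<Suc m. (-1) ^ b * mode t b)"
proof -
  have s: "summable (\<lambda>i. first_sign u * (-1) ^ b * (weight b i * g (t + Suc i)))" if "b \<in> {..<Suc m}" for b
    by (rule summable_mult, rule weight_summable) (use that in auto)
  have "hankel_op g u t = (\<Sum>i. \<Sum>b<Suc m. first_sign u * (-1) ^ b * (weight b i * g (t + Suc i)))"
    unfolding hankel_op_def
  proof (rule suminf_cong)
    fix i
    have "g (t + Suc i) * u i = g (t + Suc i) * (first_sign u * (\<Sum>b<Suc m. (-1) ^ b * weight b i))"
      using input_eq[of i] by simp
    then show "g (t + Suc i) * u i = (\<Sum>b<Suc m. first_sign u * (-1) ^ b * (weight b i * g (t + Suc i)))"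
      by (simp only: sum_distrib_left mult_ac)
  qed
  also have "\<dots> = (\<Sum>b<Suc m. \<Sum>i. first_sign u * (-1) ^ b * (weight b i * g (t + Suc i)))"
    by (rule suminf_sum) (rule s)
  also have "\<dots> = (\<Sum>b<Suc m. first_sign u * (-1) ^ b * mode t b)"
    unfolding mode_def by (intro sum.cong refl suminf_mult weight_summable) auto
  finally show ?thesis by (simp only: sum_distrib_left mult.assoc)
qed

lemma part_minor_expand:
  "fdet j (\<lambda>a b. part N (\<tau> a) (o' + b)) =
    (\<Sum>\<phi>\<in>PiE {..<j} (\<lambda>_. {..<N}). (\<Prod>b<j. weight (o' + b) (\<phi> b)) * fdet j (\<lambda>a b. g (\<tau> a + Suc (\<phi> b))))"
proof -
  have "fdet j (\<lambda>a b. part N (\<tau> a) (o' + b)) = fdet j (\<lambda>b a. \<Sum>c<N. weight (o' + b) c * g (\<tau> a + Suc c))"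
    by (subst fdet_transpose[symmetric]) (simp only: part_def)
  also have "\<dots> = (\<Sum>\<phi>\<in>PiE {..<j} (\<lambda>_. {..<N}). (\<Prod>b<j. weight (o' + b) (\<phi> b)) * fdet j (\<lambda>b a. g (\<tau> a + Suc (\<phi> b))))"
    by (rule fdet_sum_rows) simp
  also have "\<dots> = (\<Sum>\<phi>\<in>PiE {..<j} (\<lambda>_. {..<N}). (\<Prod>b<j. weight (o' + b) (\<phi> b)) * fdet j (\<lambda>a b. g (\<tau> a + Suc (\<phi> b))))"
  proof (rule sum.cong[OF refl])
    fix \<phi>
    show "(\<Prod>b<j. weight (o' + b) (\<phi> b)) * fdet j (\<lambda>b a. g (\<tau> a + Suc (\<phi> b))) =
        (\<Prod>b<j. weight (o' + b) (\<phi> b)) * fdet j (\<lambda>a b. g (\<tau> a + Suc (\<phi> b)))"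
      using fdet_transpose[of j "\<lambda>a b. g (\<tau> a + Suc (\<phi> b))"] by simp
  qed
  finally show ?thesis .
qed

text \<open>A nonzero weight product forces \<open>\<phi> b\<close> into block
  \<open>o' + b\<close>. Blocks follow one another, so \<open>\<phi>\<close> is increasing and the
  minor has its columns in order.\<close>

lemma minor_term_nonneg:
  assumes minor: "\<And>c. (\<And>b. Suc b < j \<Longrightarrow> c b < c (Suc b)) \<Longrightarrow> 0 \<le> fdet j (\<lambda>a b. g (\<tau> a + Suc (c b)))"
  shows "0 \<le> (\<Prod>b<j. weight (o' + b) (\<phi> b)) * fdet j (\<lambda>a b. g (\<tau> a + Suc (\<phi> b)))"
proof (cases "\<exists>b<j. weight (o' + b) (\<phi> b) = 0")
  case True
  then have "(\<Prod>b<j. weight (o' + b) (\<phi> b)) = 0" by (intro prod_zero) auto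
  then show ?thesis by (simp only: mult_zero_left order_refl)
next
  case False
  have "0 \<le> fdet j (\<lambda>a b. g (\<tau> a + Suc (\<phi> b)))"
  proof (rule minor)
    fix b assume b: "Suc b < j"
    then have "weight (o' + b) (\<phi> b) \<noteq> 0" "weight (o' + Suc b) (\<phi> (Suc b)) \<noteq> 0"
      using False Suc_lessD by blast+
    then have "block u (\<phi> b) = o' + b" "block u (\<phi> (Suc b)) = o' + Suc b"
      by (auto simp: weight_def split: if_splits)
    then show "\<phi> b < \<phi> (Suc b)" using block_less[of u "\<phi> b" "\<phi> (Suc b)"] by simp
  qed
  moreover have "0 \<le> (\<Prod>b<j. weight (o' + b) (\<phi> b))"
    by (intro prod_nonneg) (simp add: weight_def)
  ultimately show ?thesis by simp
qed

lemma mode_minor_tendsto: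
  assumes "o' + j \<le> Suc m"
  shows "(\<lambda>N. fdet j (\<lambda>a b. part N (\<tau> a) (o' + b))) \<longlonglongrightarrow> fdet j (\<lambda>a b. mode (\<tau> a) (o' + b))"
  by (intro tendsto_fdet part_tendsto) (use assms in simp)

lemma mode_minor_nonneg:
  assumes "o' + j \<le> Suc m"
    and "\<And>c. (\<And>b. Suc b < j \<Longrightarrow> c b < c (Suc b)) \<Longrightarrow> 0 \<le> fdet j (\<lambda>a b. g (\<tau> a + Suc (c b)))"
  shows "0 \<le> fdet j (\<lambda>a b. mode (\<tau> a) (o' + b))"
  using mode_minor_tendsto[OF assms(1), of \<tau>]
proof (rule LIMSEQ_le_const)
  show "\<exists>N. \<forall>n\<ge>N. 0 \<le> fdet j (\<lambda>a b. part n (\<tau> a) (o' + b))"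
    unfolding part_minor_expand by (intro exI allI impI sum_nonneg minor_term_nonneg assms(2))
qed

text \<open>A limit of positive numbers could be 0. The term \<delta> for one nonzero entry from
  each block occurs in every long enough truncation, where the other terms are nonnegative, and so
  bounds the limit.\<close>

lemma mode_minor_pos:
  assumes "o' + j \<le> Suc m"
    and pos: "\<And>c. (\<And>b. Suc b < j \<Longrightarrow> c b < c (Suc b)) \<Longrightarrow> 0 < fdet j (\<lambda>a b. g (\<tau> a + Suc (c b)))"
  shows "0 < fdet j (\<lambda>a b. mode (\<tau> a) (o' + b))"
proof -
  have "\<exists>i. u i \<noteq> 0 \<and> block u i = b" if "b \<le> m" for b
    using block_attained[of b u] var nonzero that by simp
  then obtain s where s: "\<And>b. b \<le> m \<Longrightarrow> u (s b) \<noteq> 0 \<and> block u (s b) = b" by metis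
  define \<phi> where "\<phi> = restrict (\<lambda>b. s (o' + b)) {..<j}"
  have \<phi>: "u (\<phi> b) \<noteq> 0" "block u (\<phi> b) = o' + b" if "b < j" for b
    using s[of "o' + b"] assms(1) that by (auto simp: \<phi>_def)
  define \<delta> where "\<delta> = (\<Prod>b<j. weight (o' + b) (\<phi> b)) * fdet j (\<lambda>a b. g (\<tau> a + Suc (\<phi> b)))"
  have "0 < (\<Prod>b<j. weight (o' + b) (\<phi> b))"
    by (intro prod_pos) (simp add: weight_def \<phi>)
  moreover have "0 < fdet j (\<lambda>a b. g (\<tau> a + Suc (\<phi> b)))"
    by (rule pos, rule block_less[of u]) (simp add: \<phi>)
  ultimately have \<delta>: "0 < \<delta>" by (simp add: \<delta>_def)
  have "\<delta> \<le> fdet j (\<lambda>a b. mode (\<tau> a) (o' + b))"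
    using mode_minor_tendsto[OF assms(1), of \<tau>]
  proof (rule LIMSEQ_le_const)
    show "\<exists>N0. \<forall>N\<ge>N0. \<delta> \<le> fdet j (\<lambda>a b. part N (\<tau> a) (o' + b))"
    proof (intro exI allI impI)
      fix N assume N: "Suc (\<Sum>b<j. \<phi> b) \<le> N"
      have "\<phi> b < N" if "b < j" for b
        using member_le_sum[of b "{..<j}" \<phi>] that N by simp
      then have mem: "\<phi> \<in> PiE {..<j} (\<lambda>_. {..<N})" by (auto simp: \<phi>_def)
      show "\<delta> \<le> fdet j (\<lambda>a b. part N (\<tau> a) (o' + b))"
        unfolding part_minor_expand \<delta>_def
      proof (rule member_le_sum[OF mem])
        fix \<psi>
        show "0 \<le> (\<Prod>b<j. weight (o' + b) (\<psi> b)) * fdet j (\<lambda>a b. g (\<tau> a + Suc (\<psi> b)))"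
          by (rule minor_term_nonneg) (rule less_imp_le[OF pos])
      qed (simp add: finite_PiE)
    qed
  qed
  with \<delta> show ?thesis by simp
qed

text \<open>Replacing the first column of the mode matrix by the output multiplies its determinant by the
  first sign of \<open>u\<close>; expanding along that column shows the sign of the output.\<close>
lemma output_alternation_sign:
  assumes nonneg: "\<And>r c. (\<And>a. Suc a < Suc m \<Longrightarrow> r a < r (Suc a)) \<Longrightarrow> (\<And>b. Suc b < Suc m \<Longrightarrow> c b < c (Suc b)) \<Longrightarrow>
      0 \<le> fdet (Suc m) (\<lambda>a b. g (r a + Suc (c b)))"
    and pos: "\<And>r c. (\<And>a. Suc a < m \<Longrightarrow> r a < r (Suc a)) \<Longrightarrow> (\<And>b. Suc b < m \<Longrightarrow> c b < c (Suc b)) \<Longrightarrow>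
      0 < fdet m (\<lambda>a b. g (r a + Suc (c b)))"
    and mono: "\<And>a. a < m \<Longrightarrow> \<tau> a < \<tau> (Suc a)"
    and alt: "\<And>a. a \<le> m \<Longrightarrow> hankel_op g u (\<tau> a) \<noteq> 0 \<and> sgn (hankel_op g u (\<tau> a)) = \<rho> * (-1) ^ a"
  shows "\<rho> = first_sign u"
proof -
  define y where "y = (\<lambda>a. hankel_op g u (\<tau> a))"
  define F where "F = (\<lambda>a b. mode (\<tau> a) b)"
  define h where "h = (\<lambda>a. fdet m (\<lambda>a' b. F (if a' < a then a' else Suc a') (Suc b)))"
  have fcof: "fcof (Suc m) F a 0 = (-1) ^ a * h a" for a
    by (simp add: fcof_def h_def)
  have h_pos: "0 < h a" for a
  proof -
    define \<tau>' where "\<tau>' = (\<lambda>a'. \<tau> (if a' < a then a' else Suc a'))"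
    have "0 < fdet m (\<lambda>a' b. mode (\<tau>' a') (1 + b))"
    proof (rule mode_minor_pos)
      fix c :: "nat \<Rightarrow> nat" assume "\<And>b. Suc b < m \<Longrightarrow> c b < c (Suc b)"
      moreover have "\<tau>' a' < \<tau>' (Suc a')" if "Suc a' < m" for a'
        unfolding \<tau>'_def by (rule increasing_skip[where m = m and r = \<tau>]) (use mono that in auto)
      ultimately show "0 < fdet m (\<lambda>a b. g (\<tau>' a + Suc (c b)))"
        by (intro pos)
    qed simp
    then show ?thesis by (simp add: h_def F_def \<tau>'_def)
  qed
  have D: "0 \<le> fdet (Suc m) F"
  proof -
    have "0 \<le> fdet (Suc m) (\<lambda>a b. mode (\<tau> a) (0 + b))"
      by (rule mode_minor_nonneg, simp, rule nonneg) (use mono in auto)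
    then show ?thesis by (simp add: F_def)
  qed
  have "(\<Sum>a<Suc m. y a * fcof (Suc m) F a 0) =
      (\<Sum>a<Suc m. \<Sum>b<Suc m. first_sign u * (-1) ^ b * (F a b * fcof (Suc m) F a 0))"
    unfolding y_def output_eq F_def sum_distrib_left sum_distrib_right by (simp only: mult_ac)
  also have "\<dots> = (\<Sum>b<Suc m. first_sign u * (-1) ^ b * (\<Sum>a<Suc m. F a b * fcof (Suc m) F a 0))"
    unfolding sum_distrib_left by (rule sum.swap)
  also have "\<dots> = (\<Sum>b<Suc m. if b = 0 then first_sign u * (-1) ^ b * fdet (Suc m) F else 0)"
    by (intro sum.cong refl) (auto simp: fcof_col_orthogonal simp del: sum.lessThan_Suc)
  also have "\<dots> = first_sign u * fdet (Suc m) F"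
    by (subst sum.delta) auto
  finally have 1: "(\<Sum>a<Suc m. y a * fcof (Suc m) F a 0) = first_sign u * fdet (Suc m) F" .
  \<comment> \<open>The alternating signs of output and cofactors cancel, so every term has sign
    \<open>\<rho>\<close> and the sum is nonzero. This forces the determinant of \<open>F\<close>,
    so far only nonnegative, to be positive, and the two signs to agree.\<close>
  have "y a * fcof (Suc m) F a 0 = \<rho> * (\<bar>y a\<bar> * h a)" if "a < Suc m" for a
  proof -
    have "y a = \<rho> * (-1) ^ a * \<bar>y a\<bar>"
      using alt[of a] that by (metis less_Suc_eq_le sgn_mult_abs y_def)
    then have "y a * fcof (Suc m) F a 0 = \<rho> * (-1) ^ a * \<bar>y a\<bar> * ((-1) ^ a * h a)"
      using fcof by simp
    also have "\<dots> = (-1) ^ (a + a) * (\<rho> * (\<bar>y a\<bar> * h a))"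
      by (simp only: power_add mult_ac)
    finally show ?thesis by simp
  qed
  then have "(\<Sum>a<Suc m. y a * fcof (Suc m) F a 0) = \<rho> * (\<Sum>a<Suc m. \<bar>y a\<bar> * h a)"
    unfolding sum_distrib_left by (intro sum.cong) auto
  then have eq: "\<rho> * (\<Sum>a<Suc m. \<bar>y a\<bar> * h a) = first_sign u * fdet (Suc m) F"
    using 1 by simp
  have S: "0 < (\<Sum>a<Suc m. \<bar>y a\<bar> * h a)"
    by (intro sum_pos) (use alt h_pos in \<open>auto simp: y_def\<close>)
  have "\<rho> = sgn (y 0)" "y 0 \<noteq> 0" using alt[of 0] by (auto simp: y_def)
  then have "\<rho> = 1 \<or> \<rho> = -1" by (auto simp: sgn_real_def)
  then show ?thesis
    using first_sign_cases[OF nonzero] eq S D by auto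
qed

end

lemma hankel_minors_pos_minor:
  assumes sp: "hankel_minors_pos k g" and "j \<le> k"
    and "\<And>a. Suc a < j \<Longrightarrow> r a < r (Suc a)" "\<And>b. Suc b < j \<Longrightarrow> c b < c (Suc b)"
  shows "0 \<le> fdet j (\<lambda>a b. g (r a + Suc (c b)))"
    and "j < k \<Longrightarrow> 0 < fdet j (\<lambda>a b. g (r a + Suc (c b)))"
proof -
  have eq: "1 + r a + c b = r a + Suc (c b)" for a b by simp
  have pos: "0 < cdet i g t" if "i < k" "1 \<le> t" for i t
    using sp that by (simp add: hankel_minors_pos_def)
  have "0 \<le> cdet j g t" if "1 \<le> t" for t
    using sp assms(2) that by (cases "j = k") (auto simp: hankel_minors_pos_def intro: less_imp_le)
  then have "0 \<le> fdet j (\<lambda>a b. g (1 + r a + c b))"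
    using assms(2) by (intro fekete_hankel_nonneg[of j 1 g] pos assms(3,4)) simp_all
  then show "0 \<le> fdet j (\<lambda>a b. g (r a + Suc (c b)))" by (simp only: eq)
  assume "j < k"
  then have "0 < fdet j (\<lambda>a b. g (1 + r a + c b))"
    by (intro fekete_hankel_pos[of j 1 g] pos assms(3,4)) simp_all
  then show "0 < fdet j (\<lambda>a b. g (r a + Suc (c b)))" by (simp only: eq)
qed

lemma hankel_minors_pos_imp_ovd:
  assumes sp: "hankel_minors_pos k g" and k: "1 \<le> k"
    and rank: "k \<le> op_rank (hankel_domain g) (hankel_op g)"
  shows "hankel_ovd (k - 1) g"
  unfolding hankel_ovd_def ovd_def
proof (intro ballI impI)
  fix u assume u: "u \<in> hankel_domain g" and var: "variation u \<le> enat (k - 1)"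
  let ?y = "hankel_op g u"
  let ?r = "op_rank (hankel_domain g) (hankel_op g)"
  have zero: "variation (\<lambda>_. 0) = 0"
    by (simp add: variation_def sign_changes_def zero_enat_def)
  show "variation ?y \<le> min (enat (?r - 1)) (variation u) \<and>
      (variation u = variation ?y \<and> ?y \<noteq> (\<lambda>_. 0) \<longrightarrow> first_sign u = first_sign ?y)"
  proof (cases "?y = (\<lambda>_. 0)")
    case True
    then show ?thesis by (simp add: zero)
  next
    case False
    then have "u \<noteq> (\<lambda>_. 0)" by (auto simp: hankel_op_def)
    obtain m where m: "variation u = enat m" "m \<le> k - 1"
      using var by (cases "variation u") auto
    interpret block_input g u m
      by unfold_locales (use m u \<open>u \<noteq> _\<close> in \<open>auto simp: hankel_domain_def\<close>)
    have sign: "\<rho> = first_sign u"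
      if "\<And>a. a < m \<Longrightarrow> \<tau> a < \<tau> (Suc a)"
        "\<And>a. a \<le> m \<Longrightarrow> ?y (\<tau> a) \<noteq> 0 \<and> sgn (?y (\<tau> a)) = \<rho> * (-1) ^ a" for \<tau> \<rho>
    proof (rule output_alternation_sign[OF _ _ that])
      show "0 \<le> fdet (Suc m) (\<lambda>a b. g (r a + Suc (c b)))"
        if "\<And>a. Suc a < Suc m \<Longrightarrow> r a < r (Suc a)" "\<And>b. Suc b < Suc m \<Longrightarrow> c b < c (Suc b)" for r c
        using sp m k that by (intro hankel_minors_pos_minor(1)[where k = k]) auto
      show "0 < fdet m (\<lambda>a b. g (r a + Suc (c b)))"
        if "\<And>a. Suc a < m \<Longrightarrow> r a < r (Suc a)" "\<And>b. Suc b < m \<Longrightarrow> c b < c (Suc b)" for r c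
        using sp m k that by (intro hankel_minors_pos_minor(2)[where k = k]) auto
    qed
    \<comment> \<open>An alternation of the output with \<open>m + 1\<close> changes contains two
      with \<open>m\<close> changes that begin with opposite signs, yet both would have to begin
      with the first sign of \<open>u\<close>.\<close>
    have le: "variation ?y \<le> enat m"
    proof (rule ccontr)
      assume "\<not> ?thesis"
      then have "enat (Suc m) \<le> variation ?y"
        by (cases "variation ?y") auto
      from variation_imp_alternation[OF this False] obtain t where
        t: "\<And>b. b < Suc m \<Longrightarrow> t b < t (Suc b)"
          "\<And>b. b \<le> Suc m \<Longrightarrow> ?y (t b) \<noteq> 0 \<and> sgn (?y (t b)) = first_sign ?y * (-1) ^ b"
        by blast
      have "first_sign ?y = first_sign u"
        by (rule sign[of t]) (use t in auto)
      moreover have "- first_sign ?y = first_sign u"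
        by (rule sign[of "\<lambda>b. t (Suc b)"]) (use t in auto)
      ultimately show False using first_sign_cases[OF False] by auto
    qed
    have "first_sign u = first_sign ?y" if "variation u = variation ?y"
    proof -
      have "enat m \<le> variation ?y" using that m by simp
      from variation_imp_alternation[OF this False] obtain t where
        "\<And>b. b < m \<Longrightarrow> t b < t (Suc b)"
        "\<And>b. b \<le> m \<Longrightarrow> ?y (t b) \<noteq> 0 \<and> sgn (?y (t b)) = first_sign ?y * (-1) ^ b"
        by blast
      then show ?thesis using sign[of t "first_sign ?y"] by simp
    qed
    \<comment> \<open>The rank bound is implied by \<open>m \<le> k - 1\<close>, as the rank is at
      least \<open>k\<close>.\<close>
    moreover have "enat m \<le> enat (?r - 1)" using m(2) rank k by simp
    ultimately show ?thesis using le m by (auto intro: order_trans)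
  qed
qed

section \<open>The rank of the Hankel operator\<close>


lemma seq_sum_apply: "(\<Sum>v\<in>S. f v) t = (\<Sum>v\<in>S. f v t :: real)"
  by (induction S rule: infinite_finite_induct) (auto simp: zero_fun_def plus_fun_def)

text \<open>The dimension is a cardinality and would be 0 for an infinite basis, so a lower bound
  calls for a finite spanning set.\<close>

lemma seq_card_le_dim:
  assumes "B \<subseteq> V" "seq.independent B" "V \<subseteq> seq.span W" "finite W"
  shows "card B \<le> seq.dim V"
proof -
  obtain B' where B': "B \<subseteq> B'" "B' \<subseteq> V" "seq.independent B'" "V \<subseteq> seq.span B'"
    using seq.maximal_independent_subset_extend[OF assms(1,2)] by blast
  have "finite B'"
    using seq.independent_span_bound[OF assms(4) B'(3)] B'(2) assms(3) by blast
  then have "card B \<le> card B'" using B'(1) by (rule card_mono)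
  also have "card B' = seq.dim V" by (rule seq.basis_card_eq_dim[OF B'(2,4,3)])
  finally show ?thesis .
qed

text \<open>The solution of a monic recurrence of order \<open>d\<close> with coefficients
  \<open>q\<close> whose initial values form the \<open>i\<close>-th unit vector.\<close>

function fundamental :: "nat \<Rightarrow> (nat \<Rightarrow> real) \<Rightarrow> nat \<Rightarrow> nat \<Rightarrow> real" where
  "fundamental d q i t =
    (if t < d then (if t = i then 1 else 0) else - (\<Sum>b<d. q b * fundamental d q i (t - d + b)))"
  by auto
termination
  by (relation "measure (\<lambda>(d, q, i, t). t)") auto

declare fundamental.simps [simp del]

lemma recurrence_solution_eq:
  assumes rec: "\<And>t. y (t + d) = - (\<Sum>b<d. q b * y (t + b))"
  shows "y t = (\<Sum>i<d. y i * fundamental d q i t)"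
proof (induction t rule: less_induct)
  case (less t)
  show ?case
  proof (cases "t < d")
    case True
    then have "(\<Sum>i<d. y i * fundamental d q i t) = (\<Sum>i<d. if i = t then y i else 0)"
      by (intro sum.cong refl) (simp add: fundamental.simps)
    then show ?thesis using True by simp
  next
    case False
    have "y t = - (\<Sum>b<d. q b * y (t - d + b))"
      using rec[of "t - d"] False by simp
    also have "\<dots> = - (\<Sum>b<d. q b * (\<Sum>i<d. y i * fundamental d q i (t - d + b)))"
      using False by (intro arg_cong[of _ _ uminus] sum.cong refl) (subst less.IH, auto)
    also have "\<dots> = - (\<Sum>i<d. \<Sum>b<d. q b * (y i * fundamental d q i (t - d + b)))"
      unfolding sum_distrib_left by (intro arg_cong[of _ _ uminus] sum.swap)
    also have "\<dots> = (\<Sum>i<d. y i * - (\<Sum>b<d. q b * fundamental d q i (t - d + b)))"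
      by (simp add: sum_distrib_left sum_negf mult_ac)
    also have "\<dots> = (\<Sum>i<d. y i * fundamental d q i t)"
      using False by (subst (2) fundamental.simps) simp
    finally show ?thesis .
  qed
qed

lemma system_minimal_recurrence:
  "is_system P Q g \<Longrightarrow> minimal_recurrence g (system_order Q)"
  by unfold_locales (rule system_order_minimal)

text \<open>Every output inherits the recurrence of the denominator, by exchanging a finite sum with
  the series, and so is a combination of \<open>degree Q\<close> fundamental solutions.\<close>

lemma hankel_range_finite_dim:
  assumes sys: "is_system P Q g"
  shows "\<exists>W. finite W \<and> hankel_op g ` hankel_domain g \<subseteq> seq.span W"
proof -
  define d where "d = degree Q"
  define q where "q = (\<lambda>b. coeff Q b / lead_coeff Q)"
  have lead: "lead_coeff Q \<noteq> 0" using system_denominator(1)[OF sys] by simp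
  let ?W = "fundamental d q ` {..<d}"
  have "hankel_op g u \<in> seq.span ?W" if u: "u \<in> hankel_domain g" for u
  proof -
    let ?y = "hankel_op g u"
    have summ: "summable (\<lambda>i. g (t + Suc i) * u i)" for t
      using u by (simp add: hankel_domain_def)
    have zero: "(\<Sum>b\<le>d. coeff Q b * ?y (t + b)) = 0" for t
    proof -
      have "(\<Sum>b\<le>d. coeff Q b * ?y (t + b)) = (\<Sum>b\<le>d. \<Sum>i. coeff Q b * (g (t + b + Suc i) * u i))"
        unfolding hankel_op_def by (intro sum.cong refl suminf_mult[symmetric] summ)
      also have "\<dots> = (\<Sum>i. \<Sum>b\<le>d. coeff Q b * (g (t + b + Suc i) * u i))"
        by (rule suminf_sum[symmetric]) (intro summable_mult summ)
      also have "\<dots> = (\<Sum>i. 0)"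
      proof (rule suminf_cong)
        fix i
        have "(\<Sum>b\<le>d. coeff Q b * (g (t + b + Suc i) * u i)) = (\<Sum>b\<le>d. coeff Q b * g ((t + Suc i) + b)) * u i"
          unfolding sum_distrib_right by (intro sum.cong refl) (simp add: ac_simps)
        then show "(\<Sum>b\<le>d. coeff Q b * (g (t + b + Suc i) * u i)) = 0"
          using system_recurrence_nat[OF sys, of "t + Suc i"] by (simp add: d_def)
      qed
      finally show ?thesis by simp
    qed
    have "?y (t + d) = - (\<Sum>b<d. coeff Q b * ?y (t + b)) / lead_coeff Q" for t
    proof -
      have "(\<Sum>b<d. coeff Q b * ?y (t + b)) + lead_coeff Q * ?y (t + d) = 0"
        using zero[of t] unfolding lessThan_Suc_atMost[symmetric] sum.lessThan_Suc by (simp only: d_def)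
      then have "lead_coeff Q * ?y (t + d) = - (\<Sum>b<d. coeff Q b * ?y (t + b))"
        by linarith
      then show ?thesis using lead by (metis nonzero_mult_div_cancel_left)
    qed
    then have "?y (t + d) = - (\<Sum>b<d. q b * ?y (t + b))" for t
      by (simp add: q_def sum_divide_distrib)
    then have sol: "?y t = (\<Sum>i<d. ?y i * fundamental d q i t)" for t
      by (rule recurrence_solution_eq)
    have "?y = (\<Sum>i<d. seq_scale (?y i) (fundamental d q i))"
      unfolding seq_scale_def by (rule ext) (simp only: seq_sum_apply, rule sol)
    also have "\<dots> \<in> seq.span ?W"
      by (intro seq.span_sum seq.span_scale seq.span_base) auto
    finally show ?thesis .
  qed
  then show ?thesis by (intro exI[of _ ?W]) auto
qed

text \<open>Unit impulses produce the shifts of \<open>g\<close>. A linear relation among the first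
  \<open>k\<close> of them would be a recurrence of order \<open>k - 1\<close>, below the minimal
  one.\<close>

lemma order_le_hankel_rank:
  assumes sys: "is_system P Q g" and k: "1 \<le> k" "k \<le> system_order Q"
  shows "k \<le> op_rank (hankel_domain g) (hankel_op g)"
proof -
  interpret minimal_recurrence g "system_order Q"
    using sys by (rule system_minimal_recurrence)
  define S where "S = (\<lambda>i t. g (t + Suc i))"
  have indep: "x i = 0" if x: "\<And>t. (\<Sum>i<k. x i * S i t) = 0" and "i < k" for x i
  proof (rule ccontr)
    assume "x i \<noteq> 0"
    have "system_order Q \<le> k - 1"
    proof (rule minimal)
      show "\<exists>b\<le>k - 1. x b \<noteq> 0" using \<open>i < k\<close> \<open>x i \<noteq> 0\<close> by (intro exI[of _ i]) auto
      show "(\<Sum>b<Suc (k - 1). x b * g (s + b)) = 0" if "1 \<le> s" for s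
        using x[of "s - 1"] that k by (simp add: S_def)
    qed
    then show False using k by simp
  qed
  have inj: "inj_on S {..<k}"
  proof (rule inj_onI, rule ccontr)
    fix i j assume ij: "i \<in> {..<k}" "j \<in> {..<k}" "S i = S j" "i \<noteq> j"
    have "(if i = i then 1 else if i = j then -1 else 0 :: real) = 0"
    proof (rule indep[of "\<lambda>l. if l = i then 1 else if l = j then -1 else 0"])
      fix t
      have "(\<Sum>l<k. (if l = i then 1 else if l = j then -1 else 0) * S l t) =
          (\<Sum>l<k. (if l = i then S l t else 0) - (if l = j then S l t else 0))"
        using ij by (intro sum.cong) auto
      also have "\<dots> = S i t - S j t" using ij by (simp add: sum_subtractf)
      finally show "(\<Sum>l<k. (if l = i then 1 else if l = j then -1 else 0) * S l t) = 0"
        using ij by simp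
    qed (use ij in auto)
    then show False by simp
  qed
  have "seq.independent (S ` {..<k})"
  proof
    assume "seq.dependent (S ` {..<k})"
    then obtain c where c: "\<exists>v\<in>S ` {..<k}. c v \<noteq> 0" "(\<Sum>v\<in>S ` {..<k}. seq_scale (c v) v) = 0"
      by (auto simp: seq.dependent_finite)
    have "(\<Sum>i<k. seq_scale (c (S i)) (S i)) = 0"
      using c(2) inj by (simp add: sum.reindex)
    then have "(\<Sum>i<k. c (S i) * S i t) = 0" for t
      using seq_sum_apply[of "\<lambda>i. seq_scale (c (S i)) (S i)" "{..<k}" t]
      by (simp add: seq_scale_def zero_fun_def)
    then have "c (S i) = 0" if "i < k" for i using that by (rule indep)
    then show False using c(1) by auto
  qed
  moreover have "S ` {..<k} \<subseteq> hankel_op g ` hankel_domain g"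
  proof
    fix v assume "v \<in> S ` {..<k}"
    then obtain i where "v = S i" by auto
    also have "S i = hankel_op g (comb 1 (\<lambda>_. i) (\<lambda>_. 1))"
      by (simp add: fun_eq_iff hankel_op_comb S_def)
    finally show "v \<in> hankel_op g ` hankel_domain g"
      using comb_in_hankel_domain[OF system_denominator(4)[OF sys]] by blast
  qed
  moreover obtain W where "finite W" "hankel_op g ` hankel_domain g \<subseteq> seq.span W"
    using hankel_range_finite_dim[OF sys] by blast
  ultimately have "card (S ` {..<k}) \<le> seq.dim (hankel_op g ` hankel_domain g)"
    by (intro seq_card_le_dim)
  then show ?thesis
    using inj by (simp add: op_rank_def card_image)
qed

theorem theorem1:
  fixes P Q :: "real poly" and g :: "nat \<Rightarrow> real" and n k :: nat
  assumes "is_system P Q g"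
    and "n = system_order Q"
    and "1 \<le> k" and "k \<le> n"
  shows "(hankel_ovd (k - 1) g \<longleftrightarrow> hankel_k_positive k g) \<and>
         (hankel_k_positive k g \<longleftrightarrow> (\<forall>j\<in>{1..k}. externally_positive (compound j g))) \<and>
         ((\<forall>j\<in>{1..k}. externally_positive (compound j g)) \<longleftrightarrow>
            pos_def (hankel_mat g 1 (k - 1)) \<and> pos_semidef (hankel_mat g 2 (k - 1)) \<and>
            externally_positive (compound k g)) \<and>
         (pos_def (hankel_mat g 1 (k - 1)) \<and> pos_semidef (hankel_mat g 2 (k - 1)) \<and>
            externally_positive (compound k g) \<longleftrightarrow>
            (\<forall>j\<in>{1..k}. hankel_k_positive (k - j + 1) (compound j g)))"
proof -
  interpret minimal_recurrence g n
    using system_minimal_recurrence[OF assms(1)] assms(2) by simp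
  have "hankel_ovd (k - 1) g \<longleftrightarrow> hankel_minors_pos k g"
  proof
    \<comment> \<open>Order preservation gives only nonnegative determinants; their strictness below
      \<open>k\<close> comes from minimality, through the equivalence with (iii).\<close>
    assume "hankel_ovd (k - 1) g"
    then have "0 \<le> cdet j g t" if "j \<le> k" "1 \<le> t" for j t
      using hankel_ovd_cdet_nonneg system_denominator(4)[OF assms(1)] that by blast
    then have "\<forall>j\<in>{1..k}. externally_positive (compound j g)"
      by (simp add: externally_positive_compound_iff)
    then show "hankel_minors_pos k g"
      using hankel_minors_pos_iff_externally_positive[OF assms(4,3)] by simp
  next
    assume "hankel_minors_pos k g"
    then show "hankel_ovd (k - 1) g"
      using order_le_hankel_rank[OF assms(1)] assms by (intro hankel_minors_pos_imp_ovd) auto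
  qed
  then show ?thesis
    by (simp only: simp_thms hankel_minors_pos_iff_externally_positive[OF assms(4,3), symmetric]
        hankel_minors_pos_iff_definite[OF assms(4,3), symmetric]
        hankel_minors_pos_iff_k_positive[OF assms(4,3), symmetric]
        hankel_minors_pos_iff_compound_k_positive[OF assms(4,3), symmetric])
qed


end
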